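(* Let $\Lambda_{10}=\{\frac{i}{1024}: i=0,1,\dots,1023\}$ and $$\Lambda_{10}^{U}=\left\{\tfrac{192}{1024},\tfrac{309}{1024},\tfrac{390}{1024},\tfrac{391}{1024},\tfrac{832}{1024},\tfrac{715}{1024},\tfrac{634}{1024},\tfrac{633}{1024}\right\}.$$ For every $c\in\Lambda_{10}\setminus\Lambda_{10}^{U}$, the potential $g^{(c)}(x)=\log|\cos\pi(x+c)|$ has a unique maximizing measure $\mu_c$ for the doubling map, $\mu_c$ is a periodic measure, and $$\Delta^{(c)}=1+\frac{\int g^{(c)}\,d\mu_c}{\log 2}.$$
   Context: For $n\in\mathbb{N}$ (including $n=0$) let $s(n)$ be the sum of the binary digits of $n$, and for $c\in[0,1)$ let $t^{(c)}(n):=e^{2\pi i c\,s(n)}$ (the weighted $(c)$-Thue-Morse sequence). The Gelfond exponent $\Delta^{(c)}$ is the smallest $\alpha$ such that $\max_{0\le t\le1}\left|\sum_{n=0}^{N-1}t^{(c)}(n)e^{2\pi i nt}\right|=O(N^{\alpha})$ as $N\to\infty$. The doubling map is $f(x)=2x\pmod 1$ on $\mathcal{S}=\mathbb{R}/\mathbb{Z}$; $\mathrm{Inv}(f)$ is the set of $f$-invariant Borel probability measures. The function $g^{(c)}$ is upper semi-continuous with the convention $\log 0=-\infty$. A measure $\mu\in\mathrm{Inv}(f)$ is maximizing for $g^{(c)}$ if $\int g^{(c)}d\mu=\sup_{\nu\in\mathrm{Inv}(f)}\int g^{(c)}d\nu$. A measure in $\mathrm{Inv}(f)$ is periodic if it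 is supported on a periodic orbit of $f$. *)

theory Defs
  imports "HOL-Probability.Probability" "HOL-Library.Landau_Symbols"
begin

fun binary_digit_sum :: "nat \<Rightarrow> nat" where
  "binary_digit_sum n = (if n = 0 then 0 else n mod 2 + binary_digit_sum (n div 2))"

declare binary_digit_sum.simps [simp del]

definition thue_morse :: "real \<Rightarrow> nat \<Rightarrow> complex" where
  "thue_morse c n = cis (2 * pi * c * real (binary_digit_sum n))"

text \<open>The supremum below is a maximum, as a continuous function on a compact interval is
  maximised.\<close>

definition thue_morse_max :: "real \<Rightarrow> nat \<Rightarrow> real" where
  "thue_morse_max c N =
     (SUP t\<in>{0..1}. cmod (\<Sum>n<N. thue_morse c n * cis (2 * pi * real n * t)))"

text \<open>``Smallest'' is read as an attained minimum, so the predicate includes the existence of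
  that minimum; there is at most one such \<open>\<alpha>\<close>.\<close>

definition is_gelfond_exponent :: "real \<Rightarrow> real \<Rightarrow> bool" where
  "is_gelfond_exponent c \<alpha> \<longleftrightarrow>
     thue_morse_max c \<in> O(\<lambda>N. real N powr \<alpha>) \<and>
     (\<forall>\<beta>. thue_morse_max c \<in> O(\<lambda>N. real N powr \<beta>) \<longrightarrow> \<alpha> \<le> \<beta>)"

text \<open>The circle \<open>\<real>/\<int>\<close> is represented by its fundamental domain \<open>[0,1)\<close>. The canonical bijection
  identifies the Borel sets of the quotient with the Borel subsets of \<open>[0,1)\<close>.\<close>

definition circle_borel :: "real measure" where
  "circle_borel = restrict_space borel {0..<1}"

definition doubling :: "real \<Rightarrow> real" where
  "doubling x = frac (2 * x)"

definition Inv :: "(real \<Rightarrow> real) \<Rightarrow> real measure set" where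
  "Inv f = {\<mu>. prob_space \<mu> \<and> sets \<mu> = sets circle_borel \<and> distr \<mu> \<mu> f = \<mu>}"

text \<open>The Bochner integral assigns \<open>0\<close> to functions that are not integrable, whereas the integral of
  an upper semi-continuous potential may be \<open>-\<infinity>\<close>. Hence the integral of an extended real function
  is taken to be the integral of its positive part minus that of its negative part
  (\<^const>\<open>e2ennreal\<close> sends negative values to \<open>0\<close>). For functions bounded above and a finite measure
  the case \<open>\<infinity> - \<infinity>\<close> does not occur.\<close>

definition ext_integral :: "'a measure \<Rightarrow> ('a \<Rightarrow> ereal) \<Rightarrow> ereal" where
  "ext_integral \<mu> h =
     enn2ereal (\<integral>\<^sup>+ x. e2ennreal (h x) \<partial>\<mu>) - enn2ereal (\<integral>\<^sup>+ x. e2ennreal (- h x) \<partial>\<mu>)"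

definition log_ext :: "real \<Rightarrow> ereal" where
  "log_ext y = (if y = 0 then -\<infinity> else ereal (ln y))"

definition potential :: "real \<Rightarrow> real \<Rightarrow> ereal" where
  "potential c x = log_ext \<bar>cos (pi * (x + c))\<bar>"

definition maximizing :: "(real \<Rightarrow> real) \<Rightarrow> (real \<Rightarrow> ereal) \<Rightarrow> real measure \<Rightarrow> bool" where
  "maximizing f g \<mu> \<longleftrightarrow>
     \<mu> \<in> Inv f \<and> ext_integral \<mu> g = (SUP \<nu>\<in>Inv f. ext_integral \<nu> g)"

definition periodic_measure :: "(real \<Rightarrow> real) \<Rightarrow> real measure \<Rightarrow> bool" where
  "periodic_measure f \<mu> \<longleftrightarrow>
     \<mu> \<in> Inv f \<and>
     (\<exists>x\<in>{0..<1}. \<exists>n>0. (f ^^ n) x = x \<and> (AE y in \<mu>. y \<in> {(f ^^ k) x | k. k < n}))"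

definition Lambda10 :: "real set" where
  "Lambda10 = {real i / 1024 | i. i \<le> 1023}"

definition Lambda10U :: "real set" where
  "Lambda10U = {192/1024, 309/1024, 390/1024, 391/1024, 832/1024, 715/1024, 634/1024, 633/1024}"

end

theory Submission
  imports Defs
begin

text \<open>Write \<open>g\<close> for the potential and \<open>f\<close> for the doubling map. It suffices to find a bounded function \<open>\<psi>\<close>
  with \<open>g + \<psi> - \<psi> \<circ> f \<le> \<beta>\<close> such that equality along a whole orbit only occurs on one periodic orbit: this
  orbit then carries the unique maximizing measure, and since the modulus of the trigonometric polynomial
  of length \<open>2 ^ k\<close> is a product of \<open>k\<close> values \<open>2 * exp g\<close> along an orbit of \<open>f\<close>, the maxima grow exactly
  like \<open>(2 * exp \<beta>) ^ k\<close>.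

  Following Bousch, \<open>\<psi>\<close> is found through its derivative. If \<open>\<tau>\<close> is the inverse branch of \<open>f\<close> with values
  in the half circle \<open>[\<gamma>, \<gamma> + 1/2)\<close>, then \<open>\<phi> = (\<Sum>n\<ge>1. 2 ^ (- n) * (g' \<circ> \<tau> ^ n))\<close> makes the derivative
  \<open>g' + \<phi> - 2 * (\<phi> \<circ> f)\<close> vanish on that half circle, and outside it has the favourable sign because
  \<open>g'(y) - g'(y - 1/2) = - 2 * pi / sin (2 * pi * (y + c))\<close> dominates the oscillation of \<open>\<phi>\<close>. The only obstruction
  to integrating \<open>\<phi>\<close> is its mean. If the means at \<open>\<gamma>1 < \<gamma>2\<close> have opposite signs, a convex
  combination of the two functions has mean \<open>0\<close>, so the exact \<open>\<gamma>\<close> of mean \<open>0\<close> is not needed.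

  When both half circles contain the same rotational periodic orbit, the mean is an explicit, rapidly
  converging sum of differences of \<open>g\<close>. It is decreasing in \<open>c\<close>, so two numerical inequalities settle
  a whole interval of parameters, and 27 intervals cover the parameters in \<open>[0, 1/2]\<close>; the reflection
  \<open>x \<mapsto> - x\<close> gives the others.\<close>

section \<open>Certificates for a maximizing periodic orbit\<close>

text \<open>The construction has a narrow margin. The difference of \<open>g'\<close> at antipodal
  points has modulus at least 2 pi, and it must beat the change of the branch sum between antipodal
  points. Once the half circle is centred within 37/400 of the maximum \<open>- c\<close> of
  \<open>g\<close>, that change is at most 3597/1820 pi, about 1.976 pi. Such a half circle also
  keeps away from the singularity of \<open>g\<close>, so the branch sum is bounded although
  \<open>g'\<close> is not, and \<open>\<psi>\<close> is Lipschitz. Uniqueness comes from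
  contraction: a point whose forward orbit never leaves a half circle is recovered from its images
  by the inverse branch, which halves distances, so it lies on the periodic orbit in that half
  circle. The mean is explicit because the circle splits into \<open>2 q\<close> pieces on which all
  iterates of the inverse branch are affine: there the n-th term of the branch sum is the exact
  derivative of \<open>g\<close> along a map of slope \<open>2 ^ (- n)\<close>, and integrates to a
  difference of two values of \<open>g\<close>. These sums of logarithms are tested in exponentiated
  form, as products of ratios of cosines, so that only cosines have to be enclosed
  numerically.\<close>

definition logcos :: "real \<Rightarrow> real \<Rightarrow> real" where
  "logcos c x = ln \<bar>cos (pi * (x + c))\<bar>"

lemma abs_cos_pi_add_int:
  fixes x k :: real
  assumes "k \<in> \<int>"
  shows "\<bar>cos (pi * (x + k))\<bar> = \<bar>cos (pi * x)\<bar>"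
proof -
  have s: "sin (pi * k) = 0"
    using assms by (auto elim!: Ints_cases simp: mult.commute)
  have "(cos (pi * k))\<^sup>2 = 1"
    using sin_cos_squared_add[of "pi * k"] s by simp
  then have "\<bar>cos (pi * k)\<bar> = 1"
    by (metis abs_square_eq_1 power2_abs abs_1 abs_power2 power2_eq_1_iff abs_minus_cancel)
  then show ?thesis
    using s by (simp add: distrib_left cos_add abs_mult)
qed

lemma logcos_add_int: "k \<in> \<int> \<Longrightarrow> logcos c (x + k) = logcos c x"
  unfolding logcos_def using abs_cos_pi_add_int[of k "x + c"] by (simp add: algebra_simps)

lemma periodic_add_int:
  fixes f :: "real \<Rightarrow> 'b"
  assumes per: "\<And>x. f (x + 1) = f x" and k: "k \<in> \<int>"
  shows "f (x + k) = f x"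
proof -
  have nat: "f (x + real n) = f x" for x n
  proof (induction n)
    case (Suc n)
    have "f (x + real (Suc n)) = f ((x + real n) + 1)" by (simp add: add_ac)
    then show ?case using per Suc by simp
  qed simp
  obtain m :: int where m: "k = of_int m" using k by (auto elim: Ints_cases)
  show ?thesis
  proof (cases "m \<ge> 0")
    case True
    then show ?thesis using nat[of x "nat m"] m by simp
  next
    case False
    then show ?thesis using nat[of "x + k" "nat (- m)"] m by simp
  qed
qed

lemma frac_eq_add_int: "\<exists>k\<in>\<int>. frac x = x + k" for x :: real
  by (rule bexI[of _ "- of_int \<lfloor>x\<rfloor>"]) (auto simp: frac_def)

lemma periodic_frac:
  fixes f :: "real \<Rightarrow> 'b"
  assumes per: "\<And>x. f (x + 1) = f x"
  shows "f (frac x) = f x"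
  using frac_eq_add_int[of x] periodic_add_int[of f, OF per] by fastforce

lemma doubling_funpow: "x \<in> {0..<1} \<Longrightarrow> (doubling ^^ k) x = frac (2 ^ k * x)"
proof (induction k)
  case 0
  then show ?case by (simp add: frac_eq)
next
  case (Suc k)
  obtain j :: int where j: "frac (2 ^ k * x) = 2 ^ k * x + of_int j"
    using frac_eq_add_int[of "2 ^ k * x"] by (auto elim: Ints_cases)
  have "doubling (frac (2 ^ k * x)) = frac (2 * (2 ^ k * x) + of_int (2 * j))"
    unfolding doubling_def j by (simp add: algebra_simps)
  also have "\<dots> = frac (2 ^ Suc k * x)" by (simp only: frac_add_of_int_right) (simp add: algebra_simps)
  finally show ?case using Suc by simp
qed

text \<open>Functions on the circle are 1-periodic functions on the line.\<close>

locale subaction =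
  fixes c :: real and \<psi> :: "real \<Rightarrow> real" and \<beta> x0 :: real and q :: nat
  assumes \<psi>_borel [measurable]: "\<psi> \<in> borel_measurable borel"
    and \<psi>_per: "\<psi> (x + 1) = \<psi> x"
    and \<psi>_bounded: "\<exists>M. \<forall>x. \<bar>\<psi> x\<bar> \<le> M"
    and q_pos: "q > 0"
    and x0_per: "2 ^ q * x0 - x0 \<in> \<int>"
    and le_\<beta>: "cos (pi * (x + c)) \<noteq> 0 \<Longrightarrow> logcos c x + \<psi> x - \<psi> (2 * x) \<le> \<beta>"
    and orbit_cos: "cos (pi * (2 ^ k * x0 + c)) \<noteq> 0"
    and orbit_eq: "logcos c (2 ^ k * x0) + \<psi> (2 ^ k * x0) - \<psi> (2 * (2 ^ k * x0)) = \<beta>"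
    and tight_orbit: "(\<And>k. cos (pi * (2 ^ k * x + c)) \<noteq> 0 \<and>
        logcos c (2 ^ k * x) + \<psi> (2 ^ k * x) - \<psi> (2 * (2 ^ k * x)) = \<beta>) \<Longrightarrow> \<exists>k. x - 2 ^ k * x0 \<in> \<int>"
begin

section \<open>Tight points and the periodic orbit on the circle\<close>

definition tight :: "real \<Rightarrow> bool" where
  "tight x \<longleftrightarrow> cos (pi * (x + c)) \<noteq> 0 \<and> logcos c x + \<psi> x - \<psi> (2 * x) = \<beta>"

definition orb :: "nat \<Rightarrow> real" where
  "orb k = frac (2 ^ k * x0)"

lemma \<psi>_add_int: "k \<in> \<int> \<Longrightarrow> \<psi> (x + k) = \<psi> x"
  using periodic_add_int[of \<psi>] \<psi>_per by blast

lemma \<psi>_doubling: "\<psi> (doubling x) = \<psi> (2 * x)"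
  unfolding doubling_def using periodic_frac[of \<psi>] \<psi>_per by blast

lemma tight_frac: "tight (frac x) = tight x"
proof (rule periodic_frac)
  fix x :: real
  have "cos (pi * (x + 1 + c)) = 0 \<longleftrightarrow> cos (pi * (x + c)) = 0"
    using abs_cos_pi_add_int[of 1 "x + c"] by (simp add: algebra_simps)
  moreover have "\<psi> (2 * (x + 1)) = \<psi> (2 * x)"
    using \<psi>_add_int[of 2 "2 * x"] by (simp add: algebra_simps)
  ultimately show "tight (x + 1) = tight x"
    unfolding tight_def using \<psi>_per logcos_add_int[of 1 c x] by simp
qed

lemma orb_in: "orb k \<in> {0..<1}"
  by (simp add: orb_def frac_lt_1)

lemma doubling_orb: "doubling (orb k) = orb (Suc k)"
proof -
  have "orb k = (doubling ^^ k) (frac x0)" for k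
  proof -
    obtain j :: int where j: "frac x0 = x0 + of_int j"
      using frac_eq_add_int[of x0] by (auto elim: Ints_cases)
    have "(doubling ^^ k) (frac x0) = frac (2 ^ k * frac x0)"
      by (rule doubling_funpow) (simp add: frac_lt_1)
    also have "\<dots> = frac (2 ^ k * x0 + of_int (2 ^ k * j))" by (simp add: j algebra_simps)
    also have "\<dots> = orb k" unfolding orb_def by (simp only: frac_add_of_int_right)
    finally show ?thesis by simp
  qed
  then show ?thesis by simp
qed

lemma orb_funpow: "orb k = (doubling ^^ k) (orb 0)"
  by (induction k) (auto simp: doubling_orb[symmetric])

lemma orb_q: "orb (k + q) = orb k"
proof (induction k)
  case 0
  obtain j :: int where j: "2 ^ q * x0 - x0 = of_int j"
    using x0_per by (auto elim: Ints_cases)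
  then have "2 ^ q * x0 = x0 + of_int j" by simp
  then have "frac (2 ^ q * x0) = frac x0" by (simp only: frac_add_of_int_right)
  then show ?case unfolding orb_def by simp
next
  case (Suc k)
  then show ?case using doubling_orb[of k] doubling_orb[of "k + q"] by simp
qed

lemma orb_mod: "orb (k mod q) = orb k"
proof -
  have "orb (j + m * q) = orb j" for j m
  proof (induction m)
    case (Suc m)
    have "orb (j + Suc m * q) = orb ((j + m * q) + q)" by (simp add: add_ac)
    then show ?case using orb_q Suc by simp
  qed simp
  from this[of "k mod q" "k div q"] show ?thesis by (simp add: add.commute)
qed

lemma tight_orb: "tight (orb k)"
  unfolding orb_def tight_frac unfolding tight_def using orbit_cos orbit_eq by blast

lemma always_tight_orbit:
  assumes x: "x \<in> {0..<1}" and t: "\<And>k. tight ((doubling ^^ k) x)"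
  shows "x \<in> {(doubling ^^ k) (orb 0) | k. k < q}"
proof -
  have "\<And>k. tight (2 ^ k * x)"
    using t doubling_funpow[OF x] tight_frac by metis
  then have "\<exists>k. x - 2 ^ k * x0 \<in> \<int>" unfolding tight_def by (intro tight_orbit) blast
  then obtain k :: nat and j :: int where j: "x - 2 ^ k * x0 = of_int j" by (auto elim: Ints_cases)
  then have "x = 2 ^ k * x0 + of_int j" by simp
  then have "frac x = orb k" unfolding orb_def by (simp only: frac_add_of_int_right)
  moreover have "frac x = x" using x by (simp add: frac_eq)
  ultimately have "x = (doubling ^^ (k mod q)) (orb 0)"
    using orb_mod[of k] orb_funpow[of "k mod q"] by simp
  then show ?thesis using q_pos by auto
qed

end

subsection \<open>Maximization over the invariant measures\<close>

lemma doubling_measurable [measurable]: "doubling \<in> measurable circle_borel circle_borel"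
  unfolding circle_borel_def
proof (rule measurable_restrict_space3)
  have "doubling = (\<lambda>x. 2 * x - of_int \<lfloor>2 * x\<rfloor>)" by (auto simp: doubling_def frac_def)
  moreover have "(\<lambda>x::real. 2 * x - of_int \<lfloor>2 * x\<rfloor>) \<in> borel \<rightarrow>\<^sub>M borel" by measurable
  ultimately show "doubling \<in> borel \<rightarrow>\<^sub>M borel" by simp
qed (auto simp: doubling_def frac_lt_1)

lemma logcos_borel [measurable]: "logcos c \<in> borel_measurable borel"
  unfolding logcos_def[abs_def] by measurable

lemma Inv_doublingD:
  assumes "\<nu> \<in> Inv doubling"
  shows "prob_space \<nu>" "sets \<nu> = sets circle_borel" "distr \<nu> \<nu> doubling = \<nu>"
    "space \<nu> = {0..<1}" "doubling \<in> measurable \<nu> \<nu>"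
    "f \<in> borel_measurable borel \<Longrightarrow> f \<in> borel_measurable \<nu>"
proof -
  show *: "prob_space \<nu>" "sets \<nu> = sets circle_borel" "distr \<nu> \<nu> doubling = \<nu>"
    using assms by (auto simp: Inv_def)
  show "space \<nu> = {0..<1}"
    using sets_eq_imp_space_eq[OF *(2)] by (simp add: circle_borel_def space_restrict_space)
  show "doubling \<in> measurable \<nu> \<nu>"
    using doubling_measurable measurable_cong_sets[OF *(2) *(2)] by blast
  show "f \<in> borel_measurable \<nu>" if "f \<in> borel_measurable borel"
  proof -
    have "f \<in> borel_measurable circle_borel"
      unfolding circle_borel_def using that by (rule measurable_restrict_space1)
    then show ?thesis using measurable_cong_sets[OF *(2) refl] by blast
  qed
qed

lemma ext_integral_potential:
  "ext_integral \<nu> (potential c) = - enn2ereal (\<integral>\<^sup>+ x. e2ennreal (- potential c x) \<partial>\<nu>)"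
proof -
  have "potential c x \<le> 0" for x
    unfolding potential_def log_ext_def by (auto simp: zero_ereal_def)
  then have "e2ennreal (potential c x) = 0" for x
    by (simp add: e2ennreal_neg)
  then show ?thesis unfolding ext_integral_def by (simp add: zero_ennreal.rep_eq)
qed

lemma neg_potential_eq:
  "e2ennreal (- potential c x) = (if cos (pi * (x + c)) = 0 then \<top> else ennreal (- logcos c x))"
  by (auto simp: potential_def log_ext_def logcos_def e2ennreal_ereal)

lemma neg_potential_measurable: "(\<lambda>x. e2ennreal (- potential c x)) \<in> borel_measurable borel"
  unfolding neg_potential_eq by measurable

text \<open>At zeros of the cosine \<open>logcos\<close> has a finite value while the potential is
  minus infinity, so these zeros have to form a null set before the two integrals can be
  identified.\<close>

lemma ext_integral_potential_integrable:
  assumes "integrable \<nu> (logcos c)" and "AE x in \<nu>. cos (pi * (x + c)) \<noteq> 0"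
  shows "ext_integral \<nu> (potential c) = ereal (\<integral>x. logcos c x \<partial>\<nu>)"
proof -
  have nn: "0 \<le> - logcos c x" for x by (simp add: logcos_def ln_le_zero_iff) (cases "cos (pi * (x + c)) = 0"; simp)
  have "(\<integral>\<^sup>+ x. e2ennreal (- potential c x) \<partial>\<nu>) = (\<integral>\<^sup>+ x. ennreal (- logcos c x) \<partial>\<nu>)"
    using assms(2) by (intro nn_integral_cong_AE) (auto simp: neg_potential_eq)
  also have "\<dots> = ennreal (\<integral>x. - logcos c x \<partial>\<nu>)"
    using assms(1) nn by (intro nn_integral_eq_integral) auto
  finally show ?thesis
    using nn by (simp add: ext_integral_potential enn2ereal_ennreal integral_nonneg_AE del: integral_minus)
       (simp add: integral_nonneg_AE)
qed

context subaction
begin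

lemma bounded_obtain: obtains M where "\<And>x. \<bar>\<psi> x\<bar> \<le> M" "M \<ge> 0"
proof -
  obtain M where "\<And>x. \<bar>\<psi> x\<bar> \<le> M" using \<psi>_bounded by blast
  then show ?thesis using that[of M] abs_ge_zero[of "\<psi> 0"] order_trans by blast
qed

text \<open>By invariance \<open>\<psi>\<close> and its composition with doubling have the same
  integral; boundedness of \<open>\<psi>\<close> supplies the integrability.\<close>

lemma integral_coboundary:
  assumes \<nu>: "\<nu> \<in> Inv doubling" and int: "integrable \<nu> (logcos c)"
  shows "integrable \<nu> (\<lambda>x. logcos c x + \<psi> x - \<psi> (2 * x))"
    and "(\<integral>x. logcos c x + \<psi> x - \<psi> (2 * x) \<partial>\<nu>) = (\<integral>x. logcos c x \<partial>\<nu>)"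
proof -
  interpret prob_space \<nu> using Inv_doublingD[OF \<nu>] by blast
  obtain M where M: "\<And>x. \<bar>\<psi> x\<bar> \<le> M" using bounded_obtain by blast
  have [measurable]: "\<psi> \<in> borel_measurable \<nu>" "(\<lambda>x. \<psi> (2 * x)) \<in> borel_measurable \<nu>"
    by (auto intro!: Inv_doublingD[OF \<nu>])
  have i1: "integrable \<nu> \<psi>" by (rule integrable_const_bound[of _ M]) (use M in auto)
  have i2: "integrable \<nu> (\<lambda>x. \<psi> (2 * x))" by (rule integrable_const_bound[of _ M]) (use M in auto)
  have "(\<integral>x. \<psi> x \<partial>\<nu>) = (\<integral>x. \<psi> x \<partial>(distr \<nu> \<nu> doubling))"
    using Inv_doublingD(3)[OF \<nu>] by simp
  also have "\<dots> = (\<integral>x. \<psi> (2 * x) \<partial>\<nu>)"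
    using Inv_doublingD(5)[OF \<nu>] by (subst integral_distr) (auto simp: \<psi>_doubling)
  finally have e: "(\<integral>x. \<psi> x \<partial>\<nu>) = (\<integral>x. \<psi> (2 * x) \<partial>\<nu>)" .
  show "integrable \<nu> (\<lambda>x. logcos c x + \<psi> x - \<psi> (2 * x))" using int i1 i2 by auto
  show "(\<integral>x. logcos c x + \<psi> x - \<psi> (2 * x) \<partial>\<nu>) = (\<integral>x. logcos c x \<partial>\<nu>)"
    using int i1 i2 e by simp
qed

text \<open>If the negative part has infinite integral, the extended integral is minus infinity.
  Otherwise \<open>logcos\<close> is integrable and the defect \<open>?D\<close> is nonnegative
  almost everywhere; its integral is the gap to \<open>\<beta>\<close>, so a zero gap makes it
  vanish almost everywhere.\<close>

lemma ext_integral_le: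
  assumes \<nu>: "\<nu> \<in> Inv doubling"
  shows "ext_integral \<nu> (potential c) \<le> ereal \<beta>"
    and "ext_integral \<nu> (potential c) = ereal \<beta> \<Longrightarrow> AE x in \<nu>. tight x"
proof -
  interpret prob_space \<nu> using Inv_doublingD[OF \<nu>] by blast
  let ?I = "\<integral>\<^sup>+ x. e2ennreal (- potential c x) \<partial>\<nu>"
  have [measurable]: "(\<lambda>x. e2ennreal (- potential c x)) \<in> borel_measurable \<nu>"
    "logcos c \<in> borel_measurable \<nu>"
    using neg_potential_measurable by (auto intro!: Inv_doublingD[OF \<nu>])
  have "ext_integral \<nu> (potential c) \<le> ereal \<beta> \<and>
    (ext_integral \<nu> (potential c) = ereal \<beta> \<longrightarrow> (AE x in \<nu>. tight x))"
  proof (cases "?I = \<top>")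
    case True
    then show ?thesis by (simp add: ext_integral_potential)
  next
    case False
    have "AE x in \<nu>. e2ennreal (- potential c x) \<noteq> \<infinity>"
      using False by (intro nn_integral_PInf_AE) auto
    then have ae: "AE x in \<nu>. cos (pi * (x + c)) \<noteq> 0"
      by eventually_elim (auto simp: neg_potential_eq split: if_splits)
    have nn: "0 \<le> - logcos c x" for x by (simp add: logcos_def ln_le_zero_iff) (cases "cos (pi * (x + c)) = 0"; simp)
    have "?I = (\<integral>\<^sup>+ x. ennreal (- logcos c x) \<partial>\<nu>)"
      using ae by (intro nn_integral_cong_AE) (auto simp: neg_potential_eq)
    then have "(\<integral>\<^sup>+ x. ennreal (- logcos c x) \<partial>\<nu>) < \<infinity>" using False by (simp add: top.not_eq_extremum)
    then have "integrable \<nu> (\<lambda>x. - logcos c x)"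
      using nn by (intro integrableI_nonneg) auto
    then have int: "integrable \<nu> (logcos c)" by simp
    note ext = ext_integral_potential_integrable[OF int ae]
    let ?D = "\<lambda>x. \<beta> - (logcos c x + \<psi> x - \<psi> (2 * x))"
    have iD: "integrable \<nu> ?D" using integral_coboundary(1)[OF \<nu> int] by simp
    have ID: "(\<integral>x. ?D x \<partial>\<nu>) = \<beta> - (\<integral>x. logcos c x \<partial>\<nu>)"
      using integral_coboundary[OF \<nu> int] by (simp add: prob_space)
    have nnD: "AE x in \<nu>. 0 \<le> ?D x" using ae le_\<beta> by auto
    have "AE x in \<nu>. tight x" if "ext_integral \<nu> (potential c) = ereal \<beta>"
    proof -
      have "(\<integral>x. ?D x \<partial>\<nu>) = 0" using that ext ID by simp
      then have "AE x in \<nu>. ?D x = 0" using integral_nonneg_eq_0_iff_AE[OF iD nnD] by simp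
      then show ?thesis unfolding tight_def using ae by eventually_elim auto
    qed
    moreover have "(\<integral>x. ?D x \<partial>\<nu>) \<ge> 0" using nnD by (rule integral_nonneg_AE)
    ultimately show ?thesis using ext ID by simp
  qed
  then show "ext_integral \<nu> (potential c) \<le> ereal \<beta>"
    "ext_integral \<nu> (potential c) = ereal \<beta> \<Longrightarrow> AE x in \<nu>. tight x" by auto
qed

text \<open>Integrability comes from tightness: at a tight point \<open>logcos\<close> differs from
  \<open>\<beta>\<close> by at most twice the bound of \<open>\<psi>\<close>.\<close>

lemma ext_integral_eq:
  assumes \<nu>: "\<nu> \<in> Inv doubling" and t: "AE x in \<nu>. tight x"
  shows "ext_integral \<nu> (potential c) = ereal \<beta>"
proof -
  interpret prob_space \<nu> using Inv_doublingD[OF \<nu>] by blast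
  obtain M where M: "\<And>x. \<bar>\<psi> x\<bar> \<le> M" using bounded_obtain by blast
  have [measurable]: "logcos c \<in> borel_measurable \<nu>" by (auto intro!: Inv_doublingD[OF \<nu>])
  have "AE x in \<nu>. norm (logcos c x) \<le> \<bar>\<beta>\<bar> + 2 * M"
    using t
  proof eventually_elim
    case (elim x)
    then show ?case using M[of x] M[of "2 * x"] unfolding tight_def by (simp add: abs_le_iff) linarith
  qed
  then have int: "integrable \<nu> (logcos c)" by (rule integrable_const_bound) simp
  have ae: "AE x in \<nu>. cos (pi * (x + c)) \<noteq> 0" using t by eventually_elim (simp add: tight_def)
  have "(\<integral>x. logcos c x + \<psi> x - \<psi> (2 * x) \<partial>\<nu>) = (\<integral>x. \<beta> \<partial>\<nu>)"
  proof (rule integral_cong_AE)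
    show "AE x in \<nu>. logcos c x + \<psi> x - \<psi> (2 * x) = \<beta>" using t by eventually_elim (simp add: tight_def)
  qed (auto intro!: Inv_doublingD[OF \<nu>])
  then show ?thesis
    using ext_integral_potential_integrable[OF int ae] integral_coboundary(2)[OF \<nu> int]
    by (simp add: prob_space)
qed

text \<open>Invariance carries an almost sure property of \<open>x\<close> over to
  \<open>doubling x\<close>. A countable intersection makes whole forward orbits tight, and such
  points lie on the periodic orbit.\<close>

lemma tight_imp_supported:
  assumes \<nu>: "\<nu> \<in> Inv doubling" and t: "AE x in \<nu>. tight x"
  shows "AE x in \<nu>. x \<in> {(doubling ^^ k) (orb 0) | k. k < q}"
proof -
  have dm: "doubling \<in> measurable \<nu> \<nu>" using Inv_doublingD[OF \<nu>] by blast
  have tb: "Measurable.pred borel tight"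
    unfolding tight_def by measurable
  have ts: "{x \<in> space \<nu>. tight x} \<in> sets \<nu>"
  proof -
    have "(\<lambda>x. x) \<in> measurable \<nu> borel" by (rule Inv_doublingD(6)[OF \<nu>]) simp
    from measurable_compose[OF this tb] show ?thesis by (simp add: pred_def)
  qed
  have "AE x in \<nu>. tight ((doubling ^^ k) x)" for k
  proof (induction k)
    case 0
    then show ?case using t by simp
  next
    case (Suc k)
    have fm: "(doubling ^^ k) \<in> measurable \<nu> \<nu>" using dm by (rule measurable_compose_n)
    have "{x \<in> space \<nu>. tight ((doubling ^^ k) x)} = (doubling ^^ k) -` {x \<in> space \<nu>. tight x} \<inter> space \<nu>"
      using measurable_space[OF fm] by auto
    then have pk: "{x \<in> space \<nu>. tight ((doubling ^^ k) x)} \<in> sets \<nu>"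
      using measurable_sets[OF fm ts] by simp
    have "AE x in distr \<nu> \<nu> doubling. tight ((doubling ^^ k) x)"
      unfolding Inv_doublingD(3)[OF \<nu>] by (rule Suc)
    then show ?case
      using AE_distr_iff[OF dm pk] by (simp add: funpow_swap1)
  qed
  then have "AE x in \<nu>. \<forall>k. tight ((doubling ^^ k) x)" by (simp add: AE_all_countable)
  then show ?thesis using AE_space
    by eventually_elim (use always_tight_orbit Inv_doublingD(4)[OF \<nu>] in blast)
qed

text \<open>The preimage of \<open>orb (Suc k)\<close> contains \<open>orb k\<close>, so point
  masses cannot decrease along the orbit; as the orbit is a cycle, they are equal. The divisor is
  \<open>card (range orb)\<close> because \<open>q\<close> may be a proper multiple of the least
  period.\<close>

lemma invariant_orbit_measure_eq:
  assumes \<nu>: "\<nu> \<in> Inv doubling"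
    and s: "AE x in \<nu>. x \<in> {(doubling ^^ k) (orb 0) | k. k < q}"
    and A: "A \<in> sets circle_borel"
  shows "measure \<nu> A = card (A \<inter> range orb) / card (range orb)"
proof -
  interpret prob_space \<nu> using Inv_doublingD[OF \<nu>] by blast
  have sub: "{(doubling ^^ k) (orb 0) | k. k < q} \<subseteq> range orb"
    by (auto simp: orb_funpow[symmetric])
  have "range orb \<subseteq> orb ` {..<q}" using orb_mod q_pos by (metis imageI lessThan_iff mod_less_divisor image_subsetI)
  then have fin: "finite (range orb)" using finite_subset by blast
  have sing: "{x} \<in> sets \<nu>" if "x \<in> {0..<1}" for x
    using that Inv_doublingD(2)[OF \<nu>] by (auto simp: circle_borel_def sets_restrict_space_iff)
  have one_le: "measure \<nu> {orb k} \<le> measure \<nu> {orb (Suc k)}" for k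
  proof -
    have "measure \<nu> {orb (Suc k)} = measure (distr \<nu> \<nu> doubling) {orb (Suc k)}"
      using Inv_doublingD(3)[OF \<nu>] by simp
    also have "\<dots> = measure \<nu> (doubling -` {orb (Suc k)} \<inter> space \<nu>)"
      using Inv_doublingD(5)[OF \<nu>] sing[OF orb_in] by (rule measure_distr)
    finally show ?thesis
      using Inv_doublingD(4)[OF \<nu>] orb_in[of k] doubling_orb[of k]
        measurable_sets[OF Inv_doublingD(5)[OF \<nu>] sing[OF orb_in[of "Suc k"]]]
      by (metis (no_types, lifting) IntI finite_measure_mono empty_subsetI insert_subset singletonI vimageI)
  qed
  have mono: "measure \<nu> {orb k} \<le> measure \<nu> {orb (k + j)}" for k j
  proof (induction j)
    case (Suc j)
    then show ?case using one_le[of "k + j"] by simp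
  qed simp
  have eq0: "measure \<nu> {orb k} = measure \<nu> {orb 0}" for k
  proof (rule antisym)
    \<comment> \<open>The step count \<open>q * k - k\<close> leads from \<open>k\<close> to
      \<open>q * k\<close>, where the orbit is back at \<open>orb 0\<close>.\<close>
    have "measure \<nu> {orb k} \<le> measure \<nu> {orb (k + (q * k - k))}" by (rule mono)
    moreover have "k + (q * k - k) = q * k" using q_pos by (cases q) auto
    moreover have "orb (q * k) = orb 0" using orb_mod[of "q * k"] by simp
    ultimately show "measure \<nu> {orb k} \<le> measure \<nu> {orb 0}" by simp
  qed (use mono[of 0 k] in simp)
  have inS: "B \<in> sets \<nu>" if "B \<subseteq> range orb" for B
  proof -
    have "finite B" using that fin finite_subset by blast
    moreover have "\<And>x. x \<in> B \<Longrightarrow> {x} \<in> sets \<nu>" using that sing orb_in by blast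
    ultimately show ?thesis using sets.countable[of B \<nu>] countable_finite by blast
  qed
  have fsum: "measure \<nu> B = card B * measure \<nu> {orb 0}" if "B \<subseteq> range orb" for B
  proof -
    have fB: "finite B" using that fin finite_subset by blast
    have "measure \<nu> B = (\<Sum>x\<in>B. measure \<nu> {x})"
      using fB that inS by (intro measure_eq_sum_singleton) (auto simp: emeasure_eq_measure)
    also have "\<dots> = (\<Sum>x\<in>B. measure \<nu> {orb 0})" using that eq0 by (intro sum.cong) auto
    finally show ?thesis by simp
  qed
  have ae: "AE x in \<nu>. x \<in> range orb" using s by eventually_elim (use sub in blast)
  have "measure \<nu> (range orb) = 1" using prob_eq_1[OF inS] ae by auto
  then have "card (range orb) * measure \<nu> {orb 0} = 1" using fsum[of "range orb"] by simp
  then have m: "measure \<nu> {orb 0} = 1 / card (range orb)" by (metis mult_zero_left nonzero_mult_div_cancel_left zero_neq_one)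
  have AS: "A \<in> sets \<nu>" using A Inv_doublingD(2)[OF \<nu>] by simp
  have "measure \<nu> A = measure \<nu> (A \<inter> range orb)"
    using ae AS inS[of "range orb"] by (intro finite_measure_eq_AE) auto
  then show ?thesis using fsum[of "A \<inter> range orb"] m by simp
qed

lemma invariant_orbit_measure_unique:
  assumes "\<mu> \<in> Inv doubling" "AE x in \<mu>. x \<in> {(doubling ^^ k) (orb 0) | k. k < q}"
    and "\<nu> \<in> Inv doubling" "AE x in \<nu>. x \<in> {(doubling ^^ k) (orb 0) | k. k < q}"
  shows "\<mu> = \<nu>"
proof (rule measure_eqI)
  show "sets \<mu> = sets \<nu>" using assms Inv_doublingD(2) by metis
  fix A assume "A \<in> sets \<mu>"
  then have A: "A \<in> sets circle_borel" using Inv_doublingD(2)[OF assms(1)] by simp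
  interpret m: prob_space \<mu> using Inv_doublingD[OF assms(1)] by blast
  interpret n: prob_space \<nu> using Inv_doublingD[OF assms(3)] by blast
  show "emeasure \<mu> A = emeasure \<nu> A"
    using invariant_orbit_measure_eq[OF assms(1,2) A] invariant_orbit_measure_eq[OF assms(3,4) A]
    by (simp add: m.emeasure_eq_measure n.emeasure_eq_measure)
qed

section \<open>The invariant measure on the orbit\<close>

definition orbit_measure :: "real measure" where
  "orbit_measure = distr (measure_pmf (pmf_of_set {..<q})) circle_borel orb"

lemma orb_measurable: "orb \<in> measurable (measure_pmf p) circle_borel"
  using orb_in by (auto simp: circle_borel_def space_restrict_space)

text \<open>On indices doubling acts as the cyclic successor \<open>?s\<close>, a permutation that
  preserves the uniform distribution on \<open>{..<q}\<close>.\<close>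

lemma orbit_measure_Inv: "orbit_measure \<in> Inv doubling"
proof -
  let ?p = "pmf_of_set {..<q}"
  let ?s = "\<lambda>k. Suc k mod q"
  have "prob_space orbit_measure"
    unfolding orbit_measure_def by (rule measure_pmf.prob_space_distr[OF orb_measurable])
  moreover have sets: "sets orbit_measure = sets circle_borel" by (simp add: orbit_measure_def)
  moreover have "distr orbit_measure orbit_measure doubling = orbit_measure"
  proof -
    have "inj_on ?s {..<q}"
    proof (rule inj_onI)
      fix x y assume xy: "x \<in> {..<q}" "y \<in> {..<q}" "Suc x mod q = Suc y mod q"
      then show "x = y" by (cases "Suc x = q"; cases "Suc y = q") auto
    qed
    moreover have "?s ` {..<q} \<subseteq> {..<q}" using q_pos by auto
    ultimately have "bij_betw ?s {..<q} {..<q}"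
      by (simp add: bij_betw_def endo_inj_surj)
    then have mp: "map_pmf ?s ?p = ?p"
      using q_pos by (intro map_pmf_of_set_bij_betw) auto
    have "distr orbit_measure orbit_measure doubling = distr orbit_measure circle_borel doubling"
      using sets by (intro distr_cong) auto
    also have "\<dots> = distr (measure_pmf ?p) circle_borel (doubling \<circ> orb)"
      unfolding orbit_measure_def by (rule distr_distr[OF doubling_measurable orb_measurable])
    also have "doubling \<circ> orb = orb \<circ> ?s" by (auto simp: doubling_orb orb_mod)
    also have "distr (measure_pmf ?p) circle_borel (orb \<circ> ?s)
        = distr (distr (measure_pmf ?p) (count_space UNIV) ?s) circle_borel orb"
      using orb_in by (subst distr_distr) (auto simp: circle_borel_def space_restrict_space)
    also have "distr (measure_pmf ?p) (count_space UNIV) ?s = measure_pmf (map_pmf ?s ?p)"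
      by (simp add: map_pmf_rep_eq)
    finally show ?thesis by (simp add: mp orbit_measure_def)
  qed
  ultimately show ?thesis by (simp add: Inv_def)
qed

lemma orbit_measure_supported: "AE x in orbit_measure. x \<in> {(doubling ^^ k) (orb 0) | k. k < q}"
proof -
  have "finite {(doubling ^^ k) (orb 0) | k. k < q}" by simp
  then have "{x \<in> space circle_borel. x \<in> {(doubling ^^ k) (orb 0) | k. k < q}} \<in> sets circle_borel"
    by (auto simp: circle_borel_def sets_restrict_space_iff space_restrict_space
        intro!: borel_closed finite_imp_closed elim: finite_subset[rotated])
  then show ?thesis
    unfolding orbit_measure_def using q_pos
    by (subst AE_distr_iff[OF orb_measurable])
      (auto simp: AE_measure_pmf_iff set_pmf_of_set lessThan_empty_iff orb_funpow[symmetric])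
qed

lemma orbit_measure_tight: "AE x in orbit_measure. tight x"
  using orbit_measure_supported by eventually_elim (auto simp: orb_funpow[symmetric] tight_orb)

lemma ext_integral_orbit_measure: "ext_integral orbit_measure (potential c) = ereal \<beta>"
  using ext_integral_eq[OF orbit_measure_Inv orbit_measure_tight] .

lemma SUP_ext_integral: "(SUP \<nu>\<in>Inv doubling. ext_integral \<nu> (potential c)) = ereal \<beta>"
  using orbit_measure_Inv ext_integral_orbit_measure ext_integral_le(1)
  by (intro antisym SUP_least) (auto intro: SUP_upper2)

lemma maximizing_iff: "maximizing doubling (potential c) \<nu> \<longleftrightarrow> \<nu> = orbit_measure"
proof
  assume "maximizing doubling (potential c) \<nu>"
  then have \<nu>: "\<nu> \<in> Inv doubling" and "ext_integral \<nu> (potential c) = ereal \<beta>"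
    by (auto simp: maximizing_def SUP_ext_integral)
  then have "AE x in \<nu>. tight x" using ext_integral_le(2) by blast
  from tight_imp_supported[OF \<nu> this] show "\<nu> = orbit_measure"
    using invariant_orbit_measure_unique \<nu> orbit_measure_Inv orbit_measure_supported by blast
qed (simp add: maximizing_def SUP_ext_integral orbit_measure_Inv ext_integral_orbit_measure)

lemma periodic_measure_orbit_measure: "periodic_measure doubling orbit_measure"
  unfolding periodic_measure_def
proof (intro conjI bexI exI)
  show "(doubling ^^ q) (orb 0) = orb 0" using orb_funpow[of q] orb_q[of 0] by simp
qed (use orbit_measure_Inv q_pos orbit_measure_supported orb_in in auto)

end

subsection \<open>The Gelfond exponent\<close>

lemma binary_digit_sum_even: "binary_digit_sum (2 * n) = binary_digit_sum n"
  by (cases "n = 0") (simp_all add: binary_digit_sum.simps[of "2 * n"])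

lemma binary_digit_sum_odd: "binary_digit_sum (Suc (2 * n)) = Suc (binary_digit_sum n)"
  by (simp add: binary_digit_sum.simps[of "Suc (2 * n)"])

lemma binary_digit_sum_add_power: "n < 2 ^ k \<Longrightarrow> binary_digit_sum (2 ^ k + n) = Suc (binary_digit_sum n)"
proof (induction k arbitrary: n)
  case 0
  then show ?case using binary_digit_sum_odd[of 0] by simp
next
  case (Suc k)
  then have IH: "binary_digit_sum (2 ^ k + n div 2) = Suc (binary_digit_sum (n div 2))"
    by (intro Suc.IH) auto
  show ?case
  proof (cases "even n")
    case True
    then obtain m where "n = 2 * m" by blast
    then show ?thesis using IH binary_digit_sum_even[of "2 ^ k + m"] binary_digit_sum_even[of m]
      by (simp add: algebra_simps)
  next
    case False
    then obtain m where "n = Suc (2 * m)" by (metis oddE Suc_eq_plus1)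
    then show ?thesis using IH binary_digit_sum_odd[of "2 ^ k + m"] binary_digit_sum_odd[of m]
      by (simp add: algebra_simps)
  qed
qed

definition tm_poly :: "real \<Rightarrow> nat \<Rightarrow> real \<Rightarrow> complex" where
  "tm_poly c N t = (\<Sum>n<N. thue_morse c n * cis (2 * pi * real n * t))"

lemma sum_lessThan_double: "(\<Sum>n<2 * m. f n) = (\<Sum>n<m. f (2 * n) + f (Suc (2 * n)))"
  for f :: "nat \<Rightarrow> 'a::comm_monoid_add"
  by (induction m) (auto simp: add_ac)

text \<open>The terms at \<open>2 * n\<close> and \<open>Suc (2 * n)\<close> differ by the one
  factor \<open>cis (2 * pi * (t + c))\<close>, since the last binary digit adds 1 to the digit
  sum.\<close>

lemma tm_poly_double: "tm_poly c (2 * m) t = (1 + cis (2 * pi * (t + c))) * tm_poly c m (2 * t)"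
  unfolding tm_poly_def sum_lessThan_double sum_distrib_left
proof (intro sum.cong refl)
  fix n
  show "thue_morse c (2 * n) * cis (2 * pi * real (2 * n) * t) +
        thue_morse c (Suc (2 * n)) * cis (2 * pi * real (Suc (2 * n)) * t) =
        (1 + cis (2 * pi * (t + c))) * (thue_morse c n * cis (2 * pi * real n * (2 * t)))"
    unfolding thue_morse_def binary_digit_sum_even binary_digit_sum_odd
    by (simp add: cis_mult algebra_simps)
qed

lemma norm_one_plus_cis: "cmod (1 + cis (2 * x)) = 2 * \<bar>cos x\<bar>"
proof -
  have "1 + cis (2 * x) = of_real (2 * cos x) * cis x"
    using sin_cos_squared_add[of x]
    by (intro complex_eqI) (auto simp: cos_double_cos sin_double power2_eq_square)
  then show ?thesis by (simp add: norm_mult)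
qed

lemma norm_tm_poly_power: "cmod (tm_poly c (2 ^ k) t) = (\<Prod>j<k. 2 * \<bar>cos (pi * (2 ^ j * t + c))\<bar>)"
proof (induction k arbitrary: t)
  case 0
  then show ?case by (simp add: tm_poly_def thue_morse_def binary_digit_sum.simps)
next
  case (Suc k)
  have "cmod (tm_poly c (2 ^ Suc k) t) = 2 * \<bar>cos (pi * (t + c))\<bar> * (\<Prod>j<k. 2 * \<bar>cos (pi * (2 ^ j * (2 * t) + c))\<bar>)"
    using norm_one_plus_cis[of "pi * (t + c)"] Suc[of "2 * t"]
    by (simp add: tm_poly_double norm_mult mult.assoc)
  also have "\<dots> = (\<Prod>j<Suc k. 2 * \<bar>cos (pi * (2 ^ j * t + c))\<bar>)"
    by (subst prod.lessThan_Suc_shift) (simp add: algebra_simps)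
  finally show ?case .
qed

text \<open>From index \<open>2 ^ k\<close> on one leading digit 1 is added, so that block is the
  polynomial of length \<open>m\<close> times the unimodular constant \<open>?w\<close>.\<close>

lemma norm_tm_poly_add_power:
  assumes "m \<le> 2 ^ k"
  shows "cmod (tm_poly c (2 ^ k + m) t) \<le> cmod (tm_poly c (2 ^ k) t) + cmod (tm_poly c m t)"
proof -
  have split: "{..<2 ^ k + m} = {..<2 ^ k} \<union> (\<lambda>n. 2 ^ k + n) ` {..<m}"
  proof (intro set_eqI iffI)
    fix x assume "x \<in> {..<2 ^ k + m}"
    then show "x \<in> {..<2 ^ k} \<union> (\<lambda>n. 2 ^ k + n) ` {..<m}"
      by (cases "x < 2 ^ k") (auto intro!: image_eqI[of _ _ "x - 2 ^ k"])
  qed auto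
  let ?w = "cis (2 * pi * c) * cis (2 * pi * 2 ^ k * t)"
  have "(\<Sum>n\<in>(\<lambda>n. 2 ^ k + n) ` {..<m}. thue_morse c n * cis (2 * pi * real n * t))
      = (\<Sum>n<m. thue_morse c (2 ^ k + n) * cis (2 * pi * real (2 ^ k + n) * t))"
    by (subst sum.reindex) (auto simp: o_def)
  also have "\<dots> = (\<Sum>n<m. ?w * (thue_morse c n * cis (2 * pi * real n * t)))"
  proof (intro sum.cong refl)
    fix n assume "n \<in> {..<m}"
    then have e: "binary_digit_sum (2 ^ k + n) = Suc (binary_digit_sum n)"
      using assms by (intro binary_digit_sum_add_power) simp
    show "thue_morse c (2 ^ k + n) * cis (2 * pi * real (2 ^ k + n) * t) =
      ?w * (thue_morse c n * cis (2 * pi * real n * t))"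
      unfolding thue_morse_def e by (simp add: cis_mult algebra_simps)
  qed
  also have "\<dots> = ?w * tm_poly c m t" by (simp add: tm_poly_def sum_distrib_left)
  finally have "tm_poly c (2 ^ k + m) t = tm_poly c (2 ^ k) t + ?w * tm_poly c m t"
    unfolding tm_poly_def[of c "2 ^ k + m"] split
    by (subst sum.union_disjoint) (auto simp: tm_poly_def)
  then have "cmod (tm_poly c (2 ^ k + m) t) \<le> cmod (tm_poly c (2 ^ k) t) + cmod (?w * tm_poly c m t)"
    using norm_triangle_ineq by metis
  then show ?thesis by (simp add: norm_mult)
qed

lemma norm_tm_poly_le: "cmod (tm_poly c N t) \<le> N"
proof -
  have "cmod (tm_poly c N t) \<le> (\<Sum>n<N. cmod (thue_morse c n * cis (2 * pi * real n * t)))"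
    unfolding tm_poly_def by (rule norm_sum)
  also have "\<dots> = N" by (simp add: norm_mult thue_morse_def)
  finally show ?thesis .
qed

lemma tm_poly_add_int:
  assumes "k \<in> \<int>" shows "tm_poly c N (t + k) = tm_poly c N t"
proof -
  obtain j :: int where j: "k = of_int j" using assms by (auto elim: Ints_cases)
  have "cis (2 * pi * real n * (t + k)) = cis (2 * pi * real n * t)" for n
  proof -
    have "cis (2 * pi * real n * (t + k)) = cis (2 * pi * real n * t) * cis (2 * pi * of_int (int n * j))"
      by (simp add: cis_mult j algebra_simps)
    also have "cis (2 * pi * of_int (int n * j)) = 1" by (rule cis_multiple_2pi) simp
    finally show ?thesis by simp
  qed
  then show ?thesis by (simp add: tm_poly_def)
qed

lemma norm_tm_poly_le_max: "cmod (tm_poly c N t) \<le> thue_morse_max c N"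
proof -
  have "tm_poly c N t = tm_poly c N (frac t)"
    using frac_eq_add_int[of t] tm_poly_add_int by metis
  moreover have "cmod (tm_poly c N (frac t)) \<le> thue_morse_max c N"
    unfolding thue_morse_max_def tm_poly_def[symmetric]
    by (rule cSUP_upper) (auto intro!: bdd_aboveI2[of _ _ "real N"] norm_tm_poly_le simp: less_imp_le[OF frac_lt_1])
  ultimately show ?thesis by simp
qed

lemma thue_morse_max_le: "(\<And>t. cmod (tm_poly c N t) \<le> B) \<Longrightarrow> thue_morse_max c N \<le> B"
  unfolding thue_morse_max_def tm_poly_def[symmetric] by (rule cSUP_least) auto

text \<open>The point is built backwards: the two halves of \<open>t\<close> modulo 1 differ by 1/2,
  where cosine and sine change places, so one of them has squared cosine at least 1/2. This serves
  to bound the growth rate from below.\<close>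

lemma ex_all_cos_ge:
  "\<exists>t. \<forall>j<k. (cos (pi * (2 ^ j * t + c)))\<^sup>2 \<ge> 1 / 2"
proof (induction k)
  case (Suc k)
  then obtain t where t: "\<And>j. j < k \<Longrightarrow> (cos (pi * (2 ^ j * t + c)))\<^sup>2 \<ge> 1 / 2" by blast
  obtain s where s: "(cos (pi * (s + c)))\<^sup>2 \<ge> 1 / 2" "2 * s - t \<in> {0, 1}"
  proof (cases "(cos (pi * (t / 2 + c)))\<^sup>2 \<ge> 1 / 2")
    case False
    have "cos (pi * (t / 2 + 1 / 2 + c)) = - sin (pi * (t / 2 + c))"
      using cos_add[of "pi * (t / 2 + c)" "pi / 2"] by (simp add: algebra_simps)
    then have "(cos (pi * (t / 2 + 1 / 2 + c)))\<^sup>2 \<ge> 1 / 2"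
      using False sin_cos_squared_add[of "pi * (t / 2 + c)"] by (simp del: sin_cos_squared_add)
    then show ?thesis using that[of "t / 2 + 1 / 2"] by simp
  qed (use that[of "t / 2"] in simp)
  have "(cos (pi * (2 ^ j * s + c)))\<^sup>2 \<ge> 1 / 2" if "j < Suc k" for j
  proof (cases j)
    case 0
    then show ?thesis using s by simp
  next
    case (Suc i)
    have "2 ^ j * s + c = 2 ^ i * t + c + 2 ^ i * (2 * s - t)" by (simp add: Suc algebra_simps)
    moreover have "2 ^ i * (2 * s - t) \<in> \<int>" using s(2) by auto
    ultimately have "\<bar>cos (pi * (2 ^ j * s + c))\<bar> = \<bar>cos (pi * (2 ^ i * t + c))\<bar>"
      using abs_cos_pi_add_int by metis
    then have "(cos (pi * (2 ^ j * s + c)))\<^sup>2 = (cos (pi * (2 ^ i * t + c)))\<^sup>2"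
      by (metis power2_abs)
    then show ?thesis using t[of i] that Suc by simp
  qed
  then show ?case by blast
qed simp

lemma le_of_power_le:
  fixes a b C :: real
  assumes "a > 0" "b > 0" "\<And>k. a ^ k \<le> C * b ^ k"
  shows "a \<le> b"
proof (rule ccontr)
  assume "\<not> a \<le> b"
  then have "1 < a / b" using assms by simp
  then obtain k where "C < (a / b) ^ k" using real_arch_pow by blast
  then show False using assms(3)[of k] assms(2) by (simp add: power_divide pos_less_divide_eq)
qed

context subaction
begin

text \<open>The growth factor of the maxima when the length is doubled.\<close>

definition rate :: real where "rate = 2 * exp \<beta>"

lemma sum_logcos_telescope:
  "(\<Sum>j<k. \<psi> (2 ^ j * t) - \<psi> (2 * (2 ^ j * t))) = \<psi> t - \<psi> (2 ^ k * t)"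
  by (induction k) (auto simp: algebra_simps)

lemma prod_cos_eq_exp:
  assumes "\<And>j. j < k \<Longrightarrow> cos (pi * (2 ^ j * t + c)) \<noteq> 0"
  shows "(\<Prod>j<k. 2 * \<bar>cos (pi * (2 ^ j * t + c))\<bar>) = 2 ^ k * exp (\<Sum>j<k. logcos c (2 ^ j * t))"
  using assms by (simp add: exp_sum prod.distrib logcos_def)

lemma norm_tm_poly_power_le:
  assumes M: "\<And>x. \<bar>\<psi> x\<bar> \<le> M"
  shows "cmod (tm_poly c (2 ^ k) t) \<le> exp (2 * M) * rate ^ k"
proof (cases "\<forall>j<k. cos (pi * (2 ^ j * t + c)) \<noteq> 0")
  case True
  have "(\<Sum>j<k. logcos c (2 ^ j * t) + (\<psi> (2 ^ j * t) - \<psi> (2 * (2 ^ j * t)))) \<le> (\<Sum>j<k. \<beta>)"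
  proof (rule sum_mono)
    fix j assume "j \<in> {..<k}"
    then show "logcos c (2 ^ j * t) + (\<psi> (2 ^ j * t) - \<psi> (2 * (2 ^ j * t))) \<le> \<beta>"
      using le_\<beta>[of "2 ^ j * t"] True by simp
  qed
  then have "(\<Sum>j<k. logcos c (2 ^ j * t)) \<le> k * \<beta> + 2 * M"
    using M[of t] M[of "2 ^ k * t"] by (simp add: sum.distrib sum_logcos_telescope)
  then have "2 ^ k * exp (\<Sum>j<k. logcos c (2 ^ j * t)) \<le> 2 ^ k * exp (k * \<beta> + 2 * M)"
    by simp
  also have "\<dots> = exp (2 * M) * rate ^ k"
    by (simp add: rate_def exp_add exp_of_nat_mult power_mult_distrib)
  finally show ?thesis using True by (simp add: norm_tm_poly_power prod_cos_eq_exp)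
next
  case False
  then obtain j where "j < k" "cos (pi * (2 ^ j * t + c)) = 0" by blast
  then have z: "(\<Prod>j<k. 2 * \<bar>cos (pi * (2 ^ j * t + c))\<bar>) = 0"
    by (intro prod_zero) auto
  show ?thesis unfolding norm_tm_poly_power z by (simp add: rate_def)
qed

lemma norm_tm_poly_power_ge:
  assumes M: "\<And>x. \<bar>\<psi> x\<bar> \<le> M"
  shows "cmod (tm_poly c (2 ^ k) x0) \<ge> exp (- 2 * M) * rate ^ k"
proof -
  have "(\<Sum>j<k. logcos c (2 ^ j * x0) + (\<psi> (2 ^ j * x0) - \<psi> (2 * (2 ^ j * x0)))) = (\<Sum>j<k. \<beta>)"
    using orbit_eq by (intro sum.cong) (auto simp: algebra_simps)
  then have "(\<Sum>j<k. logcos c (2 ^ j * x0)) \<ge> k * \<beta> + - 2 * M"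
    using M[of x0] M[of "2 ^ k * x0"] by (simp add: sum.distrib sum_logcos_telescope)
  then have "2 ^ k * exp (\<Sum>j<k. logcos c (2 ^ j * x0)) \<ge> 2 ^ k * exp (k * \<beta> + - 2 * M)"
    by simp
  also have "2 ^ k * exp (k * \<beta> + - 2 * M) = exp (- 2 * M) * rate ^ k"
    unfolding exp_add by (simp add: rate_def exp_of_nat_mult power_mult_distrib)
  finally show ?thesis using orbit_cos by (simp add: norm_tm_poly_power prod_cos_eq_exp)
qed

text \<open>A point with all cosines at least \<open>1 / sqrt 2\<close> in modulus is compared with
  the upper bound of order \<open>rate ^ k\<close>. The consequence \<open>rate > 1\<close> makes
  the geometric sum over the binary digits of \<open>N\<close> comparable to its largest
  term.\<close>

lemma rate_ge: "rate \<ge> sqrt 2"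
proof -
  obtain M where M: "\<And>x. \<bar>\<psi> x\<bar> \<le> M" using bounded_obtain by blast
  have "sqrt 2 ^ k \<le> exp (2 * M) * rate ^ k" for k
  proof -
    obtain t where t: "\<And>j. j < k \<Longrightarrow> (cos (pi * (2 ^ j * t + c)))\<^sup>2 \<ge> 1 / 2"
      using ex_all_cos_ge by blast
    have "sqrt 2 \<le> 2 * \<bar>cos (pi * (2 ^ j * t + c))\<bar>" if "j < k" for j
    proof (rule real_le_lsqrt)
      show "2 \<le> (2 * \<bar>cos (pi * (2 ^ j * t + c))\<bar>)\<^sup>2" using t[OF that] by (simp add: power_mult_distrib)
    qed simp_all
    then have "(\<Prod>j<k. sqrt 2) \<le> (\<Prod>j<k. 2 * \<bar>cos (pi * (2 ^ j * t + c))\<bar>)"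
      by (intro prod_mono) auto
    then show ?thesis using norm_tm_poly_power_le[OF M, of k t] by (simp add: norm_tm_poly_power)
  qed
  moreover have "rate > 0" by (simp add: rate_def)
  ultimately show ?thesis using le_of_power_le[of "sqrt 2" rate "exp (2 * M)"] by simp
qed

lemma rate_gt_1: "rate > 1"
  by (rule less_le_trans[OF _ rate_ge]) simp

text \<open>Peeling off the leading binary digit of \<open>N\<close> leaves at most one block of
  length \<open>2 ^ k\<close> for each \<open>k < K\<close>.\<close>

lemma norm_tm_poly_le_geometric:
  assumes M: "\<And>x. \<bar>\<psi> x\<bar> \<le> M"
  shows "N < 2 ^ K \<Longrightarrow> cmod (tm_poly c N t) \<le> exp (2 * M) * (\<Sum>k<K. rate ^ k)"
proof (induction K arbitrary: N)
  case 0
  then show ?case by (simp add: tm_poly_def)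
next
  case (Suc K)
  show ?case
  proof (cases "N < 2 ^ K")
    case True
    from Suc.IH[OF this] have "cmod (tm_poly c N t) \<le> exp (2 * M) * (\<Sum>k<K. rate ^ k)" .
    moreover have "exp (2 * M) * rate ^ K \<ge> 0" by (simp add: rate_def)
    ultimately show ?thesis by (simp add: distrib_left)
  next
    case False
    define m where "m = N - 2 ^ K"
    have m: "N = 2 ^ K + m" "m < 2 ^ K" using False Suc.prems by (auto simp: m_def)
    have "cmod (tm_poly c N t) \<le> cmod (tm_poly c (2 ^ K) t) + cmod (tm_poly c m t)"
      unfolding m(1) using m(2) by (intro norm_tm_poly_add_power) simp
    also have "\<dots> \<le> exp (2 * M) * rate ^ K + exp (2 * M) * (\<Sum>k<K. rate ^ k)"
      using norm_tm_poly_power_le[OF M] Suc.IH[OF m(2)] by (intro add_mono)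
    finally show ?thesis by (simp add: distrib_left)
  qed
qed

definition gelfond :: real where "gelfond = 1 + \<beta> / ln 2"

lemma two_powr_gelfond: "2 powr gelfond = rate"
proof -
  have "(1 + \<beta> / ln 2) * ln 2 = ln 2 + \<beta>" by (simp add: field_simps)
  then show ?thesis by (simp add: gelfond_def rate_def powr_def exp_add)
qed

lemma gelfond_pos: "gelfond > 0"
proof (rule ccontr)
  assume "\<not> gelfond > 0"
  then have "2 powr gelfond \<le> 2 powr (0::real)" by (intro powr_mono) auto
  then show False using rate_gt_1 two_powr_gelfond by simp
qed

text \<open>For \<open>N\<close> between \<open>2 ^ K\<close> and \<open>2 ^ Suc K\<close> only a
  constant is lost against \<open>rate ^ K\<close>. Conversely the values at
  \<open>N = 2 ^ k\<close>, \<open>t = x0\<close> are of order \<open>rate ^ k\<close>, which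
  excludes smaller exponents.\<close>

lemma is_gelfond_exponent_gelfond: "is_gelfond_exponent c gelfond"
  unfolding is_gelfond_exponent_def
proof (intro conjI allI impI)
  obtain M where M: "\<And>x. \<bar>\<psi> x\<bar> \<le> M" using bounded_obtain by blast
  define C where "C = exp (2 * M) * rate / (rate - 1)"
  have r1: "rate > 1" by (rule rate_gt_1)
  have "thue_morse_max c N \<le> C * real N powr gelfond" if N: "N \<ge> 1" for N
  proof (rule thue_morse_max_le)
    fix t
    obtain K where K: "2 ^ K \<le> N" "N < 2 ^ Suc K"
      using ex_power_ivl1[OF le_refl N] unfolding Suc_eq_plus1 by blast
    have "cmod (tm_poly c N t) \<le> exp (2 * M) * (\<Sum>k<Suc K. rate ^ k)"
      by (rule norm_tm_poly_le_geometric[OF M K(2)])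
    also have "(\<Sum>k<Suc K. rate ^ k) = (rate ^ Suc K - 1) / (rate - 1)"
      using r1 by (intro geometric_sum) simp
    also have "\<dots> \<le> rate ^ Suc K / (rate - 1)" using r1 by (simp add: divide_right_mono)
    finally have le: "cmod (tm_poly c N t) \<le> exp (2 * M) * (rate ^ Suc K / (rate - 1))" by simp
    have "rate ^ K = (2 ^ K) powr gelfond"
      using two_powr_gelfond by (metis powr_gt_zero powr_powr powr_realpow mult.commute zero_less_numeral)
    also have "\<dots> \<le> real N powr gelfond"
    proof (rule powr_mono2)
      show "2 ^ K \<le> real N" using K(1) by (metis numeral_power_le_of_nat_cancel_iff)
    qed (use gelfond_pos in auto)
    finally have rK: "rate ^ K \<le> real N powr gelfond" .
    have "exp (2 * M) * (rate ^ Suc K / (rate - 1)) = C * rate ^ K" by (simp add: C_def)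
    also have "\<dots> \<le> C * real N powr gelfond"
      using rK r1 by (intro mult_left_mono) (auto simp: C_def)
    finally show "cmod (tm_poly c N t) \<le> C * real N powr gelfond" using le by simp
  qed
  moreover have "thue_morse_max c N \<ge> 0" for N
    using norm_tm_poly_le_max[of c N 0] norm_ge_zero order_trans by blast
  ultimately show "thue_morse_max c \<in> O(\<lambda>N. real N powr gelfond)"
    by (intro bigoI[where c = C] eventually_sequentiallyI[of 1]) auto
next
  fix \<alpha> assume "thue_morse_max c \<in> O(\<lambda>N. real N powr \<alpha>)"
  then obtain C where C: "C > 0" "eventually (\<lambda>N. norm (thue_morse_max c N) \<le> C * norm (real N powr \<alpha>)) sequentially"
    by (rule landau_o.bigE)
  then obtain N0 where N0: "\<And>N. N \<ge> N0 \<Longrightarrow> norm (thue_morse_max c N) \<le> C * norm (real N powr \<alpha>)"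
    by (auto simp: eventually_sequentially)
  obtain M where M: "\<And>x. \<bar>\<psi> x\<bar> \<le> M" using bounded_obtain by blast
  define B where "B = 2 powr \<alpha>"
  have B: "B > 0" by (simp add: B_def)
  have r0: "rate > 0" using rate_gt_1 by simp
  have large: "rate ^ k \<le> (C * exp (2 * M)) * B ^ k" if "k \<ge> N0" for k
  proof -
    have "N0 \<le> 2 ^ k" using that by (meson less_exp less_imp_le order_trans)
    then have "thue_morse_max c (2 ^ k) \<le> C * (real (2 ^ k) powr \<alpha>)"
      using N0[of "2 ^ k"] by simp
    also have "real (2 ^ k) powr \<alpha> = B ^ k"
      unfolding B_def by (simp add: powr_realpow[symmetric] powr_powr mult.commute)
    finally have "exp (- 2 * M) * rate ^ k \<le> C * B ^ k"
      using norm_tm_poly_power_ge[OF M, of k] norm_tm_poly_le_max[of c "2 ^ k" x0] by simp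
    then show ?thesis by (simp add: exp_minus field_simps)
  qed
  \<comment> \<open>The bound \<open>large\<close> is applied at \<open>k + N0\<close>; the factor
    \<open>(B / rate) ^ N0\<close> pays for this shift, so the estimate holds for every
    \<open>k\<close>.\<close>
  have "rate ^ k \<le> (C * exp (2 * M) * (B / rate) ^ N0) * B ^ k" for k
  proof -
    have "rate ^ (k + N0) \<le> (C * exp (2 * M)) * B ^ (k + N0)" by (rule large) simp
    then show ?thesis using r0 by (simp add: power_add power_divide field_simps)
  qed
  then have "rate \<le> B" by (rule le_of_power_le[OF r0 B])
  then show "gelfond \<le> \<alpha>"
    unfolding B_def two_powr_gelfond[symmetric] by simp
qed

theorem maximizing_and_gelfond:
  "\<exists>\<mu>. maximizing doubling (potential c) \<mu>
    \<and> (\<forall>\<nu>. maximizing doubling (potential c) \<nu> \<longrightarrow> \<nu> = \<mu>)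
    \<and> periodic_measure doubling \<mu>
    \<and> (\<exists>\<Delta>. is_gelfond_exponent c \<Delta>
          \<and> ereal \<Delta> = 1 + ext_integral \<mu> (potential c) / ereal (ln 2))"
proof (intro exI conjI allI impI)
  show "is_gelfond_exponent c gelfond" by (rule is_gelfond_exponent_gelfond)
  show "ereal gelfond = 1 + ext_integral orbit_measure (potential c) / ereal (ln 2)"
    by (simp add: ext_integral_orbit_measure gelfond_def one_ereal_def)
qed (auto simp: maximizing_iff periodic_measure_orbit_measure)

end

section \<open>Sums along an inverse branch\<close>

text \<open>This turns the tolerance of \<open>admissible\<close> into rational bounds for tangents.
  The true value is about 0.2991.\<close>

lemma tan_le_three_tenths: "tan (37 / 400 * pi) \<le> 3 / 10"
proof -
  let ?x = "37 / 400 * pi"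
  have x: "0 < ?x" "?x \<le> 2906 / 10000" using pi_approx by auto
  have "?x < pi / 2" using pi_gt_zero by simp
  then have cpos: "cos ?x > 0" using x by (intro cos_gt_zero) auto
  have "\<bar>sin ?x - (\<Sum>m<5. sin_coeff m * ?x ^ m)\<bar> \<le> inverse (fact 5) * \<bar>?x\<bar> ^ 5"
    by (rule Maclaurin_sin_bound)
  moreover have "(\<Sum>m<5. sin_coeff m * ?x ^ m) = ?x - ?x ^ 3 / 6"
  proof -
    have "{..<5::nat} = {0, 1, 2, 3, 4}" by auto
    then show ?thesis by (simp add: sin_coeff_def fact_numeral)
  qed
  moreover have "inverse (fact 5) * \<bar>?x\<bar> ^ 5 = ?x ^ 5 / 120"
    using x by (simp add: fact_numeral abs_of_pos)
  ultimately have s: "sin ?x \<le> ?x - ?x ^ 3 / 6 + ?x ^ 5 / 120" by linarith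
  have "cos ?x = 1 - 2 * (sin (?x / 2))\<^sup>2" using cos_double_sin[of "?x / 2"] by simp
  moreover have "(sin (?x / 2))\<^sup>2 \<le> (?x / 2)\<^sup>2"
    using abs_sin_x_le_abs_x[of "?x / 2"] unfolding abs_le_square_iff .
  ultimately have c: "cos ?x \<ge> 1 - ?x\<^sup>2 / 2" by (simp add: power2_eq_square field_simps)
  have x2: "?x\<^sup>2 \<le> (2906 / 10000)\<^sup>2" using x by (intro power_mono) auto
  have lo: "?x \<ge> 29059 / 100000" using pi_approx by simp
  have "?x ^ 3 \<ge> (29059 / 100000) ^ 3" using lo by (intro power_mono) auto
  moreover have "?x ^ 5 \<le> (2906 / 10000) ^ 5" using x by (intro power_mono) auto
  ultimately have "sin ?x \<le> 2866 / 10000" using s x by (simp add: power_divide)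
  also have "\<dots> \<le> 3 / 10 * (1 - (2906 / 10000)\<^sup>2 / 2)" by (simp add: power2_eq_square)
  also have "\<dots> \<le> 3 / 10 * (1 - ?x\<^sup>2 / 2)"
    by (intro mult_left_mono diff_left_mono divide_right_mono x2) simp_all
  also have "\<dots> \<le> 3 / 10 * cos ?x" using c by (rule mult_left_mono) simp
  finally show ?thesis using cpos by (simp add: tan_def divide_simps)
qed

text \<open>The midpoint \<open>\<gamma> + 1 / 4\<close> of the half circle is close to
  \<open>- c\<close>, the maximum of \<open>g\<close>. With the tolerance 37/400 the tangent at the
  midpoint is at most 3/10 in modulus, just small enough to bring
  \<open>branch_sum_half_diff\<close> below 2 pi.\<close>

definition admissible :: "real \<Rightarrow> real \<Rightarrow> bool" where
  "admissible c \<gamma> \<longleftrightarrow> \<bar>\<gamma> + c + 1 / 4\<bar> \<le> 37 / 400"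

definition dlogcos :: "real \<Rightarrow> real \<Rightarrow> real" where
  "dlogcos c y = - pi * tan (pi * (y + c))"

lemma admissible_angle:
  assumes "admissible c \<gamma>" "\<gamma> \<le> y" "y \<le> \<gamma> + 1 / 2"
  shows "- (pi / 2) < pi * (y + c)" "pi * (y + c) < pi / 2"
proof -
  have "- (1 / 2) < y + c" "y + c < 1 / 2" using assms unfolding admissible_def by linarith+
  then have "pi * - (1 / 2) < pi * (y + c)" "pi * (y + c) < pi * (1 / 2)"
    using pi_gt_zero by (intro mult_strict_left_mono; simp)+
  then show "- (pi / 2) < pi * (y + c)" "pi * (y + c) < pi / 2" by simp_all
qed

lemma admissible_cos_pos:
  assumes "admissible c \<gamma>" "\<gamma> \<le> y" "y \<le> \<gamma> + 1 / 2"
  shows "cos (pi * (y + c)) > 0"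
  using admissible_angle[OF assms] by (rule cos_gt_zero_pi)

lemma tan_shift_quarter:
  fixes x :: real
  assumes "cos x \<noteq> 0" "cos (x + pi / 4) \<noteq> 0"
  shows "tan (x + pi / 4) = (1 + tan x) / (1 - tan x)"
  using tan_add[of x "pi / 4"] assms by (simp add: cos_45 tan_45)

lemma tan_shift_half: "tan (x + pi / 2) = - 1 / tan x" for x :: real
  by (simp add: tan_def sin_add cos_add)

lemma admissible_mid:
  assumes "admissible c \<gamma>"
  shows "\<bar>tan (pi * (\<gamma> + 1 / 4 + c))\<bar> \<le> 3 / 10"
proof -
  let ?d = "\<gamma> + 1 / 4 + c"
  have d: "- (37 / 400) \<le> ?d" "?d \<le> 37 / 400" using assms unfolding admissible_def by linarith+
  have b: "37 / 400 * pi < pi / 2" using pi_gt_zero by simp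
  have e: "pi * ?d \<le> 37 / 400 * pi" "- (37 / 400 * pi) \<le> pi * ?d"
    using d pi_gt_zero mult_left_mono[OF d(2), of pi] mult_left_mono[OF d(1), of pi] by simp_all
  have "tan (pi * ?d) \<le> tan (37 / 400 * pi)" using b e pi_gt_zero by (subst tan_mono_le_eq) linarith+
  moreover have "tan (- (37 / 400 * pi)) \<le> tan (pi * ?d)" using b e pi_gt_zero by (subst tan_mono_le_eq) linarith+
  ultimately show ?thesis using tan_le_three_tenths by (simp add: abs_le_iff)
qed

lemma admissible_tan_mono:
  assumes "admissible c \<gamma>" "\<gamma> \<le> y" "y \<le> z" "z \<le> \<gamma> + 1 / 2"
  shows "tan (pi * (y + c)) \<le> tan (pi * (z + c))"
proof -
  have "pi * (y + c) \<le> pi * (z + c)" using assms by simp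
  then show ?thesis
    using admissible_angle[OF assms(1), of y] admissible_angle[OF assms(1), of z] assms
    by (subst tan_mono_le_eq) auto
qed

text \<open>The end points are pi/4 away from the midpoint, so the addition formula turns 3/10 into
  (1 + 3/10) / (1 - 3/10) = 13/7. The tangents at the two ends have product -1; their difference is
  \<open>t + 1 / t\<close> with \<open>t\<close> between 7/13 and 13/7, hence at most 13/7 + 7/13 =
  218/91.\<close>

lemma admissible_tan_ends:
  assumes a: "admissible c \<gamma>"
  shows "tan (pi * (\<gamma> + 1 / 2 + c)) \<le> 13 / 7" "tan (pi * (\<gamma> + c)) \<ge> - (13 / 7)"
    "tan (pi * (\<gamma> + 1 / 2 + c)) - tan (pi * (\<gamma> + c)) \<le> 218 / 91"
proof -
  let ?s = "tan (pi * (\<gamma> + 1 / 4 + c))"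
  let ?t1 = "tan (pi * (\<gamma> + 1 / 2 + c))" and ?t0 = "tan (pi * (\<gamma> + c))"
  have s: "\<bar>?s\<bar> \<le> 3 / 10" by (rule admissible_mid[OF a])
  have e1: "pi * (\<gamma> + 1 / 4 + c) + pi / 4 = pi * (\<gamma> + 1 / 2 + c)"
    and e0: "pi * (\<gamma> + c) + pi / 2 = pi * (\<gamma> + 1 / 2 + c)" by (simp_all add: algebra_simps)
  have "?t1 = (1 + ?s) / (1 - ?s)"
    unfolding e1[symmetric]
    using admissible_cos_pos[OF a, of "\<gamma> + 1 / 4"] admissible_cos_pos[OF a, of "\<gamma> + 1 / 2"] e1
    by (intro tan_shift_quarter) auto
  moreover have "(1 + x) / (1 - x) \<le> 13 / 7" "(1 + x) / (1 - x) \<ge> 7 / 13" if "\<bar>x\<bar> \<le> 3 / 10" for x :: real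
  proof -
    have "1 - x > 0" using that by linarith
    then show "(1 + x) / (1 - x) \<le> 13 / 7" "(1 + x) / (1 - x) \<ge> 7 / 13"
      using that unfolding abs_le_iff by (simp_all add: pos_divide_le_eq pos_le_divide_eq)
  qed
  ultimately have t1: "?t1 \<le> 13 / 7" "?t1 \<ge> 7 / 13" using s by simp_all
  then show "?t1 \<le> 13 / 7" by simp
  have "?t1 = - 1 / ?t0" using tan_shift_half[of "pi * (\<gamma> + c)"] unfolding e0 .
  then have t0: "?t0 = - 1 / ?t1" by simp
  have "1 / ?t1 \<le> 13 / 7" using t1 by (subst pos_divide_le_eq) linarith+
  then show "?t0 \<ge> - (13 / 7)" unfolding t0 by simp
  have "(?t1 - 7 / 13) * (13 / 7 - ?t1) \<ge> 0" using t1 by simp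
  then have "?t1 * ?t1 + 1 \<le> 218 / 91 * ?t1" by (simp add: algebra_simps)
  then show "?t1 - ?t0 \<le> 218 / 91" unfolding t0 using t1 by (simp add: field_simps)
qed

lemma admissible_tan_bound:
  assumes a: "admissible c \<gamma>" and y: "\<gamma> \<le> y" "y \<le> \<gamma> + 1 / 2"
  shows "\<bar>tan (pi * (y + c))\<bar> \<le> 13 / 7"
  using admissible_tan_mono[OF a, of \<gamma> y] admissible_tan_mono[OF a, of y "\<gamma> + 1 / 2"]
    admissible_tan_ends[OF a] y by (simp add: abs_le_iff)

lemma admissible_dlogcos_bound:
  assumes "admissible c \<gamma>" "\<gamma> \<le> y" "y \<le> \<gamma> + 1 / 2"
  shows "\<bar>dlogcos c y\<bar> \<le> pi * (13 / 7)"
  unfolding dlogcos_def abs_mult using admissible_tan_bound[OF assms] by simp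

lemma admissible_dlogcos_osc:
  assumes a: "admissible c \<gamma>" and y: "\<gamma> \<le> y" "y \<le> \<gamma> + 1 / 2" and z: "\<gamma> \<le> z" "z \<le> \<gamma> + 1 / 2"
  shows "\<bar>dlogcos c y - dlogcos c z\<bar> \<le> pi * (218 / 91)"
proof -
  have "\<bar>tan (pi * (z + c)) - tan (pi * (y + c))\<bar> \<le> 218 / 91"
    using admissible_tan_mono[OF a, of \<gamma> y] admissible_tan_mono[OF a, of y "\<gamma> + 1 / 2"]
      admissible_tan_mono[OF a, of \<gamma> z] admissible_tan_mono[OF a, of z "\<gamma> + 1 / 2"]
      admissible_tan_ends[OF a] y z unfolding abs_le_iff by linarith
  moreover have "dlogcos c y - dlogcos c z = pi * (tan (pi * (z + c)) - tan (pi * (y + c)))"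
    by (simp add: dlogcos_def algebra_simps)
  ultimately show ?thesis by (simp add: abs_mult)
qed

text \<open>With \<open>t\<close> the tangent at \<open>y\<close>, the difference is pi times
  \<open>(1 + t * t) / (1 - t)\<close>, which is convex for \<open>t\<close> between -13/7 and 3/10
  and equals 109/70 at both ends.\<close>

lemma admissible_dlogcos_quarter:
  assumes a: "admissible c \<gamma>" and y: "\<gamma> \<le> y" "y \<le> \<gamma> + 1 / 4"
  shows "\<bar>dlogcos c y - dlogcos c (y + 1 / 4)\<bar> \<le> pi * (109 / 70)"
proof -
  let ?t = "tan (pi * (y + c))"
  have e: "pi * (y + c) + pi / 4 = pi * (y + 1 / 4 + c)" by (simp add: algebra_simps)
  have q: "tan (pi * (y + 1 / 4 + c)) = (1 + ?t) / (1 - ?t)"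
    unfolding e[symmetric]
    using admissible_cos_pos[OF a, of y] admissible_cos_pos[OF a, of "y + 1 / 4"] y e
    by (intro tan_shift_quarter) auto
  have t: "?t \<le> 3 / 10" "?t \<ge> - (13 / 7)"
    using admissible_tan_mono[OF a, of y "\<gamma> + 1 / 4"] admissible_mid[OF a] y
      admissible_tan_bound[OF a, of y] by (simp_all add: abs_le_iff)
  have "(3 / 10 - ?t) * (?t + 13 / 7) \<ge> 0" using t by simp
  then have "1 + ?t * ?t \<le> 109 / 70 * (1 - ?t)" by (simp add: algebra_simps)
  moreover have "(1 + ?t) / (1 - ?t) - ?t = (1 + ?t * ?t) / (1 - ?t)" using t by (simp add: field_simps)
  moreover have "(1 + ?t * ?t) / (1 - ?t) \<ge> 0" using t by (intro divide_nonneg_nonneg) auto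
  moreover have "(1 + ?t * ?t) / (1 - ?t) \<le> 109 / 70 \<longleftrightarrow> 1 + ?t * ?t \<le> 109 / 70 * (1 - ?t)"
    using t by (intro pos_divide_le_eq) simp
  ultimately have "(1 + ?t) / (1 - ?t) - ?t \<le> 109 / 70" "(1 + ?t) / (1 - ?t) - ?t \<ge> 0" by simp_all
  moreover have "dlogcos c y - dlogcos c (y + 1 / 4) = pi * ((1 + ?t) / (1 - ?t) - ?t)"
    unfolding dlogcos_def q right_diff_distrib by simp
  ultimately show ?thesis by (simp add: abs_mult)
qed

lemma two_le_tan_plus_cot:
  fixes x :: real
  assumes "sin x > 0" "cos x > 0"
  shows "tan x + 1 / tan x \<ge> 2"
proof -
  have "tan x > 0" using assms unfolding tan_def by (rule divide_pos_pos)
  moreover have "(tan x - 1)\<^sup>2 \<ge> 0" by simp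
  ultimately show ?thesis by (simp add: power2_eq_square field_simps)
qed

text \<open>A shift by half a turn replaces a tangent by minus its reciprocal; a number plus its
  reciprocal has modulus at least 2.\<close>

lemma dlogcos_half_diff: "dlogcos c y - dlogcos c (y - 1 / 2) = - pi * (tan (pi * (y + c)) + 1 / tan (pi * (y + c)))"
proof -
  have "pi * (y + c) = pi * (y - 1 / 2 + c) + pi / 2" by (simp add: algebra_simps)
  then have "tan (pi * (y + c)) = - 1 / tan (pi * (y - 1 / 2 + c))"
    using tan_shift_half by metis
  then have "tan (pi * (y - 1 / 2 + c)) = - 1 / tan (pi * (y + c))" by simp
  then show ?thesis by (simp add: dlogcos_def algebra_simps)
qed

lemma dlogcos_half_diff_neg:
  assumes "- c < y" "y < 1 / 2 - c"
  shows "dlogcos c y - dlogcos c (y - 1 / 2) \<le> - 2 * pi"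
proof -
  have "0 < y + c" "y + c < 1 / 2" using assms by auto
  then have "0 < pi * (y + c)" "pi * (y + c) < pi * (1 / 2)" using pi_gt_zero
    by (auto intro!: mult_strict_left_mono simp del: times_divide_eq_right)
  then have "tan (pi * (y + c)) + 1 / tan (pi * (y + c)) \<ge> 2"
    by (intro two_le_tan_plus_cot sin_gt_zero cos_gt_zero) auto
  then have "pi * 2 \<le> pi * (tan (pi * (y + c)) + 1 / tan (pi * (y + c)))" by (intro mult_left_mono) auto
  then show ?thesis unfolding dlogcos_half_diff by simp
qed

lemma dlogcos_half_diff_pos:
  assumes "1 / 2 - c < y" "y < 1 - c"
  shows "dlogcos c y - dlogcos c (y - 1 / 2) \<ge> 2 * pi"
proof -
  let ?z = "pi * (1 - c - y)"
  have e: "pi * (y + c) = pi - ?z" by (simp add: algebra_simps)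
  have "tan (pi * (y + c)) = - tan ?z" unfolding e by (simp add: tan_def)
  moreover have "0 < 1 - c - y" "1 - c - y < 1 / 2" using assms by auto
  then have "0 < ?z" "?z < pi * (1 / 2)" using pi_gt_zero
    by (auto intro!: mult_strict_left_mono simp del: times_divide_eq_right)
  then have "tan ?z + 1 / tan ?z \<ge> 2"
    by (intro two_le_tan_plus_cot sin_gt_zero cos_gt_zero) auto
  then have "pi * 2 \<le> pi * (tan ?z + 1 / tan ?z)" by (intro mult_left_mono) auto
  ultimately show ?thesis unfolding dlogcos_half_diff by (simp add: algebra_simps)
qed

subsection \<open>Primitives along an inverse branch\<close>

definition inv_branch :: "real \<Rightarrow> real \<Rightarrow> real" where
  "inv_branch \<gamma> x = \<gamma> + frac (x - 2 * \<gamma>) / 2"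

definition branch_sum :: "real \<Rightarrow> real \<Rightarrow> real \<Rightarrow> real" where
  "branch_sum c \<gamma> x = (\<Sum>n. (1 / 2) ^ Suc n * dlogcos c ((inv_branch \<gamma> ^^ Suc n) x))"

text \<open>The derivative of \<open>g + \<psi> - \<psi> o f\<close> when \<open>\<psi>\<close> has
  derivative \<open>branch_sum\<close>; the factor 2 is the chain rule.\<close>

definition cob_deriv :: "real \<Rightarrow> real \<Rightarrow> real \<Rightarrow> real" where
  "cob_deriv c \<gamma> y = dlogcos c y + branch_sum c \<gamma> y - 2 * branch_sum c \<gamma> (2 * y)"

lemma inv_branch_range: "\<gamma> \<le> inv_branch \<gamma> x" "inv_branch \<gamma> x < \<gamma> + 1 / 2"
  using frac_lt_1[of "x - 2 * \<gamma>"] by (simp_all add: inv_branch_def)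

lemma inv_branch_add_int: "k \<in> \<int> \<Longrightarrow> inv_branch \<gamma> (x + k) = inv_branch \<gamma> x"
  unfolding inv_branch_def using frac_add_int_right[of k "x - 2 * \<gamma>"] by (simp add: algebra_simps)

lemma inv_branch_eqI:
  assumes "\<gamma> \<le> y" "y < \<gamma> + 1 / 2" "2 * y - x \<in> \<int>"
  shows "inv_branch \<gamma> x = y"
proof -
  have "inv_branch \<gamma> x = inv_branch \<gamma> (2 * y)"
    using inv_branch_add_int[OF assms(3), of \<gamma> x] by simp
  also have "frac (2 * y - 2 * \<gamma>) = 2 * y - 2 * \<gamma>" using assms by (simp add: frac_eq)
  then have "inv_branch \<gamma> (2 * y) = y" by (simp add: inv_branch_def field_simps)
  finally show ?thesis .
qed

lemma inv_branch_funpow_range: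
  "\<gamma> \<le> (inv_branch \<gamma> ^^ Suc n) x" "(inv_branch \<gamma> ^^ Suc n) x < \<gamma> + 1 / 2"
  by (simp_all add: inv_branch_range)

lemma inv_branch_borel [measurable]: "inv_branch \<gamma> \<in> borel_measurable borel"
  unfolding inv_branch_def[abs_def] frac_def by measurable

lemma inv_branch_funpow_borel [measurable]: "(inv_branch \<gamma> ^^ n) \<in> borel_measurable borel"
  by (rule measurable_compose_n) simp

lemma dlogcos_borel [measurable]: "dlogcos c \<in> borel_measurable borel"
  unfolding dlogcos_def[abs_def] tan_def by measurable

lemma branch_sum_borel [measurable]: "branch_sum c \<gamma> \<in> borel_measurable borel"
  unfolding branch_sum_def[abs_def] by measurable

lemma branch_sum_add_int: "k \<in> \<int> \<Longrightarrow> branch_sum c \<gamma> (x + k) = branch_sum c \<gamma> x"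
  unfolding branch_sum_def funpow_Suc_right by (simp add: inv_branch_add_int)

lemma half_power_sums: "(\<lambda>n. (1 / 2) ^ Suc n * C) sums C" for C :: real
  using sums_mult2[OF power_half_series, of C] by simp

context
  fixes c \<gamma> :: real
  assumes adm: "admissible c \<gamma>"
begin

lemma branch_sum_term_bound:
  "norm ((1 / 2) ^ Suc n * dlogcos c ((inv_branch \<gamma> ^^ Suc n) x)) \<le> (1 / 2) ^ Suc n * (pi * (13 / 7))"
  unfolding norm_mult using inv_branch_funpow_range[where \<gamma> = \<gamma> and n = n and x = "x"]
    admissible_dlogcos_bound[OF adm, of "(inv_branch \<gamma> ^^ Suc n) x"]
  by (intro mult_mono) (auto simp: norm_power simp del: funpow.simps)

lemma branch_sum_summable: "summable (\<lambda>n. (1 / 2) ^ Suc n * dlogcos c ((inv_branch \<gamma> ^^ Suc n) x))"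
  by (rule summable_comparison_test'[OF sums_summable[OF half_power_sums[of "pi * (13 / 7)"]], of 0])
    (rule branch_sum_term_bound)

lemma branch_sum_bound: "\<bar>branch_sum c \<gamma> x\<bar> \<le> pi * (13 / 7)"
proof -
  have "norm (\<Sum>n. (1 / 2) ^ Suc n * dlogcos c ((inv_branch \<gamma> ^^ Suc n) x)) \<le> (\<Sum>n. (1 / 2) ^ Suc n * (pi * (13 / 7)))"
    by (rule norm_suminf_le[OF branch_sum_term_bound sums_summable[OF half_power_sums]])
  then show ?thesis unfolding branch_sum_def using sums_unique[OF half_power_sums, of "pi * (13 / 7)"] by simp
qed

text \<open>Splitting off the first term gives the functional equation that makes
  \<open>cob_deriv\<close> vanish on the half circle.\<close>

lemma branch_sum_step:
  "2 * branch_sum c \<gamma> x = dlogcos c (inv_branch \<gamma> x) + branch_sum c \<gamma> (inv_branch \<gamma> x)"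
proof -
  let ?f = "\<lambda>n. (1 / 2) ^ Suc n * dlogcos c ((inv_branch \<gamma> ^^ Suc n) x)"
  have "branch_sum c \<gamma> x = ?f 0 + (\<Sum>n. ?f (Suc n))"
    unfolding branch_sum_def using suminf_split_head[OF branch_sum_summable] by simp
  also have "(\<Sum>n. ?f (Suc n)) = (\<Sum>n. 1 / 2 * ((1 / 2) ^ Suc n * dlogcos c ((inv_branch \<gamma> ^^ Suc n) (inv_branch \<gamma> x))))"
    by (rule arg_cong[where f = suminf]) (simp add: funpow_swap1 fun_eq_iff)
  also have "\<dots> = 1 / 2 * branch_sum c \<gamma> (inv_branch \<gamma> x)"
    unfolding branch_sum_def by (rule suminf_mult[OF branch_sum_summable])
  finally show ?thesis by simp
qed

text \<open>The chosen preimages of antipodal points are a quarter turn apart. By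
  \<open>branch_sum_step\<close> the difference is half of a quarter-turn difference of
  \<open>dlogcos\<close>, at most 109/70 pi, plus half of a variation of \<open>branch_sum\<close>,
  at most 218/91 pi.\<close>

lemma branch_sum_half_diff:
  "\<bar>branch_sum c \<gamma> x - branch_sum c \<gamma> (x + 1 / 2)\<bar> \<le> pi * (3597 / 1820)"
proof -
  let ?y = "inv_branch \<gamma> x" and ?z = "inv_branch \<gamma> (x + 1 / 2)"
  have "\<bar>dlogcos c ?y - dlogcos c ?z\<bar> \<le> pi * (109 / 70)"
  proof (cases "?y < \<gamma> + 1 / 4")
    case True
    have "?z = ?y + 1 / 4"
    proof (rule inv_branch_eqI)
      obtain k where k: "k \<in> \<int>" "frac (x - 2 * \<gamma>) = x - 2 * \<gamma> + k" using frac_eq_add_int by blast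
      have "2 * (?y + 1 / 4) - (x + 1 / 2) = k" using k(2) by (simp add: inv_branch_def field_simps)
      then show "2 * (?y + 1 / 4) - (x + 1 / 2) \<in> \<int>" using k(1) by simp
    qed (use True inv_branch_range[of \<gamma> x] in auto)
    then show ?thesis using admissible_dlogcos_quarter[OF adm, of ?y] True inv_branch_range[of \<gamma> x] by simp
  next
    case False
    have z: "?z = ?y - 1 / 4"
    proof (rule inv_branch_eqI)
      obtain k where k: "k \<in> \<int>" "frac (x - 2 * \<gamma>) = x - 2 * \<gamma> + k" using frac_eq_add_int by blast
      have "2 * (?y - 1 / 4) - (x + 1 / 2) = k - 1" using k(2) by (simp add: inv_branch_def field_simps)
      then show "2 * (?y - 1 / 4) - (x + 1 / 2) \<in> \<int>" using k(1) by simp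
    qed (use False inv_branch_range[of \<gamma> x] in auto)
    then have "?y = ?z + 1 / 4" by simp
    then show ?thesis
      using admissible_dlogcos_quarter[OF adm, of ?z] inv_branch_range[of \<gamma> "x + 1 / 2"] inv_branch_range[of \<gamma> x]
      by (simp add: abs_minus_commute)
  qed
  moreover have "\<bar>branch_sum c \<gamma> ?y - branch_sum c \<gamma> ?z\<bar> \<le> pi * (218 / 91)"
  proof -
    let ?g = "\<lambda>n. (1 / 2) ^ Suc n * dlogcos c ((inv_branch \<gamma> ^^ Suc n) ?y) - (1 / 2) ^ Suc n * dlogcos c ((inv_branch \<gamma> ^^ Suc n) ?z)"
    have "norm (?g n) \<le> (1 / 2) ^ Suc n * (pi * (218 / 91))" for n
    proof -
      have "norm (?g n) = (1 / 2) ^ Suc n * \<bar>dlogcos c ((inv_branch \<gamma> ^^ Suc n) ?y) - dlogcos c ((inv_branch \<gamma> ^^ Suc n) ?z)\<bar>"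
        unfolding right_diff_distrib[symmetric] real_norm_def abs_mult by simp
      also have "\<dots> \<le> (1 / 2) ^ Suc n * (pi * (218 / 91))"
        using inv_branch_funpow_range[where \<gamma> = \<gamma> and n = n and x = "?y"] inv_branch_funpow_range[where \<gamma> = \<gamma> and n = n and x = "?z"]
        by (intro mult_left_mono admissible_dlogcos_osc[OF adm]) (auto simp del: funpow.simps)
      finally show ?thesis .
    qed
    then have "norm (\<Sum>n. ?g n) \<le> (\<Sum>n. (1 / 2) ^ Suc n * (pi * (218 / 91)))"
      by (rule norm_suminf_le[OF _ sums_summable[OF half_power_sums]])
    moreover have "(\<Sum>n. ?g n) = branch_sum c \<gamma> ?y - branch_sum c \<gamma> ?z"
      unfolding branch_sum_def by (rule suminf_diff[OF branch_sum_summable branch_sum_summable, symmetric])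
    ultimately show ?thesis using sums_unique[OF half_power_sums, of "pi * (218 / 91)"] by simp
  qed
  ultimately show ?thesis
    using branch_sum_step[of x] branch_sum_step[of "x + 1 / 2"] unfolding abs_le_iff by linarith
qed

lemma cob_deriv_zero:
  assumes "\<gamma> \<le> y" "y < \<gamma> + 1 / 2"
  shows "cob_deriv c \<gamma> y = 0"
proof -
  have "inv_branch \<gamma> (2 * y) = y" using assms by (intro inv_branch_eqI) auto
  then show ?thesis using branch_sum_step[of "2 * y"] by (simp add: cob_deriv_def)
qed

text \<open>The points \<open>y\<close> and \<open>y - 1 / 2\<close> have the same double modulo 1,
  and \<open>cob_deriv\<close> vanishes at the second, so what remains is a difference of
  \<open>dlogcos\<close> and one of \<open>branch_sum\<close>.\<close>

lemma cob_deriv_gap: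
  assumes "\<gamma> + 1 / 2 \<le> y" "y < \<gamma> + 1"
  shows "\<bar>cob_deriv c \<gamma> y - (dlogcos c y - dlogcos c (y - 1 / 2))\<bar> \<le> pi * (3597 / 1820)"
proof -
  have "inv_branch \<gamma> (2 * y) = y - 1 / 2" using assms by (intro inv_branch_eqI) auto
  then show ?thesis using branch_sum_step[of "2 * y"] branch_sum_half_diff[of "y - 1 / 2"]
    by (simp add: cob_deriv_def abs_minus_commute)
qed

lemma cob_deriv_add_int:
  assumes "k \<in> \<int>" shows "cob_deriv c \<gamma> (y + k) = cob_deriv c \<gamma> y"
proof -
  have "dlogcos c (y + k) = dlogcos c y"
  proof -
    obtain j :: int where j: "k = of_int j" using assms by (auto elim: Ints_cases)
    have "tan (pi * (y + k + c)) = tan (pi * (y + c) + of_int j * pi)" by (simp add: j algebra_simps)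
    also have "\<dots> = tan (pi * (y + c))" by (rule tan_periodic_int)
    finally show ?thesis by (simp add: dlogcos_def)
  qed
  moreover have "2 * k \<in> \<int>" using assms by simp
  then have "branch_sum c \<gamma> (2 * (y + k)) = branch_sum c \<gamma> (2 * y)"
    using branch_sum_add_int[of "2 * k" c \<gamma> "2 * y"] by (simp add: algebra_simps)
  ultimately show ?thesis using branch_sum_add_int[OF assms] by (simp add: cob_deriv_def)
qed

lemma cob_deriv_le:
  assumes "\<gamma> + 1 / 2 \<le> y" "y < 1 / 2 - c"
  shows "cob_deriv c \<gamma> y \<le> - (1 / 50)"
proof -
  have "\<gamma> < - c" using adm unfolding admissible_def by linarith
  moreover have "- c < \<gamma> + 1 / 2" using adm unfolding admissible_def by linarith
  ultimately have "dlogcos c y - dlogcos c (y - 1 / 2) \<le> - 2 * pi" 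
    using assms by (intro dlogcos_half_diff_neg) auto
  moreover have "y < \<gamma> + 1" using assms \<open>- c < \<gamma> + 1 / 2\<close> by simp
  ultimately have "cob_deriv c \<gamma> y \<le> pi * (3597 / 1820) - 2 * pi"
    using cob_deriv_gap[of y] assms unfolding abs_le_iff by linarith
  \<comment> \<open>Here 2 - 3597/1820 = 43/1820, and three times this exceeds 1/50.\<close>
  also have "\<dots> \<le> - (1 / 50)" using pi_gt3 by simp
  finally show ?thesis .
qed

text \<open>The mirror image of \<open>cob_deriv_le\<close>; translation by 1 brings
  \<open>y\<close> into the range of \<open>cob_deriv_gap\<close>.\<close>

lemma cob_deriv_ge:
  assumes "- (1 / 2) - c < y" "y < \<gamma>"
  shows "cob_deriv c \<gamma> y \<ge> 1 / 50"
proof -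
  have "\<gamma> < - c" using adm unfolding admissible_def by linarith
  moreover have "- c < \<gamma> + 1 / 2" using adm unfolding admissible_def by linarith
  ultimately have "dlogcos c (y + 1) - dlogcos c (y + 1 - 1 / 2) \<ge> 2 * pi" 
    using assms by (intro dlogcos_half_diff_pos) auto
  moreover have "\<gamma> + 1 / 2 \<le> y + 1" using assms \<open>\<gamma> < - c\<close> by simp
  ultimately have "cob_deriv c \<gamma> (y + 1) \<ge> 2 * pi - pi * (3597 / 1820)"
    using cob_deriv_gap[of "y + 1"] assms unfolding abs_le_iff by linarith
  moreover have "2 * pi - pi * (3597 / 1820) \<ge> 1 / 50" using pi_gt3 by simp
  ultimately show ?thesis using cob_deriv_add_int[of 1 y] by simp
qed

end

section \<open>Construction of the coboundary\<close>

lemma ex_primitive: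
  fixes f :: "real \<Rightarrow> real"
  assumes "\<And>a b. f integrable_on {a..b}"
  shows "\<exists>F. \<forall>a b. a \<le> b \<longrightarrow> (f has_integral (F b - F a)) {a..b}"
proof -
  \<comment> \<open>For negative \<open>x\<close> the interval \<open>{0..x}\<close> is empty and
    its integral 0, so the oriented integral needs both cases.\<close>
  define F where "F x = (if x \<ge> 0 then integral {0..x} f else - integral {x..0} f)" for x
  have "(f has_integral (F b - F a)) {a..b}" if ab: "a \<le> b" for a b
  proof -
    have i: "(f has_integral integral {x..y} f) {x..y}" for x y
      using assms by (rule integrable_integral)
    have c: "integral {x..z} f = integral {x..y} f + integral {y..z} f" if "x \<le> y" "y \<le> z" for x y z
      using Henstock_Kurzweil_Integration.integral_combine[OF that assms] by simp
    have "integral {a..b} f = F b - F a"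
      using ab c[of 0 a b] c[of a 0 b] c[of a b 0] by (auto simp: F_def)
    then show ?thesis using i[of a b] by simp
  qed
  then show ?thesis by blast
qed

lemma has_integral_le_const:
  fixes f :: "real \<Rightarrow> real"
  assumes f: "(f has_integral I) {a..b}" and ab: "a \<le> b" and le: "\<And>x. a < x \<Longrightarrow> x < b \<Longrightarrow> f x \<le> C"
  shows "I \<le> C * (b - a)"
proof -
  let ?g = "\<lambda>x. if a < x \<and> x < b then f x else C"
  have "(?g has_integral I) (cbox a b)"
    using f by (intro has_integral_spike_interior[of f I a b ?g]) auto
  moreover have "((\<lambda>x. C) has_integral C * (b - a)) (cbox a b)"
    using has_integral_const_real[of C a b] ab by (simp add: mult.commute)
  ultimately show ?thesis by (rule has_integral_le) (use le in auto)
qed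

lemma has_integral_ge_const:
  fixes f :: "real \<Rightarrow> real"
  assumes f: "(f has_integral I) {a..b}" and ab: "a \<le> b" and ge: "\<And>x. a < x \<Longrightarrow> x < b \<Longrightarrow> f x \<ge> C"
  shows "I \<ge> C * (b - a)"
  using has_integral_le_const[OF has_integral_neg[OF f] ab, of "- C"] ge by simp

lemma bounded_borel_integrable_on:
  fixes f :: "real \<Rightarrow> real"
  assumes [measurable]: "f \<in> borel_measurable borel" and "\<And>x. \<bar>f x\<bar> \<le> B"
  shows "f integrable_on {a..b}"
proof -
  have "integrable lebesgue (\<lambda>x. indicator {a..b} x *\<^sub>R f x)"
    by (rule integrableI_bounded_set_indicator[where B = B])
      (use assms in \<open>auto simp: emeasure_lborel_Icc_eq intro!: measurable_completion\<close>)
  then have "set_integrable lebesgue {a..b} f" unfolding set_integrable_def .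
  then show ?thesis by (rule set_lebesgue_integral_eq_integral(1))
qed

lemma DERIV_logcos:
  assumes "cos (pi * (x + c)) > 0"
  shows "(logcos c has_real_derivative dlogcos c x) (at x)"
proof -
  have "((\<lambda>x. ln (cos (pi * (x + c)))) has_real_derivative dlogcos c x) (at x)"
    unfolding dlogcos_def tan_def using assms by (auto intro!: derivative_eq_intros)
  moreover have "\<forall>\<^sub>F y in nhds x. ln (cos (pi * (y + c))) = logcos c y"
  proof -
    have "isCont (\<lambda>y. cos (pi * (y + c))) x" by (intro continuous_intros)
    then have "\<forall>\<^sub>F y in nhds x. cos (pi * (y + c)) > 0"
      using assms tendsto_at_iff_tendsto_nhds[of "\<lambda>y. cos (pi * (y + c))" x]
      unfolding isCont_def by (intro order_tendstoD(1)) auto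
    then show ?thesis by eventually_elim (simp add: logcos_def)
  qed
  ultimately show ?thesis by (rule DERIV_cong_ev[OF refl _ refl, THEN iffD1, rotated])
qed

lemma has_integral_dlogcos:
  assumes "a \<le> b" "\<And>x. a \<le> x \<Longrightarrow> x \<le> b \<Longrightarrow> cos (pi * (x + c)) > 0"
  shows "(dlogcos c has_integral (logcos c b - logcos c a)) {a..b}"
  using assms
  by (intro fundamental_theorem_of_calculus)
    (auto intro!: DERIV_logcos[THEN has_real_derivative_iff_has_vector_derivative[THEN iffD1], THEN has_vector_derivative_at_within])

lemma cos_pos_centre:
  assumes "- (1 / 2) - c < x" "x < 1 / 2 - c"
  shows "cos (pi * (x + c)) > 0"
proof (rule cos_gt_zero_pi)
  have "- (1 / 2) < x + c" "x + c < 1 / 2" using assms by linarith+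
  then have "pi * - (1 / 2) < pi * (x + c)" "pi * (x + c) < pi * (1 / 2)"
    using pi_gt_zero by (intro mult_strict_left_mono; simp)+
  then show "- (pi / 2) < pi * (x + c)" "pi * (x + c) < pi / 2" by simp_all
qed

lemma ex_shift_centre:
  assumes "cos (pi * (x + c)) \<noteq> 0"
  shows "\<exists>k\<in>\<int>. - (1 / 2) - c < x + k \<and> x + k < 1 / 2 - c"
proof -
  define k :: real where "k = - of_int \<lfloor>x + c + 1 / 2\<rfloor>"
  have k: "k \<in> \<int>" by (simp add: k_def)
  have "x + k = x - of_int \<lfloor>x + c + 1 / 2\<rfloor>" by (simp add: k_def)
  then have b: "- (1 / 2) - c \<le> x + k" "x + k < 1 / 2 - c"
    using of_int_floor_le[of "x + c + 1 / 2"] floor_correct[of "x + c + 1 / 2"] by linarith+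
  have "x + k \<noteq> - (1 / 2) - c"
  proof
    assume "x + k = - (1 / 2) - c"
    then have "x + c + k = - (1 / 2)" by simp
    then have "cos (pi * (x + c + k)) = 0" by simp
    then show False using abs_cos_pi_add_int[OF k, of "x + c"] assms by simp
  qed
  then show ?thesis using b k by (intro bexI[of _ k]) auto
qed

text \<open>The means of the branch sums at \<open>\<gamma>1\<close> and \<open>\<gamma>2\<close> have opposite signs, so some convex combination
  has mean \<open>0\<close> and hence a 1-periodic primitive \<open>\<psi>\<close>. The derivative of \<open>g + \<psi> - \<psi> \<circ> f\<close> vanishes
  on \<open>[\<gamma>2, \<gamma>1 + 1/2]\<close>, is negative to the right of it and positive to the left, up to the
  singularity of \<open>g\<close>.\<close>

lemma ex_subaction:
  assumes a1: "admissible c \<gamma>1" and a2: "admissible c \<gamma>2"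
    and lt: "\<gamma>1 < \<gamma>2" "\<gamma>2 < \<gamma>1 + 1 / 2"
    and J1: "integral {0..1} (branch_sum c \<gamma>1) > 0" and J2: "integral {0..1} (branch_sum c \<gamma>2) < 0"
  obtains \<psi> \<beta> where "\<psi> \<in> borel_measurable borel" "\<And>x. \<psi> (x + 1) = \<psi> x" "\<exists>M. \<forall>x. \<bar>\<psi> x\<bar> \<le> M"
    "\<And>x. cos (pi * (x + c)) \<noteq> 0 \<Longrightarrow> logcos c x + \<psi> x - \<psi> (2 * x) \<le> \<beta>"
    "\<And>x. \<gamma>2 \<le> x \<Longrightarrow> x \<le> \<gamma>1 + 1 / 2 \<Longrightarrow> cos (pi * (x + c)) \<noteq> 0 \<and> logcos c x + \<psi> x - \<psi> (2 * x) = \<beta>"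
    "\<And>x. cos (pi * (x + c)) \<noteq> 0 \<Longrightarrow> logcos c x + \<psi> x - \<psi> (2 * x) = \<beta> \<Longrightarrow> \<exists>k\<in>\<int>. \<gamma>2 \<le> x + k \<and> x + k \<le> \<gamma>1 + 1 / 2"
proof -
  let ?J1 = "integral {0..1} (branch_sum c \<gamma>1)" and ?J2 = "integral {0..1} (branch_sum c \<gamma>2)"
  let ?B = "pi * (13 / 7)"
  define w where "w = - ?J2 / (?J1 - ?J2)"
  have w: "0 < w" "w < 1" using J1 J2 by (auto simp: w_def field_simps)
  define \<Phi> where "\<Phi> x = w * branch_sum c \<gamma>1 x + (1 - w) * branch_sum c \<gamma>2 x" for x
  have [measurable]: "\<Phi> \<in> borel_measurable borel" unfolding \<Phi>_def[abs_def] by measurable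
  have \<Phi>_bound: "\<bar>\<Phi> x\<bar> \<le> ?B" for x
  proof -
    have "\<bar>\<Phi> x\<bar> \<le> w * \<bar>branch_sum c \<gamma>1 x\<bar> + (1 - w) * \<bar>branch_sum c \<gamma>2 x\<bar>"
      unfolding \<Phi>_def using w by (intro order_trans[OF abs_triangle_ineq]) (simp add: abs_mult)
    also have "\<dots> \<le> w * ?B + (1 - w) * ?B"
      using w branch_sum_bound[OF a1] branch_sum_bound[OF a2] by (intro add_mono mult_left_mono) auto
    also have "\<dots> = ?B" by (simp only: distrib_right[symmetric]) simp
    finally show ?thesis .
  qed
  have \<Phi>_per: "\<Phi> (x + 1) = \<Phi> x" for x
    unfolding \<Phi>_def by (simp add: branch_sum_add_int)
  obtain \<psi> where \<psi>: "\<And>a b. a \<le> b \<Longrightarrow> (\<Phi> has_integral (\<psi> b - \<psi> a)) {a..b}"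
    using ex_primitive[OF bounded_borel_integrable_on[OF \<open>\<Phi> \<in> borel_measurable borel\<close> \<Phi>_bound]] by blast
  have lip: "\<bar>\<psi> b - \<psi> a\<bar> \<le> ?B * (b - a)" if "a \<le> b" for a b
  proof -
    have b: "\<Phi> x \<le> ?B" "- ?B \<le> \<Phi> x" for x using \<Phi>_bound[of x] unfolding abs_le_iff by linarith+
    have "\<psi> b - \<psi> a \<le> ?B * (b - a)" by (rule has_integral_le_const[OF \<psi>[OF that] that b(1)])
    moreover have "- ?B * (b - a) \<le> \<psi> b - \<psi> a" by (rule has_integral_ge_const[OF \<psi>[OF that] that b(2)])
    ultimately show ?thesis unfolding abs_le_iff mult_minus_left by linarith
  qed
  have "(branch_sum c \<gamma>1 has_integral ?J1) {0..1}" "(branch_sum c \<gamma>2 has_integral ?J2) {0..1}"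
    using bounded_borel_integrable_on[OF branch_sum_borel branch_sum_bound[OF a1]]
      bounded_borel_integrable_on[OF branch_sum_borel branch_sum_bound[OF a2]]
    by (auto intro: integrable_integral)
  then have "(\<Phi> has_integral (w * ?J1 + (1 - w) * ?J2)) {0..1}"
    unfolding \<Phi>_def[abs_def] by (intro has_integral_add has_integral_mult_right)
  moreover have "w * ?J1 + (1 - w) * ?J2 = 0"
  proof -
    have "w * (?J1 - ?J2) = - ?J2" using J1 J2 by (simp add: w_def)
    then show ?thesis by (simp add: algebra_simps)
  qed
  ultimately have \<psi>01: "\<psi> 1 = \<psi> 0" using has_integral_unique[OF _ \<psi>[of 0 1]] by fastforce
  \<comment> \<open>Periodicity of \<open>\<Phi>\<close> makes increments of \<open>\<psi>\<close>
    periodic; the zero mean, in the form \<open>\<psi>01\<close>, then makes \<open>\<psi>\<close>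
    itself periodic.\<close>
  have shift: "\<psi> (b + 1) - \<psi> (a + 1) = \<psi> b - \<psi> a" if "a \<le> b" for a b
  proof -
    have "(\<Phi> has_integral (\<psi> (b + 1) - \<psi> (a + 1))) (cbox (a + 1) (b + 1))" using \<psi> that by simp
    from has_integral_affinity[OF this, of 1 1]
    have "(\<Phi> has_integral (\<psi> (b + 1) - \<psi> (a + 1))) {a..b}" using that by (simp add: \<Phi>_per)
    then show ?thesis using has_integral_unique \<psi>[OF that] by blast
  qed
  have per: "\<psi> (x + 1) = \<psi> x" for x
    using shift[of 0 x] shift[of x 0] \<psi>01 by (cases "0 \<le> x") auto
  have cont: "continuous_on UNIV \<psi>"
  proof (rule lipschitz_on_continuous_on[of ?B])
    show "?B-lipschitz_on UNIV \<psi>"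
    proof (rule lipschitz_onI)
      fix x y :: real
      show "dist (\<psi> x) (\<psi> y) \<le> ?B * dist x y"
        using lip[of x y] lip[of y x] by (cases "x \<le> y") (auto simp: dist_real_def abs_minus_commute)
    qed simp
  qed
  have bdd: "\<bar>\<psi> x\<bar> \<le> \<bar>\<psi> 0\<bar> + ?B" for x
  proof -
    have "\<psi> (frac x) = \<psi> x" using periodic_frac[of \<psi>] per by blast
    moreover have "\<bar>\<psi> (frac x) - \<psi> 0\<bar> \<le> ?B * (frac x - 0)" by (rule lip) simp
    moreover have "?B * (frac x - 0) \<le> ?B * 1" using frac_lt_1[of x] by (intro mult_left_mono) (auto simp: less_imp_le)
    ultimately show ?thesis by linarith
  qed
  define D where "D x = logcos c x + \<psi> x - \<psi> (2 * x)" for x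
  define D' where "D' x = w * cob_deriv c \<gamma>1 x + (1 - w) * cob_deriv c \<gamma>2 x" for x
  have D'_eq: "D' x = dlogcos c x + \<Phi> x - 2 * \<Phi> (2 * x)" for x
    by (simp add: D'_def cob_deriv_def \<Phi>_def algebra_simps)
  \<comment> \<open>The inverse branches jump, so \<open>\<psi>\<close> need not be differentiable
    everywhere; monotonicity of \<open>D\<close> is therefore read off from integrals of
    \<open>D'\<close>.\<close>
  have D: "(D' has_integral (D b - D a)) {a..b}" if "a \<le> b" "- (1 / 2) - c < a" "b < 1 / 2 - c" for a b
  proof -
    have "(\<Phi> has_integral (\<psi> (2 * b) - \<psi> (2 * a))) (cbox (2 * a) (2 * b))" using \<psi>[of "2 * a" "2 * b"] that by simp
    from has_integral_affinity[OF this, of 2 0]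
    have "((\<lambda>x. \<Phi> (2 * x)) has_integral (1 / 2 * (\<psi> (2 * b) - \<psi> (2 * a)))) {a..b}" using that by simp
    from has_integral_mult_right[OF this, of 2]
    have "((\<lambda>x. 2 * \<Phi> (2 * x)) has_integral (\<psi> (2 * b) - \<psi> (2 * a))) {a..b}"
      by (simp only: mult.assoc[symmetric]) simp
    moreover have "(dlogcos c has_integral (logcos c b - logcos c a)) {a..b}"
      using that by (intro has_integral_dlogcos cos_pos_centre) auto
    ultimately have "((\<lambda>x. dlogcos c x + \<Phi> x - 2 * \<Phi> (2 * x)) has_integral
        (logcos c b - logcos c a + (\<psi> b - \<psi> a) - (\<psi> (2 * b) - \<psi> (2 * a)))) {a..b}"
      using \<psi>[OF that(1)] by (intro has_integral_diff has_integral_add)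
    moreover have "logcos c b - logcos c a + (\<psi> b - \<psi> a) - (\<psi> (2 * b) - \<psi> (2 * a)) = D b - D a"
      by (simp add: D_def)
    ultimately show ?thesis unfolding D'_eq[abs_def] by simp
  qed
  have c: "- (1 / 2) - c < \<gamma>1" "\<gamma>2 + 1 / 2 < 1 / 2 - c" using a1 a2 unfolding admissible_def by linarith+
  have mid: "D x = D \<gamma>2" if "\<gamma>2 \<le> x" "x \<le> \<gamma>1 + 1 / 2" for x
  proof -
    have z: "D' y = 0" if "\<gamma>2 < y" "y < x" for y
      using that \<open>x \<le> \<gamma>1 + 1 / 2\<close> lt cob_deriv_zero[OF a1, of y] cob_deriv_zero[OF a2, of y] by (simp add: D'_def)
    have i: "(D' has_integral (D x - D \<gamma>2)) {\<gamma>2..x}" using that lt c by (intro D) auto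
    show ?thesis
      using has_integral_le_const[OF i that(1), of 0] has_integral_ge_const[OF i that(1), of 0] z by simp
  qed
  have right: "D x < D \<gamma>2" if "\<gamma>1 + 1 / 2 < x" "x < 1 / 2 - c" for x
  proof -
    have i: "(D' has_integral (D x - D (\<gamma>1 + 1 / 2))) {\<gamma>1 + 1 / 2..x}" using that lt c by (intro D) auto
    have "D' y \<le> w * - (1 / 50)" if y: "\<gamma>1 + 1 / 2 < y" "y < x" for y
    proof -
      have "cob_deriv c \<gamma>1 y \<le> - (1 / 50)" using y \<open>x < 1 / 2 - c\<close> by (intro cob_deriv_le[OF a1]) auto
      \<comment> \<open>Up to \<open>\<gamma>2 + 1 / 2\<close> this term is 0 and beyond it is
        negative; strictness comes from the \<open>\<gamma>1\<close> term with weight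
        \<open>w > 0\<close>.\<close>
      moreover have "cob_deriv c \<gamma>2 y \<le> 0"
        using cob_deriv_zero[OF a2, of y] cob_deriv_le[OF a2, of y] y lt \<open>x < 1 / 2 - c\<close>
        by (cases "y < \<gamma>2 + 1 / 2") auto
      ultimately have "D' y \<le> w * - (1 / 50) + (1 - w) * 0"
        unfolding D'_def using w by (intro add_mono mult_left_mono) auto
      then show ?thesis by simp
    qed
    then have "D x - D (\<gamma>1 + 1 / 2) \<le> w * - (1 / 50) * (x - (\<gamma>1 + 1 / 2))"
      using that by (intro has_integral_le_const[OF i]) auto
    also have "\<dots> < 0" using that w by (simp add: mult_pos_pos)
    finally show ?thesis using mid[of "\<gamma>1 + 1 / 2"] lt by simp
  qed
  have left: "D x < D \<gamma>2" if "- (1 / 2) - c < x" "x < \<gamma>2" for x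
  proof -
    have i: "(D' has_integral (D \<gamma>2 - D x)) {x..\<gamma>2}" using that lt c by (intro D) auto
    have "D' y \<ge> (1 - w) * (1 / 50)" if y: "x < y" "y < \<gamma>2" for y
    proof -
      have "cob_deriv c \<gamma>2 y \<ge> 1 / 50" using y \<open>- (1 / 2) - c < x\<close> by (intro cob_deriv_ge[OF a2]) auto
      moreover have "cob_deriv c \<gamma>1 y \<ge> 0"
        using cob_deriv_zero[OF a1, of y] cob_deriv_ge[OF a1, of y] y lt \<open>- (1 / 2) - c < x\<close>
        by (cases "y < \<gamma>1") auto
      ultimately have "D' y \<ge> w * 0 + (1 - w) * (1 / 50)"
        unfolding D'_def using w by (intro add_mono mult_left_mono) auto
      then show ?thesis by simp
    qed
    then have "D \<gamma>2 - D x \<ge> (1 - w) * (1 / 50) * (\<gamma>2 - x)"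
      using that by (intro has_integral_ge_const[OF i]) auto
    moreover have "(1 - w) * (1 / 50) * (\<gamma>2 - x) > 0" using that w by (intro mult_pos_pos) auto
    ultimately show ?thesis by simp
  qed
  have D_per: "D (x + k) = D x" if "k \<in> \<int>" for x k
  proof -
    have "2 * k \<in> \<int>" using that by simp
    then have "\<psi> (2 * (x + k)) = \<psi> (2 * x)"
      using periodic_add_int[of \<psi> "2 * k" "2 * x"] per by (simp add: algebra_simps)
    then show ?thesis using logcos_add_int[OF that] periodic_add_int[of \<psi>, OF _ that] per by (simp add: D_def)
  qed
  show ?thesis
  proof (rule that[of \<psi> "D \<gamma>2", folded D_def])
    show "\<psi> \<in> borel_measurable borel" using cont by (rule borel_measurable_continuous_onI)
    show "\<exists>M. \<forall>x. \<bar>\<psi> x\<bar> \<le> M" using bdd by blast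
    show "D x \<le> D \<gamma>2" if "cos (pi * (x + c)) \<noteq> 0" for x
    proof -
      obtain k where k: "k \<in> \<int>" "- (1 / 2) - c < x + k" "x + k < 1 / 2 - c" using ex_shift_centre[OF \<open>cos (pi * (x + c)) \<noteq> 0\<close>] by blast
      then show ?thesis using mid[of "x + k"] left[of "x + k"] right[of "x + k"] D_per[OF k(1), of x] by linarith
    qed
    show "cos (pi * (x + c)) \<noteq> 0 \<and> D x = D \<gamma>2" if "\<gamma>2 \<le> x" "x \<le> \<gamma>1 + 1 / 2" for x
      using mid[OF that] cos_pos_centre[of c x] that lt c by auto
    show "\<exists>k\<in>\<int>. \<gamma>2 \<le> x + k \<and> x + k \<le> \<gamma>1 + 1 / 2" if "cos (pi * (x + c)) \<noteq> 0" "D x = D \<gamma>2" for x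
    proof -
      obtain k where k: "k \<in> \<int>" "- (1 / 2) - c < x + k" "x + k < 1 / 2 - c" using ex_shift_centre[OF \<open>cos (pi * (x + c)) \<noteq> 0\<close>] by blast
      then show ?thesis using left[of "x + k"] right[of "x + k"] D_per[OF k(1), of x] that(2)
        by (intro bexI[of _ k]) (auto simp: not_less[symmetric])
    qed
  qed (rule per)
qed

section \<open>Orbits of rotational type\<close>

lemma branch_sum_iterate:
  assumes "admissible c \<gamma>"
  shows "branch_sum c \<gamma> x = (\<Sum>n<K. dlogcos c ((inv_branch \<gamma> ^^ Suc n) x) / 2 ^ Suc n)
    + branch_sum c \<gamma> ((inv_branch \<gamma> ^^ K) x) / 2 ^ K"
proof (induction K)
  case (Suc K)
  show ?case
    using Suc branch_sum_step[OF assms, of "(inv_branch \<gamma> ^^ K) x"] by (simp add: field_simps)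
qed simp

text \<open>For a fixed half circle the points at which \<open>dlogcos\<close> is evaluated do not
  depend on \<open>c\<close>, and the tangent increases.\<close>

lemma branch_sum_antimono:
  assumes a: "admissible c \<gamma>" and a': "admissible c' \<gamma>" and le: "c \<le> c'"
  shows "branch_sum c' \<gamma> x \<le> branch_sum c \<gamma> x"
  unfolding branch_sum_def
proof (rule suminf_le)
  fix n
  let ?y = "(inv_branch \<gamma> ^^ Suc n) x"
  have y: "\<gamma> \<le> ?y" "?y \<le> \<gamma> + 1 / 2"
    using inv_branch_funpow_range[where \<gamma> = \<gamma> and n = n and x = x] by (auto simp del: funpow.simps)
  have "pi * (?y + c) \<le> pi * (?y + c')" using le by simp
  then have "tan (pi * (?y + c)) \<le> tan (pi * (?y + c'))"
    using admissible_angle[OF a y] admissible_angle[OF a' y] by (subst tan_mono_le_eq) auto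
  then show "(1 / 2) ^ Suc n * dlogcos c' ?y \<le> (1 / 2) ^ Suc n * dlogcos c ?y"
    unfolding dlogcos_def mult_minus_left by (intro mult_left_mono le_imp_neg_le) simp_all
qed (use branch_sum_summable[OF a] branch_sum_summable[OF a'] in auto)

lemma branch_sum_integrable: "admissible c \<gamma> \<Longrightarrow> branch_sum c \<gamma> integrable_on {a..b}"
  by (rule bounded_borel_integrable_on[OF branch_sum_borel branch_sum_bound])

lemma integral_branch_sum_antimono:
  assumes "admissible c \<gamma>" "admissible c' \<gamma>" "c \<le> c'"
  shows "integral {0..1} (branch_sum c' \<gamma>) \<le> integral {0..1} (branch_sum c \<gamma>)"
  using assms by (intro integral_le branch_sum_integrable branch_sum_antimono)

text \<open>The weight \<open>1 / 2 ^ n\<close> is the slope of the affine inner map, so the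
  integrand is an exact derivative.\<close>

lemma has_integral_dlogcos_scaled:
  assumes "a \<le> b" and pos: "\<And>y. z + (a - e) / 2 ^ n \<le> y \<Longrightarrow> y \<le> z + (b - e) / 2 ^ n \<Longrightarrow> cos (pi * (y + c)) > 0"
  shows "((\<lambda>x. dlogcos c (z + (x - e) / 2 ^ n) / 2 ^ n) has_integral
      (logcos c (z + (b - e) / 2 ^ n) - logcos c (z + (a - e) / 2 ^ n))) {a..b}"
proof (rule fundamental_theorem_of_calculus[OF assms(1)])
  fix x assume x: "x \<in> {a..b}"
  have "cos (pi * (z + (x - e) / 2 ^ n + c)) > 0" using x by (intro pos) (auto simp: divide_right_mono)
  then have "(logcos c has_real_derivative dlogcos c (z + (x - e) / 2 ^ n)) (at (z + (x - e) / 2 ^ n))"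
    by (rule DERIV_logcos)
  moreover have "((\<lambda>x. z + (x - e) / 2 ^ n) has_real_derivative 1 / 2 ^ n) (at x within {a..b})"
    by (auto intro!: derivative_eq_intros)
  ultimately have "((\<lambda>x. logcos c (z + (x - e) / 2 ^ n)) has_real_derivative dlogcos c (z + (x - e) / 2 ^ n) * (1 / 2 ^ n)) (at x within {a..b})"
    by (rule DERIV_chain2)
  then show "((\<lambda>x. logcos c (z + (x - e) / 2 ^ n)) has_vector_derivative dlogcos c (z + (x - e) / 2 ^ n) / 2 ^ n) (at x within {a..b})"
    by (simp add: has_real_derivative_iff_has_vector_derivative)
qed

text \<open>Where every iterate of the inverse branch is affine, the first \<open>K\<close> terms
  integrate exactly; by \<open>branch_sum_iterate\<close> the rest is \<open>branch_sum\<close> at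
  an iterate, divided by \<open>2 ^ K\<close>.\<close>

lemma integral_branch_sum_arc:
  assumes adm: "admissible c \<gamma>" and ab: "a \<le> b"
    and it: "\<And>n x. a \<le> x \<Longrightarrow> x < b \<Longrightarrow> (inv_branch \<gamma> ^^ n) x = z n + (x - e) / 2 ^ n"
    and rng: "\<And>n. n \<ge> 1 \<Longrightarrow> \<gamma> \<le> z n + (a - e) / 2 ^ n" "\<And>n. n \<ge> 1 \<Longrightarrow> z n + (b - e) / 2 ^ n \<le> \<gamma> + 1 / 2"
  shows "\<bar>integral {a..b} (branch_sum c \<gamma>)
      - (\<Sum>n\<in>{1..K}. logcos c (z n + (b - e) / 2 ^ n) - logcos c (z n + (a - e) / 2 ^ n))\<bar>
    \<le> pi * (13 / 7) / 2 ^ K * (b - a)"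
proof -
  let ?S = "\<lambda>x. \<Sum>n\<in>{1..K}. dlogcos c (z n + (x - e) / 2 ^ n) / 2 ^ n"
  let ?I = "\<Sum>n\<in>{1..K}. logcos c (z n + (b - e) / 2 ^ n) - logcos c (z n + (a - e) / 2 ^ n)"
  let ?E = "pi * (13 / 7) / 2 ^ K"
  have "(?S has_integral ?I) {a..b}"
  proof (rule has_integral_sum)
    fix n assume n: "n \<in> {1..K}"
    show "((\<lambda>x. dlogcos c (z n + (x - e) / 2 ^ n) / 2 ^ n) has_integral
      (logcos c (z n + (b - e) / 2 ^ n) - logcos c (z n + (a - e) / 2 ^ n))) {a..b}"
    proof (rule has_integral_dlogcos_scaled[OF ab])
      fix y assume "z n + (a - e) / 2 ^ n \<le> y" "y \<le> z n + (b - e) / 2 ^ n"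
      then show "cos (pi * (y + c)) > 0"
        using rng[of n] n by (intro admissible_cos_pos[OF adm]) auto
    qed
  qed simp
  moreover have "(branch_sum c \<gamma> has_integral integral {a..b} (branch_sum c \<gamma>)) {a..b}"
    using branch_sum_integrable[OF adm] by (rule integrable_integral)
  ultimately have i: "((\<lambda>x. branch_sum c \<gamma> x - ?S x) has_integral (integral {a..b} (branch_sum c \<gamma>) - ?I)) {a..b}"
    by (intro has_integral_diff)
  have bd: "\<bar>branch_sum c \<gamma> x - ?S x\<bar> \<le> ?E" if "a < x" "x < b" for x
  proof -
    have "?S x = (\<Sum>n<K. dlogcos c (z (Suc n) + (x - e) / 2 ^ Suc n) / 2 ^ Suc n)"
      by (rule sum.reindex_bij_witness[of _ Suc "\<lambda>n. n - 1"]) auto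
    also have "\<dots> = (\<Sum>n<K. dlogcos c ((inv_branch \<gamma> ^^ Suc n) x) / 2 ^ Suc n)"
      using that by (intro sum.cong refl) (simp add: it del: funpow.simps)
    finally have "branch_sum c \<gamma> x - ?S x = branch_sum c \<gamma> ((inv_branch \<gamma> ^^ K) x) / 2 ^ K"
      using branch_sum_iterate[OF adm, of x K] by simp
    then have "\<bar>branch_sum c \<gamma> x - ?S x\<bar> = \<bar>branch_sum c \<gamma> ((inv_branch \<gamma> ^^ K) x)\<bar> / 2 ^ K"
      by (simp only: abs_divide) simp
    also have "\<dots> \<le> ?E" using branch_sum_bound[OF adm] by (rule divide_right_mono) simp
    finally show ?thesis .
  qed
  have b1: "branch_sum c \<gamma> x - ?S x \<le> ?E" and b2: "- ?E \<le> branch_sum c \<gamma> x - ?S x" if "a < x" "x < b" for x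
    using bd[OF that] unfolding abs_le_iff by linarith+
  have "integral {a..b} (branch_sum c \<gamma>) - ?I \<le> ?E * (b - a)"
    by (rule has_integral_le_const[OF i ab b1])
  moreover have "- ?E * (b - a) \<le> integral {a..b} (branch_sum c \<gamma>) - ?I"
    by (rule has_integral_ge_const[OF i ab b2])
  ultimately show ?thesis unfolding abs_le_iff mult_minus_left by linarith
qed

text \<open>A periodic orbit of rotational type, described by the arcs \<open>[l j, r j]\<close>, \<open>j < q\<close>, between
  consecutive points of the orbit, where doubling maps arc \<open>j + 1\<close> onto arc \<open>j\<close>. The longest arc has
  index \<open>0\<close>; all other end points are lifted into a common half circle. The half circle starting at
  \<open>start u\<close> is the one for which the cut point of the inverse branch returns to the arc \<open>0\<close> at
  distance \<open>u\<close> from its left end point.\<close>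

locale gap_system =
  fixes q :: nat and l r :: "nat \<Rightarrow> real" and js :: "nat list"
  assumes q_pos: "q > 0"
    and l_step: "2 * l (Suc m) - l m \<in> \<int>"
    and r_step: "2 * r (Suc m) - r m \<in> \<int>"
    and l_per: "l (m + q) = l m"
    and r_per: "m > 0 \<Longrightarrow> r (m + q) = r m"
    and r_0: "r 0 = r q + 1"
    and arc_length: "j < q \<Longrightarrow> r j - l j = 2 ^ (q - 1) / (2 ^ q - 1) / 2 ^ j"
    and js: "distinct js" "set js = {..<q}"
    and chain: "Suc i < q \<Longrightarrow> l (js ! Suc i) - r (js ! i) \<in> \<int>"
begin

text \<open>The length of arc 0. It exceeds 1/2, so this arc fits into no half circle; this is why
  \<open>r 0\<close> is lifted one turn above \<open>r q\<close>.\<close>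

definition L :: real where "L = 2 ^ (q - 1) / (2 ^ q - 1)"

definition start :: "real \<Rightarrow> real" where "start u = l q - 1 / 2 + u / 2 ^ q"

text \<open>The returning cut point splits arc 0, and its preimages split the other arcs. The left
  pieces start at \<open>l m\<close>, the right pieces end at \<open>r m\<close>; all of them with
  \<open>m > 0\<close> have to lie in the half circle, so that the inverse branch maps pieces
  affinely to pieces.\<close>

definition fits :: "real \<Rightarrow> bool" where
  "fits u \<longleftrightarrow> 0 \<le> u \<and> u \<le> L \<and> (\<forall>m\<in>{1..q}. start u \<le> l m \<and> l m + u / 2 ^ m \<le> start u + 1 / 2 \<and>
     start u \<le> r m - (L - u) / 2 ^ m \<and> r m \<le> start u + 1 / 2)"

text \<open>The integral over arc \<open>j\<close> of the n-th term of the branch sum, where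
  \<open>m = j + n\<close>: it depends on \<open>j\<close> and \<open>n\<close> only through
  \<open>m\<close>.\<close>

definition arc_diff :: "real \<Rightarrow> real \<Rightarrow> nat \<Rightarrow> real" where
  "arc_diff c u m = logcos c (l m + u / 2 ^ m) - logcos c (l m)
     + (logcos c (r m) - logcos c (r m - (L - u) / 2 ^ m))"

lemma L_nonneg: "L \<ge> 0" and L_le_1: "L \<le> 1"
proof -
  define a :: real where "a = 2 ^ (q - 1)"
  have "a \<ge> 1" by (simp add: a_def)
  moreover have "L = a / (2 * a - 1)"
  proof -
    have "2 ^ q = 2 * a" using q_pos by (cases q) (simp_all add: a_def)
    then show ?thesis by (simp add: L_def a_def)
  qed
  ultimately show "L \<ge> 0" "L \<le> 1" by simp_all
qed

lemma l_per': "l (m + k * q) = l m"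
proof (induction k)
  case (Suc k)
  have "l (m + Suc k * q) = l ((m + k * q) + q)" by (simp add: add_ac)
  then show ?case using l_per Suc by simp
qed simp

lemma r_per': "m > 0 \<Longrightarrow> r (m + k * q) = r m"
proof (induction k)
  case (Suc k)
  have "r (m + Suc k * q) = r ((m + k * q) + q)" by (simp add: add_ac)
  then show ?case using r_per[of "m + k * q"] Suc by simp
qed simp

text \<open>Representatives are taken in \<open>{1..q}\<close> because \<open>r\<close> is periodic
  only from index 1 on.\<close>

lemma ex_index: "m > 0 \<Longrightarrow> \<exists>m'\<in>{1..q}. \<exists>k. m = m' + k * q"
  using q_pos
  by (intro bexI[of _ "(m - 1) mod q + 1"] exI[of _ "(m - 1) div q"])
    (auto simp: Suc_le_eq mod_less_divisor algebra_simps)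

lemma fitsD:
  assumes f: "fits u" and m: "m > 0"
  shows "start u \<le> l m" "l m + u / 2 ^ m \<le> start u + 1 / 2"
    "start u \<le> r m - (L - u) / 2 ^ m" "r m \<le> start u + 1 / 2"
proof -
  obtain m' k where m': "m' \<in> {1..q}" "m = m' + k * q" using ex_index[OF m] by blast
  then have e: "l m = l m'" "r m = r m'" using l_per' r_per' by auto
  have u: "0 \<le> u" "u \<le> L" using f by (auto simp: fits_def)
  have "(2::real) ^ m' \<le> 2 ^ m" using m' by (intro power_increasing) auto
  then have "u / 2 ^ m \<le> u / 2 ^ m'" "(L - u) / 2 ^ m \<le> (L - u) / 2 ^ m'"
    using u by (auto intro!: divide_left_mono)
  moreover have "start u \<le> l m'" "l m' + u / 2 ^ m' \<le> start u + 1 / 2"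
    "start u \<le> r m' - (L - u) / 2 ^ m'" "r m' \<le> start u + 1 / 2" using f m' unfolding fits_def by auto
  ultimately show "start u \<le> l m" "l m + u / 2 ^ m \<le> start u + 1 / 2"
    "start u \<le> r m - (L - u) / 2 ^ m" "r m \<le> start u + 1 / 2" unfolding e by linarith+
qed

lemma inv_branch_left:
  assumes f: "fits u" and x: "l j \<le> x" "x < l j + u / 2 ^ j"
  shows "(inv_branch (start u) ^^ n) x = l (j + n) + (x - l j) / 2 ^ n"
proof (induction n)
  case (Suc n)
  have "inv_branch (start u) (l (j + n) + (x - l j) / 2 ^ n) = l (j + Suc n) + (x - l j) / 2 ^ Suc n"
  proof (rule inv_branch_eqI)
    have "(x - l j) / 2 ^ Suc n < (u / 2 ^ j) / 2 ^ Suc n" using x by (intro divide_strict_right_mono) auto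
    then have "(x - l j) / 2 ^ Suc n < u / 2 ^ (j + Suc n)" by (simp add: power_add field_simps)
    then show "l (j + Suc n) + (x - l j) / 2 ^ Suc n < start u + 1 / 2"
      using fitsD(2)[OF f, of "j + Suc n"] by linarith
    have "(x - l j) / 2 ^ Suc n \<ge> 0" using x by simp
    then show "start u \<le> l (j + Suc n) + (x - l j) / 2 ^ Suc n"
      using fitsD(1)[OF f, of "j + Suc n"] by linarith
    show "2 * (l (j + Suc n) + (x - l j) / 2 ^ Suc n) - (l (j + n) + (x - l j) / 2 ^ n) \<in> \<int>"
    proof -
      have "2 * (l (j + Suc n) + (x - l j) / 2 ^ Suc n) - (l (j + n) + (x - l j) / 2 ^ n) = 2 * l (Suc (j + n)) - l (j + n)"
        by (simp add: field_simps)
      then show ?thesis using l_step by metis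
    qed
  qed
  then show ?case using Suc by simp
qed simp

lemma inv_branch_right:
  assumes f: "fits u" and x: "r j - (L - u) / 2 ^ j \<le> x" "x < r j"
  shows "(inv_branch (start u) ^^ n) x = r (j + n) + (x - r j) / 2 ^ n"
proof (induction n)
  case (Suc n)
  have "inv_branch (start u) (r (j + n) + (x - r j) / 2 ^ n) = r (j + Suc n) + (x - r j) / 2 ^ Suc n"
  proof (rule inv_branch_eqI)
    have "(r j - x) / 2 ^ Suc n \<le> ((L - u) / 2 ^ j) / 2 ^ Suc n" using x by (intro divide_right_mono) auto
    then have "(r j - x) / 2 ^ Suc n \<le> (L - u) / 2 ^ (j + Suc n)" by (simp add: power_add field_simps)
    moreover have "(x - r j) / 2 ^ Suc n = - ((r j - x) / 2 ^ Suc n)" by (simp only: minus_divide_left minus_diff_eq)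
    ultimately show "start u \<le> r (j + Suc n) + (x - r j) / 2 ^ Suc n"
      using fitsD(3)[OF f, of "j + Suc n"] by linarith
    have "(x - r j) / 2 ^ Suc n < 0" using x by (simp add: divide_neg_pos)
    then show "r (j + Suc n) + (x - r j) / 2 ^ Suc n < start u + 1 / 2"
      using fitsD(4)[OF f, of "j + Suc n"] by linarith
    show "2 * (r (j + Suc n) + (x - r j) / 2 ^ Suc n) - (r (j + n) + (x - r j) / 2 ^ n) \<in> \<int>"
    proof -
      have "2 * (r (j + Suc n) + (x - r j) / 2 ^ Suc n) - (r (j + n) + (x - r j) / 2 ^ n) = 2 * r (Suc (j + n)) - r (j + n)"
        by (simp add: field_simps)
      then show ?thesis using r_step by metis
    qed
  qed
  then show ?case using Suc by simp
qed simp

lemma arc_split: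
  assumes "j < q"
  shows "r j - (L - u) / 2 ^ j = l j + u / 2 ^ j"
  using arc_length[OF assms] unfolding L_def by (simp add: diff_divide_distrib)

text \<open>After reindexing by \<open>m = j + n\<close> the sum over arc \<open>j\<close> starts
  beyond \<open>j\<close> and stops at the common index \<open>M\<close>. Fewer terms are then kept
  for larger \<open>j\<close>, but the arc is shorter by \<open>2 ^ j\<close>, so the error is the
  same for all arcs.\<close>

lemma integral_branch_sum_gap:
  assumes f: "fits u" and adm: "admissible c (start u)" and j: "j < q" and jM: "j \<le> M"
  shows "\<bar>integral {l j..r j} (branch_sum c (start u)) - (\<Sum>m\<in>{j<..M}. arc_diff c u m)\<bar>
    \<le> pi * (13 / 7) * L / 2 ^ M"
proof -
  let ?e = "l j + u / 2 ^ j" and ?K = "M - j" and ?\<phi> = "branch_sum c (start u)"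
  have u: "0 \<le> u" "u \<le> L" using f by (auto simp: fits_def)
  have e: "r j - (L - u) / 2 ^ j = ?e" by (rule arc_split[OF j])
  have le: "l j \<le> ?e" "?e \<le> r j"
  proof -
    show "l j \<le> ?e" using u by simp
    show "?e \<le> r j" using u unfolding e[symmetric] by simp
  qed
  have pw: "x / 2 ^ j / 2 ^ n = x / 2 ^ (j + n)" for n and x :: real by (simp add: power_add)
  have i1: "\<bar>integral {l j..?e} ?\<phi> - (\<Sum>n\<in>{1..?K}. logcos c (l (j + n) + (?e - l j) / 2 ^ n) - logcos c (l (j + n) + (l j - l j) / 2 ^ n))\<bar>
    \<le> pi * (13 / 7) / 2 ^ ?K * (?e - l j)"
  proof (rule integral_branch_sum_arc[OF adm le(1)])
    fix n x assume "l j \<le> x" "x < ?e"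
    then show "(inv_branch (start u) ^^ n) x = l (j + n) + (x - l j) / 2 ^ n" by (rule inv_branch_left[OF f])
  next
    fix n :: nat assume "n \<ge> 1"
    then show "start u \<le> l (j + n) + (l j - l j) / 2 ^ n" "l (j + n) + (?e - l j) / 2 ^ n \<le> start u + 1 / 2"
      using fitsD(1,2)[OF f, of "j + n"] by (simp_all only: add_diff_cancel_left' pw) simp_all
  qed
  have i2: "\<bar>integral {?e..r j} ?\<phi> - (\<Sum>n\<in>{1..?K}. logcos c (r (j + n) + (r j - r j) / 2 ^ n) - logcos c (r (j + n) + (?e - r j) / 2 ^ n))\<bar>
    \<le> pi * (13 / 7) / 2 ^ ?K * (r j - ?e)"
  proof (rule integral_branch_sum_arc[OF adm le(2)])
    fix n x assume "?e \<le> x" "x < r j"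
    then show "(inv_branch (start u) ^^ n) x = r (j + n) + (x - r j) / 2 ^ n"
      by (intro inv_branch_right[OF f]) (simp_all add: e)
  next
    fix n :: nat assume n: "n \<ge> 1"
    have "(?e - r j) / 2 ^ n = - ((L - u) / 2 ^ (j + n))" unfolding e[symmetric] pw[symmetric] by simp
    then show "start u \<le> r (j + n) + (?e - r j) / 2 ^ n" "r (j + n) + (r j - r j) / 2 ^ n \<le> start u + 1 / 2"
      using fitsD[OF f, of "j + n"] n by simp_all
  qed
  have "integral {l j..r j} ?\<phi> = integral {l j..?e} ?\<phi> + integral {?e..r j} ?\<phi>"
    using Henstock_Kurzweil_Integration.integral_combine[OF le branch_sum_integrable[OF adm]] by simp
  moreover have "(\<Sum>n\<in>{1..?K}. logcos c (l (j + n) + (?e - l j) / 2 ^ n) - logcos c (l (j + n) + (l j - l j) / 2 ^ n))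
      + (\<Sum>n\<in>{1..?K}. logcos c (r (j + n) + (r j - r j) / 2 ^ n) - logcos c (r (j + n) + (?e - r j) / 2 ^ n))
      = (\<Sum>m\<in>{j<..M}. arc_diff c u m)"
  proof -
    have "(?e - r j) / 2 ^ n = - ((L - u) / 2 ^ (j + n))" for n unfolding e[symmetric] pw[symmetric] by simp
    then have "(\<Sum>n\<in>{1..?K}. logcos c (l (j + n) + (?e - l j) / 2 ^ n) - logcos c (l (j + n) + (l j - l j) / 2 ^ n))
      + (\<Sum>n\<in>{1..?K}. logcos c (r (j + n) + (r j - r j) / 2 ^ n) - logcos c (r (j + n) + (?e - r j) / 2 ^ n))
      = (\<Sum>n\<in>{1..?K}. arc_diff c u (j + n))"
      unfolding sum.distrib[symmetric] by (intro sum.cong refl) (simp add: arc_diff_def power_add)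
    also have "\<dots> = (\<Sum>m\<in>{j<..M}. arc_diff c u m)"
      by (rule sum.reindex_bij_witness[of _ "\<lambda>m. m - j" "\<lambda>n. j + n"]) (use jM in auto)
    finally show ?thesis .
  qed
  moreover have "pi * (13 / 7) / 2 ^ ?K * (?e - l j) + pi * (13 / 7) / 2 ^ ?K * (r j - ?e) = pi * (13 / 7) * L / 2 ^ M"
  proof -
    have "pi * (13 / 7) / 2 ^ ?K * (?e - l j) + pi * (13 / 7) / 2 ^ ?K * (r j - ?e) = pi * (13 / 7) / 2 ^ ?K * (r j - l j)"
      unfolding distrib_left[symmetric] by simp
    also have "r j - l j = L / 2 ^ j" using arc_length[OF j] by (simp add: L_def)
    also have "pi * (13 / 7) / 2 ^ ?K * (L / 2 ^ j) = pi * (13 / 7) * L / 2 ^ (?K + j)" by (simp add: power_add)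
    finally show ?thesis using jM by simp
  qed
  ultimately show ?thesis using i1 i2 unfolding abs_le_iff by linarith
qed

section \<open>Tiling of the circle by the arcs\<close>

definition pos :: "nat \<Rightarrow> real" where
  "pos i = l (js ! 0) + (\<Sum>k<i. r (js ! k) - l (js ! k))"

lemma length_js: "length js = q"
  using distinct_card[OF js(1)] js(2) by simp

lemma js_less: "i < q \<Longrightarrow> js ! i < q"
  using js(2) length_js nth_mem by blast

lemma sum_js: "(\<Sum>i<q. f (js ! i)) = (\<Sum>j<q. f j)" for f :: "nat \<Rightarrow> real"
proof -
  have "(\<Sum>j<q. f j) = sum_list (map f js)" using js by (simp add: sum_list_distinct_conv_sum_set)
  also have "\<dots> = (\<Sum>i<q. f (js ! i))" by (simp add: sum_list_sum_nth length_js atLeast0LessThan)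
  finally show ?thesis by simp
qed

lemma pos_Suc: "pos (Suc i) = pos i + (r (js ! i) - l (js ! i))"
  by (simp add: pos_def)

lemma pos_cong: "i < q \<Longrightarrow> pos i - l (js ! i) \<in> \<int>"
proof (induction i)
  case (Suc i)
  have "pos (Suc i) - l (js ! Suc i) = (pos i - l (js ! i)) - (l (js ! Suc i) - r (js ! i))"
    by (simp add: pos_Suc)
  moreover have "pos i - l (js ! i) \<in> \<int>" using Suc by simp
  ultimately show ?case using chain[OF Suc.prems] by (simp only: Ints_diff)
qed (simp add: pos_def)

text \<open>The arc lengths are a geometric sum equal to 1. This also supplies the adjacency of the
  last arc to the first, which \<open>chain\<close> does not state.\<close>

lemma pos_q: "pos q = pos 0 + 1"
proof -
  have "(\<Sum>i<q. r (js ! i) - l (js ! i)) = (\<Sum>j<q. r j - l j)" by (rule sum_js[of "\<lambda>j. r j - l j"])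
  also have "\<dots> = (\<Sum>j<q. L * (1 / 2) ^ j)"
    using arc_length by (intro sum.cong) (auto simp: L_def power_divide)
  also have "\<dots> = L * ((1 - (1 / 2) ^ q) / (1 - 1 / 2))"
    unfolding sum_distrib_left[symmetric] by (subst sum_gp_strict) simp
  also have "\<dots> = 1"
  proof -
    define a :: real where "a = 2 ^ (q - 1)"
    have "a \<ge> 1" by (simp add: a_def)
    moreover have "2 ^ q = 2 * a" using q_pos by (cases q) (simp_all add: a_def)
    ultimately show ?thesis
      unfolding L_def power_divide a_def[symmetric] by (simp add: field_simps)
  qed
  finally show ?thesis by (simp add: pos_def)
qed

lemma pos_mono: "i < q \<Longrightarrow> pos i \<le> pos (Suc i)"
  using arc_length[OF js_less[of i]] by (simp add: pos_Suc)

lemma in_some_gap: "\<exists>k\<in>\<int>. \<exists>j<q. l j \<le> x + k \<and> x + k < r j"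
proof -
  let ?k = "- of_int \<lfloor>x - pos 0\<rfloor> :: real"
  have "pos 0 \<le> x + ?k" "x + ?k < pos 0 + 1"
    using of_int_floor_le[of "x - pos 0"] floor_correct[of "x - pos 0"] by linarith+
  then have x: "pos 0 \<le> x + ?k" "x + ?k < pos q" by (simp_all add: pos_q)
  have "\<exists>i<n. pos i \<le> x + ?k \<and> x + ?k < pos (Suc i)" if "n \<le> q" "x + ?k < pos n" for n
    using that
  proof (induction n)
    case 0
    then show ?case using x by simp
  next
    case (Suc n)
    then show ?case by (cases "x + ?k < pos n") (auto simp: less_Suc_eq not_less)
  qed
  then obtain i where i: "i < q" "pos i \<le> x + ?k" "x + ?k < pos (Suc i)" using x by blast
  let ?k' = "?k - (pos i - l (js ! i))"
  have "?k' \<in> \<int>" using pos_cong[OF i(1)] by simp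
  moreover have "l (js ! i) \<le> x + ?k'" "x + ?k' < r (js ! i)" using i by (simp_all add: pos_Suc)
  ultimately show ?thesis using js_less[OF i(1)] by blast
qed

lemma integral_branch_sum_eq_sum:
  assumes adm: "admissible c \<gamma>"
  shows "integral {0..1} (branch_sum c \<gamma>) = (\<Sum>j<q. integral {l j..r j} (branch_sum c \<gamma>))"
proof -
  let ?\<phi> = "branch_sum c \<gamma>"
  obtain F where F: "\<And>a b. a \<le> b \<Longrightarrow> (?\<phi> has_integral (F b - F a)) {a..b}"
    using ex_primitive[OF branch_sum_integrable[OF adm]] by blast
  have I: "integral {a..b} ?\<phi> = F b - F a" if "a \<le> b" for a b
    using F[OF that] by (rule integral_unique)
  have shift: "F (b + k) - F (a + k) = F b - F a" if "a \<le> b" "k \<in> \<int>" for a b k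
  proof -
    have "(?\<phi> has_integral (F (b + k) - F (a + k))) (cbox (a + k) (b + k))" using F that by simp
    from has_integral_affinity[OF this, of 1 k]
    have "(?\<phi> has_integral (F (b + k) - F (a + k))) {a..b}" using that by (simp add: branch_sum_add_int)
    then show ?thesis using has_integral_unique F[OF that(1)] by blast
  qed
  have "F (pos n) - F (pos 0) = (\<Sum>i<n. integral {l (js ! i)..r (js ! i)} ?\<phi>)" if "n \<le> q" for n
    using that
  proof (induction n)
    case (Suc n)
    let ?k = "pos n - l (js ! n)"
    have "l (js ! n) \<le> r (js ! n)" using pos_mono[of n] Suc.prems by (simp add: pos_Suc)
    then have "F (r (js ! n) + ?k) - F (l (js ! n) + ?k) = integral {l (js ! n)..r (js ! n)} ?\<phi>"
      using shift[of "l (js ! n)" "r (js ! n)" ?k] I[of "l (js ! n)" "r (js ! n)"] pos_cong[of n] Suc.prems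
      by (simp only: Suc_le_eq)
    moreover have "r (js ! n) + ?k = pos (Suc n)" by (simp add: pos_Suc)
    ultimately show ?case using Suc by simp
  qed simp
  then have "F (pos 0 + 1) - F (pos 0) = (\<Sum>j<q. integral {l j..r j} ?\<phi>)"
    unfolding pos_q[symmetric] sum_js[of "\<lambda>j. integral {l j..r j} ?\<phi>", symmetric] by simp
  moreover have "F (x + 1) - F x = F 1 - F 0" for x
    using shift[of 0 x 1] shift[of x 0 1] by (cases "0 \<le> x") auto
  ultimately show ?thesis using I[of 0 1] by simp
qed

lemma integral_branch_sum_approx:
  assumes f: "fits u" and adm: "admissible c (start u)" and M: "q \<le> M"
  shows "\<bar>integral {0..1} (branch_sum c (start u)) - (\<Sum>j<q. \<Sum>m\<in>{j<..M}. arc_diff c u m)\<bar> \<le> 6 * q / 2 ^ M"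
proof -
  have "\<bar>\<Sum>j<q. integral {l j..r j} (branch_sum c (start u)) - (\<Sum>m\<in>{j<..M}. arc_diff c u m)\<bar>
      \<le> (\<Sum>j<q. pi * (13 / 7) * L / 2 ^ M)"
    using M integral_branch_sum_gap[OF f adm] by (intro order_trans[OF sum_abs] sum_mono) auto
  also have "\<dots> = q * (pi * (13 / 7) * L) / 2 ^ M" by simp
  also have "\<dots> \<le> real q * 6 / 2 ^ M"
  proof -
    have "pi * (13 / 7) \<le> 6" using pi_approx by simp
    then have "pi * (13 / 7) * L \<le> 6 * 1" using L_le_1 L_nonneg by (intro mult_mono) auto
    then have "pi * (13 / 7) * L \<le> 6" by simp
    then have "real q * (pi * (13 / 7) * L) \<le> real q * 6" by (rule mult_left_mono) simp
    then show ?thesis by (rule divide_right_mono) simp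
  qed
  finally show ?thesis by (simp add: integral_branch_sum_eq_sum[OF adm] sum_subtractf mult.commute)
qed

subsection \<open>The orbit\<close>

lemma l_power: "2 ^ k * l (m + k) - l m \<in> \<int>"
proof (induction k)
  case (Suc k)
  have "2 ^ Suc k * l (m + Suc k) - l m = 2 ^ k * (2 * l (Suc (m + k)) - l (m + k)) + (2 ^ k * l (m + k) - l m)"
    by (simp add: algebra_simps)
  moreover have "2 ^ k * (2 * l (Suc (m + k)) - l (m + k)) \<in> \<int>"
    using l_step[of "m + k"] by (intro Ints_mult) auto
  ultimately show ?case using Suc by (simp only: Ints_add)
qed simp

lemma l_0: "l (k * q) = l 0"
  using l_per'[of 0 k] by simp

lemma l_in_orbit: "\<exists>k. l m - 2 ^ k * l 0 \<in> \<int>"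
proof -
  have "m + (q * m - m) = m * q" using q_pos by (cases q) auto
  then have "2 ^ (q * m - m) * l 0 - l m \<in> \<int>" using l_power[of "q * m - m" m] by (simp only: l_0)
  then have "l m - 2 ^ (q * m - m) * l 0 \<in> \<int>" by (metis Ints_minus minus_diff_eq)
  then show ?thesis by blast
qed

lemma orbit_in_l: "\<exists>m>0. 2 ^ k * l 0 - l m \<in> \<int>"
proof -
  let ?m = "q * Suc k - k"
  have m: "?m > 0" "?m + k = Suc k * q" using q_pos by (cases q; simp)+
  then have "2 ^ k * l 0 - l ?m \<in> \<int>" using l_power[of k ?m] unfolding m(2) l_0 by simp
  then show ?thesis using m by blast
qed

text \<open>A right end is the left end of the next arc in the order \<open>js\<close>, hence again
  a point of the orbit.\<close>

lemma r_cong_l: "m > 0 \<Longrightarrow> \<exists>m'. r m - l m' \<in> \<int>"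
proof -
  have base: "\<exists>m'. r j - l m' \<in> \<int>" if "j < q" for j
  proof -
    have "j \<in> set js" using that js(2) by simp
    then obtain i where i: "i < q" "j = js ! i" using length_js by (auto simp: in_set_conv_nth)
    show ?thesis
    proof (cases "Suc i < q")
      case True
      have "r j - l (js ! Suc i) \<in> \<int>" using chain[OF True] i by (metis Ints_minus minus_diff_eq)
      then show ?thesis by blast
    next
      case False
      then have q: "q = Suc i" using i by simp
      have "r j - l (js ! 0) = 1 - (pos i - l j)"
        using pos_q i pos_Suc[of i] by (simp add: q pos_def)
      then have "r j - l (js ! 0) \<in> \<int>" using pos_cong[OF i(1)] i(2) by simp
      then show ?thesis by blast
    qed
  qed
  assume "m > 0"
  then obtain m' k where m': "m' \<in> {1..q}" "m = m' + k * q" using ex_index by blast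
  then have e: "r m = r m'" using r_per' by auto
  show ?thesis
  proof (cases "m' = q")
    case True
    obtain k where "r 0 - l k \<in> \<int>" using base q_pos by blast
    then have "r 0 - l k - 1 \<in> \<int>" by simp
    then show ?thesis unfolding e True using r_0 by (intro exI[of _ k]) (simp add: algebra_simps)
  next
    case False
    then show ?thesis unfolding e using base[of m'] m' by auto
  qed
qed

text \<open>Modulo 1 every point lies in a piece of some arc, at distance at most 1 from the end
  point to which the piece is attached; \<open>n\<close> inverse steps divide this distance by
  \<open>2 ^ n\<close>.\<close>

lemma inv_branch_near_orbit:
  assumes f: "fits u" and n: "n \<ge> 1"
  shows "\<exists>v\<in>l ` {1..q} \<union> r ` {1..q}. \<bar>(inv_branch (start u) ^^ n) x - v\<bar> \<le> 1 / 2 ^ n"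
proof -
  obtain k j where k: "k \<in> \<int>" "j < q" "l j \<le> x + k" "x + k < r j" using in_some_gap by blast
  obtain p where p: "n = Suc p" using n by (cases n) auto
  have per: "(inv_branch (start u) ^^ n) x = (inv_branch (start u) ^^ n) (x + k)"
    unfolding p funpow_Suc_right by (simp add: inv_branch_add_int[OF k(1)])
  have img: "l (j + n) \<in> l ` {1..q}" "r (j + n) \<in> r ` {1..q}"
  proof -
    obtain m k' where m: "m \<in> {1..q}" "j + n = m + k' * q" using ex_index[of "j + n"] n by auto
    then have "l (j + n) = l m" "r (j + n) = r m" using l_per'[of m k'] r_per'[of m k'] by auto
    then show "l (j + n) \<in> l ` {1..q}" "r (j + n) \<in> r ` {1..q}" using m(1) by blast+
  qed
  have len: "r j - l j \<le> 1"
  proof -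
    have "r j - l j = L / 2 ^ j" using arc_length[OF k(2)] by (simp add: L_def)
    also have "\<dots> \<le> 1 / 1" using L_le_1 L_nonneg by (intro frac_le) auto
    finally show ?thesis by simp
  qed
  have small: "\<bar>y / 2 ^ n\<bar> \<le> 1 / 2 ^ n" if "\<bar>y\<bar> \<le> 1" for y :: real
    using that by (simp add: abs_divide divide_right_mono)
  show ?thesis
  proof (cases "x + k < l j + u / 2 ^ j")
    case True
    have "\<bar>x + k - l j\<bar> \<le> 1" using k len by linarith
    from small[OF this] show ?thesis
      unfolding per inv_branch_left[OF f k(3) True] using img by (intro bexI[of _ "l (j + n)"]) auto
  next
    case False
    then have *: "r j - (L - u) / 2 ^ j \<le> x + k" by (simp add: arc_split[OF k(2)])
    have "\<bar>x + k - r j\<bar> \<le> 1" using k len by linarith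
    from small[OF this] show ?thesis
      unfolding per inv_branch_right[OF f * k(4)] using img by (intro bexI[of _ "r (j + n)"]) auto
  qed
qed

text \<open>For every \<open>n\<close>, a lift of \<open>x\<close> is the n-th inverse iterate of
  its own n-th image. Hence it is arbitrarily close to the finite set of end points, and so belongs
  to it.\<close>

lemma always_in_half_circle:
  assumes f: "fits u" and x: "\<And>n. \<exists>k\<in>\<int>. start u \<le> 2 ^ n * x + k \<and> 2 ^ n * x + k < start u + 1 / 2"
  shows "\<exists>k. x - 2 ^ k * l 0 \<in> \<int>"
proof -
  let ?V = "l ` {1..q} \<union> r ` {1..q}"
  obtain k where k: "k \<in> \<int>" "start u \<le> x + k" "x + k < start u + 1 / 2" using x[of 0] by auto
  have it: "(inv_branch (start u) ^^ Suc n) (2 ^ Suc n * x) = x + k" for n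
  proof (induction n)
    case 0
    have "2 * k \<in> \<int>" using k by simp
    then have "2 * (x + k) - 2 * x \<in> \<int>" by (simp add: algebra_simps)
    then show ?case using k by (simp add: inv_branch_eqI)
  next
    case (Suc n)
    obtain k' where k': "k' \<in> \<int>" "start u \<le> 2 ^ Suc n * x + k'" "2 ^ Suc n * x + k' < start u + 1 / 2" using x[of "Suc n"] by auto
    have "2 * (2 ^ Suc n * x + k') - 2 ^ Suc (Suc n) * x = 2 * k'" by (simp add: algebra_simps)
    moreover have "2 * k' \<in> \<int>" using k' by simp
    ultimately have "inv_branch (start u) (2 ^ Suc (Suc n) * x) = 2 ^ Suc n * x + k'"
      using k' by (intro inv_branch_eqI) auto
    then have "(inv_branch (start u) ^^ Suc (Suc n)) (2 ^ Suc (Suc n) * x) = (inv_branch (start u) ^^ Suc n) (2 ^ Suc n * x + k')"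
      unfolding funpow_Suc_right[of "Suc n"] by (simp del: funpow.simps power_Suc)
    also have "\<dots> = (inv_branch (start u) ^^ Suc n) (2 ^ Suc n * x)"
      unfolding funpow_Suc_right by (simp add: inv_branch_add_int[OF k'(1)] del: power_Suc)
    finally show ?case using Suc by simp
  qed
  have "x + k \<in> closure ?V"
    unfolding closure_approachable
  proof (intro allI impI)
    fix e :: real assume "e > 0"
    then obtain n where "(1 / 2) ^ n < e" using real_arch_pow_inv[of e "1 / 2"] by auto
    moreover have "1 / 2 ^ Suc n \<le> (1 / 2 :: real) ^ n" by (simp add: power_divide field_simps)
    moreover obtain v where "v \<in> ?V" "\<bar>x + k - v\<bar> \<le> 1 / 2 ^ Suc n"
      using inv_branch_near_orbit[OF f, of "Suc n" "2 ^ Suc n * x"] unfolding it by auto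
    ultimately show "\<exists>v\<in>?V. dist v (x + k) < e"
      by (intro bexI[of _ v]) (auto simp: dist_real_def abs_minus_commute)
  qed
  moreover have "closure ?V = ?V" by (intro closure_closed finite_imp_closed) simp
  ultimately have "x + k \<in> ?V" by (simp only:)
  then have "\<exists>m. x + k - l m \<in> \<int>"
  proof
    assume "x + k \<in> r ` {1..q}"
    then show ?thesis using r_cong_l by (metis One_nat_def Suc_le_eq atLeastAtMost_iff imageE)
  qed (metis Ints_0 diff_self imageE)
  then obtain m where "x + k - l m \<in> \<int>" by blast
  moreover obtain k' where "l m - 2 ^ k' * l 0 \<in> \<int>" using l_in_orbit by blast
  ultimately have "(x + k - l m) + (l m - 2 ^ k' * l 0) - k \<in> \<int>" using k(1) by (simp only: Ints_add Ints_diff)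
  then show ?thesis by (intro exI[of _ k']) (simp add: algebra_simps)
qed

theorem ex_subaction_orbit:
  assumes f1: "fits u1" and f2: "fits u2" and u: "u1 < u2"
    and a1: "admissible c (start u1)" and a2: "admissible c (start u2)"
    and J1: "integral {0..1} (branch_sum c (start u1)) > 0"
    and J2: "integral {0..1} (branch_sum c (start u2)) < 0"
  shows "\<exists>\<psi> \<beta>. subaction c \<psi> \<beta> (l 0) q"
proof -
  have lt: "start u1 < start u2" using u by (simp add: start_def divide_strict_right_mono)
  have lt2: "start u2 < start u1 + 1 / 2" using a1 a2 unfolding admissible_def by linarith
  obtain \<psi> \<beta> where s: "\<psi> \<in> borel_measurable borel" "\<And>x. \<psi> (x + 1) = \<psi> x" "\<exists>M. \<forall>x. \<bar>\<psi> x\<bar> \<le> M"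
    "\<And>x. cos (pi * (x + c)) \<noteq> 0 \<Longrightarrow> logcos c x + \<psi> x - \<psi> (2 * x) \<le> \<beta>"
    "\<And>x. start u2 \<le> x \<Longrightarrow> x \<le> start u1 + 1 / 2 \<Longrightarrow> cos (pi * (x + c)) \<noteq> 0 \<and> logcos c x + \<psi> x - \<psi> (2 * x) = \<beta>"
    "\<And>x. cos (pi * (x + c)) \<noteq> 0 \<Longrightarrow> logcos c x + \<psi> x - \<psi> (2 * x) = \<beta> \<Longrightarrow> \<exists>k\<in>\<int>. start u2 \<le> x + k \<and> x + k \<le> start u1 + 1 / 2"
    by (rule ex_subaction[OF a1 a2 lt lt2 J1 J2], rule that)
  have orb: "cos (pi * (2 ^ k * l 0 + c)) \<noteq> 0 \<and> logcos c (2 ^ k * l 0) + \<psi> (2 ^ k * l 0) - \<psi> (2 * (2 ^ k * l 0)) = \<beta>" for k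
  proof -
    obtain m where m: "m > 0" "2 ^ k * l 0 - l m \<in> \<int>" using orbit_in_l by blast
    let ?k = "2 ^ k * l 0 - l m"
    have u1: "0 \<le> u1" using f1 by (simp add: fits_def)
    then have "u1 / 2 ^ m \<ge> 0" by simp
    then have "l m \<le> start u1 + 1 / 2" using fitsD(2)[OF f1 m(1)] by linarith
    then have t: "cos (pi * (l m + c)) \<noteq> 0" "logcos c (l m) + \<psi> (l m) - \<psi> (2 * l m) = \<beta>"
      using s(5) fitsD(1)[OF f2 m(1)] by auto
    have e: "2 ^ k * l 0 = l m + ?k" by simp
    have "\<bar>cos (pi * (l m + ?k + c))\<bar> = \<bar>cos (pi * (l m + c))\<bar>"
      using abs_cos_pi_add_int[OF m(2), of "l m + c"] by (simp add: algebra_simps)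
    moreover have "logcos c (l m + ?k) = logcos c (l m)" by (rule logcos_add_int[OF m(2)])
    moreover have "\<psi> (l m + ?k) = \<psi> (l m)" using periodic_add_int[of \<psi>, OF _ m(2)] s(2) by blast
    moreover have "2 * ?k \<in> \<int>" by (intro Ints_mult m(2)) simp
    then have "\<psi> (2 * l m + 2 * ?k) = \<psi> (2 * l m)" using periodic_add_int[of \<psi>] s(2) by blast
    then have "\<psi> (2 * (l m + ?k)) = \<psi> (2 * l m)" by (simp only: distrib_left)
    ultimately show ?thesis using t unfolding e[symmetric] by auto
  qed
  have "subaction c \<psi> \<beta> (l 0) q"
  proof (unfold_locales)
    show "2 ^ q * l 0 - l 0 \<in> \<int>" using l_power[of q 0] l_per[of 0] by simp
    fix x
    assume t: "\<And>k. cos (pi * (2 ^ k * x + c)) \<noteq> 0 \<and> logcos c (2 ^ k * x) + \<psi> (2 ^ k * x) - \<psi> (2 * (2 ^ k * x)) = \<beta>"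
    \<comment> \<open>The tight interval from \<open>start u2\<close> to
      \<open>start u1 + 1 / 2\<close> lies inside the half circle belonging to
      \<open>u2\<close>.\<close>
    show "\<exists>k. x - 2 ^ k * l 0 \<in> \<int>"
    proof (rule always_in_half_circle[OF f2])
      fix n
      obtain k where "k \<in> \<int>" "start u2 \<le> 2 ^ n * x + k" "2 ^ n * x + k \<le> start u1 + 1 / 2" using s(6) t[of n] by blast
      then show "\<exists>k\<in>\<int>. start u2 \<le> 2 ^ n * x + k \<and> 2 ^ n * x + k < start u2 + 1 / 2"
        using lt by (intro bexI[of _ k]) auto
    qed
  qed (use s(1-4) q_pos orb in auto)
  then show ?thesis by blast
qed

end

section \<open>Symmetries in the parameter\<close>

lemma subaction_mirror:
  assumes "subaction c \<psi> \<beta> x0 q"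
  shows "subaction (- c) (\<lambda>x. \<psi> (- x)) \<beta> (- x0) q"
proof -
  interpret subaction c \<psi> \<beta> x0 q by fact
  have c: "cos (pi * (x + - c)) = cos (pi * (- x + c))" for x
    using cos_minus[of "pi * (x + - c)"] by (simp add: algebra_simps)
  have g: "logcos (- c) x = logcos c (- x)" for x unfolding logcos_def c ..
  show ?thesis
  proof (unfold_locales, goal_cases)
    case (2 x)
    show ?case using \<psi>_add_int[of "-1" "- x"] by (simp add: algebra_simps)
  next
    case 5
    show ?case using Ints_minus[OF x0_per] by simp
  next
    case (6 x)
    then show ?case using le_\<beta>[of "- x"] unfolding c g by simp
  next
    case (7 k)
    then show ?case using orbit_cos[of k] unfolding c by simp
  next
    case (8 k)
    then show ?case using orbit_eq[of k] unfolding g by simp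
  next
    case (9 x)
    have "\<exists>k. - x - 2 ^ k * x0 \<in> \<int>"
    proof (rule tight_orbit)
      fix k
      show "cos (pi * (2 ^ k * - x + c)) \<noteq> 0 \<and>
        logcos c (2 ^ k * - x) + \<psi> (2 ^ k * - x) - \<psi> (2 * (2 ^ k * - x)) = \<beta>"
        using 9[of k] unfolding c g by simp
    qed
    then obtain k where "- x - 2 ^ k * x0 \<in> \<int>" by blast
    from Ints_minus[OF this] show ?case by (intro exI[of _ k]) (simp add: algebra_simps)
  qed (use \<psi>_bounded q_pos in auto)
qed

lemma subaction_shift:
  assumes "subaction c \<psi> \<beta> x0 q" "k \<in> \<int>"
  shows "subaction (c + k) \<psi> \<beta> x0 q"
proof -
  interpret subaction c \<psi> \<beta> x0 q by fact
  have c: "\<bar>cos (pi * (x + (c + k)))\<bar> = \<bar>cos (pi * (x + c))\<bar>" for x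
    using abs_cos_pi_add_int[OF assms(2), of "x + c"] by (simp add: add.assoc)
  then have c0: "cos (pi * (x + (c + k))) = 0 \<longleftrightarrow> cos (pi * (x + c)) = 0" for x by (metis abs_eq_0_iff)
  have g: "logcos (c + k) x = logcos c x" for x unfolding logcos_def c ..
  show ?thesis
    using \<psi>_borel \<psi>_per \<psi>_bounded q_pos x0_per le_\<beta> orbit_cos orbit_eq tight_orbit
    unfolding subaction_def c0 g by blast
qed

section \<open>Numerical bounds for the cosine\<close>

lemma cos_taylor_bound:
  fixes z :: real
  assumes "n > 0"
  shows "\<bar>cos z - (\<Sum>m<n. cos_coeff m * z ^ m)\<bar> \<le> \<bar>z\<bar> ^ n / fact n"
proof -
  obtain t where "cos z = (\<Sum>m<n. cos_coeff m * z ^ m) + (cos (t + 1 / 2 * real n * pi) / fact n) * z ^ n"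
    using Maclaurin_cos_expansion[of z n] by blast
  moreover have "\<bar>cos s / fact n * z ^ n\<bar> \<le> 1 / fact n * \<bar>z\<bar> ^ n" for s :: real
    unfolding abs_mult abs_divide power_abs by (intro mult_right_mono divide_right_mono) (simp_all add: divide_right_mono)
  ultimately show ?thesis by simp
qed

text \<open>Horner form of the cosine series in \<open>y = z * z\<close>, beginning at its k-th
  nonzero term and divided by \<open>y ^ k\<close>.\<close>

primrec taylor_sum :: "real \<Rightarrow> nat \<Rightarrow> nat \<Rightarrow> real" where
  "taylor_sum y k 0 = 0"
| "taylor_sum y k (Suc n) = 1 / fact (2 * k) - y * taylor_sum y (Suc k) n"

lemma taylor_sum_eq: "y ^ k * taylor_sum y k n = (\<Sum>i<n. (- 1) ^ i * y ^ (k + i) / fact (2 * (k + i)))"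
proof (induction n arbitrary: k)
  case (Suc n)
  have "y ^ k * taylor_sum y k (Suc n) = y ^ k / fact (2 * k) - y ^ Suc k * taylor_sum y (Suc k) n"
    by (simp add: algebra_simps)
  also have "\<dots> = y ^ k / fact (2 * k) - (\<Sum>i<n. (- 1) ^ i * y ^ (Suc k + i) / fact (2 * (Suc k + i)))"
    by (simp only: Suc)
  also have "\<dots> = (\<Sum>i<Suc n. (- 1) ^ i * y ^ (k + i) / fact (2 * (k + i)))"
    by (subst sum.lessThan_Suc_shift) (simp add: sum_negf[symmetric])
  finally show ?case .
qed simp

lemma taylor_sum_cos: "taylor_sum (z\<^sup>2) 0 n = (\<Sum>m<2 * n. cos_coeff m * z ^ m)"
  unfolding sum_lessThan_double using taylor_sum_eq[of "z\<^sup>2" 0 n]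
  by (simp add: cos_coeff_def power_mult[symmetric])

text \<open>The remainder after \<open>n\<close> terms is at most the modulus of the next term;
  including that term, of sign \<open>(- 1) ^ n\<close>, settles the direction of the error.\<close>

lemma cos_ge_taylor_sum: "odd n \<Longrightarrow> taylor_sum (z\<^sup>2) 0 (Suc n) \<le> cos z"
  and cos_le_taylor_sum: "even n \<Longrightarrow> n > 0 \<Longrightarrow> cos z \<le> taylor_sum (z\<^sup>2) 0 (Suc n)"
proof -
  have b: "n > 0 \<Longrightarrow> \<bar>cos z - taylor_sum (z\<^sup>2) 0 n\<bar> \<le> z ^ (2 * n) / fact (2 * n)"
    using cos_taylor_bound[of "2 * n" z] by (simp add: taylor_sum_cos power_even_abs)
  have s: "taylor_sum (z\<^sup>2) 0 (Suc n) = taylor_sum (z\<^sup>2) 0 n + (- 1) ^ n * z ^ (2 * n) / fact (2 * n)"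
    using taylor_sum_eq[of "z\<^sup>2" 0 n] taylor_sum_eq[of "z\<^sup>2" 0 "Suc n"] by (simp add: power_mult[symmetric])
  show "odd n \<Longrightarrow> taylor_sum (z\<^sup>2) 0 (Suc n) \<le> cos z"
    using b unfolding s abs_le_iff by (cases "n = 0") auto
  show "even n \<Longrightarrow> n > 0 \<Longrightarrow> cos z \<le> taylor_sum (z\<^sup>2) 0 (Suc n)"
    using b unfolding s abs_le_iff by auto
qed

text \<open>For \<open>y \<le> 2\<close> the alternating terms decrease. Nonnegative Horner stages
  are what allows the bounds in \<open>taylor_bounds\<close> to be multiplied.\<close>

lemma taylor_sum_range:
  assumes y: "0 \<le> y" "y \<le> 2"
  shows "0 \<le> taylor_sum y k n \<and> taylor_sum y k n \<le> 1 / fact (2 * k)"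
proof (induction n arbitrary: k)
  case (Suc n)
  have "y * taylor_sum y (Suc k) n \<le> 2 * (1 / fact (2 * Suc k))"
    using y Suc[of "Suc k"] by (intro mult_mono) auto
  also have "\<dots> \<le> 1 / fact (2 * k)"
  proof -
    have "fact (2 * Suc k) = (2 * real k + 2) * (2 * real k + 1) * fact (2 * k)"
      by (simp add: algebra_simps)
    moreover have "(2 * real k + 2) * (2 * real k + 1) \<ge> 2 * 1" by (intro mult_mono) auto
    then have "(2 * real k + 2) * (2 * real k + 1) * fact (2 * k) \<ge> 2 * fact (2 * k)" by (intro mult_right_mono) auto
    ultimately have "2 * fact (2 * k) \<le> (fact (2 * Suc k) :: real)" by simp
    then show ?thesis by (simp add: divide_simps)
  qed
  finally have "y * taylor_sum y (Suc k) n \<le> 1 / fact (2 * k)" .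
  moreover have "0 \<le> y * taylor_sum y (Suc k) n" using y Suc[of "Suc k"] by simp
  ultimately show ?case by simp
qed simp

subsection \<open>Fixed-point evaluation\<close>

text \<open>Numbers are represented by integers with the scale \<open>2 ^ 28 = 268435456\<close>. All divisions except those
  in \<open>fixed_abs\<close> and \<open>cos_ratio\<close> are shifts, which are much cheaper to evaluate by rewriting.
  For the same reason the definitions avoid \<open>let\<close> and \<open>case\<close>: rewriting would enter their
  bodies before the bound values are known.\<close>

abbreviation scale :: int where "scale \<equiv> 268435456"

definition shift :: "int \<Rightarrow> int" where "shift x = drop_bit 28 x"

lemma shift_eq_div: "shift x = x div scale"
  by (simp add: shift_def drop_bit_eq_div)

lemma floor_div_le: "real_of_int (a div b) \<le> a / b"
  by (metis floor_divide_of_int_eq of_int_floor_le)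

lemma less_floor_div: "a / b < real_of_int (a div b) + 1"
  by (metis floor_correct floor_divide_of_int_eq of_int_1 of_int_add)

lemma shift_le: "real_of_int (shift x) \<le> x / scale"
  using floor_div_le[of x scale] by (simp add: shift_eq_div)

lemma less_shift: "x / scale < real_of_int (shift x) + 1"
  using less_floor_div[of x scale] by (simp add: shift_eq_div)

fun taylor_lo :: "int \<Rightarrow> int \<Rightarrow> int list \<Rightarrow> int" and taylor_hi :: "int \<Rightarrow> int \<Rightarrow> int list \<Rightarrow> int" where
  "taylor_lo yl yh [] = 0"
| "taylor_lo yl yh (c # cs) = c - 1 - shift (yh * taylor_hi yl yh cs)"
| "taylor_hi yl yh [] = 0"
| "taylor_hi yl yh (c # cs) = c + 1 - shift (yl * taylor_lo yl yh cs)"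

text \<open>Each stage subtracts a multiple of the next, so lower and upper bounds alternate. The
  upper bound adds 1 because the coefficient is rounded down, the lower bound subtracts 1 because
  \<open>shift\<close> rounds the subtracted product down.\<close>

lemma taylor_bounds:
  fixes y :: real
  assumes y: "real_of_int yl \<le> scale * y" "scale * y \<le> real_of_int yh" "0 \<le> yl" "y \<le> 2"
    and c: "\<And>i. i < length cs \<Longrightarrow> real_of_int (cs ! i) \<le> scale / fact (2 * (k + i)) \<and> scale / fact (2 * (k + i)) \<le> cs ! i + 1"
  shows "real_of_int (taylor_lo yl yh cs) \<le> scale * taylor_sum y k (length cs)
    \<and> scale * taylor_sum y k (length cs) \<le> real_of_int (taylor_hi yl yh cs)"
  using c
proof (induction cs arbitrary: k)
  case (Cons c cs)
  let ?t = "taylor_sum y (Suc k) (length cs)" and ?lo = "real_of_int (taylor_lo yl yh cs)" and ?hi = "real_of_int (taylor_hi yl yh cs)"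
  have IH: "?lo \<le> scale * ?t" "scale * ?t \<le> ?hi"
    using Cons.IH[of "Suc k"] Cons.prems[of "Suc _"] by auto
  have y0: "y \<ge> 0" using y by linarith
  have t: "?t \<ge> 0" using taylor_sum_range[OF y0 y(4)] by blast
  have c0: "real_of_int c \<le> scale / fact (2 * k)" "scale / fact (2 * k) \<le> c + 1" using Cons.prems[of 0] by auto
  have e: "scale * taylor_sum y k (length (c # cs)) = scale / fact (2 * k) - scale * (y * ?t)"
    by (simp add: right_diff_distrib)
  have "(scale * y) * (scale * ?t) \<le> yh * ?hi" using y y0 IH t by (intro mult_mono) auto
  then have "scale * (y * ?t) \<le> real_of_int (yh * taylor_hi yl yh cs) / scale" by simp
  then have 1: "scale * (y * ?t) \<le> shift (yh * taylor_hi yl yh cs) + 1" using less_shift[of "yh * taylor_hi yl yh cs"] by linarith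
  have "yl * ?lo \<le> yl * (scale * ?t)" using y IH by (intro mult_left_mono) auto
  also have "\<dots> \<le> (scale * y) * (scale * ?t)" using y t by (intro mult_right_mono) auto
  finally have "real_of_int (yl * taylor_lo yl yh cs) / scale \<le> scale * (y * ?t)" by simp
  then have 2: "shift (yl * taylor_lo yl yh cs) \<le> scale * (y * ?t)" using shift_le[of "yl * taylor_lo yl yh cs"] by linarith
  show ?case unfolding e using 1 2 c0 by simp
qed simp

definition fixed_abs :: "int \<Rightarrow> int \<Rightarrow> int" where
  "fixed_abs n d = \<bar>n\<bar> * scale div d"

text \<open>\<open>843314856\<close> is \<open>2 ^ 28 * pi\<close> rounded down.\<close>

definition fixed_sq :: "int \<Rightarrow> int" where "fixed_sq z = shift (z * z)"

definition sq_lo :: "int \<Rightarrow> int" where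
  "sq_lo p = fixed_sq (shift (843314856 * p))"

definition sq_hi :: "int \<Rightarrow> int" where
  "sq_hi p = fixed_sq (shift (843314857 * (p + 1)) + 1) + 1"

text \<open>The entries are \<open>scale / fact (2 * k)\<close> rounded down. Six terms end with a
  negative one and give a lower bound; \<open>cos_hi\<close> takes a seventh, whose coefficient
  rounds to 0.\<close>

definition cos_lo :: "int \<Rightarrow> int" where
  "cos_lo p = taylor_lo (sq_lo p) (sq_hi p) [268435456, 134217728, 11184810, 372827, 6657, 73]"

definition cos_hi :: "int \<Rightarrow> int" where
  "cos_hi p = taylor_hi (sq_lo p) (sq_hi p) [268435456, 134217728, 11184810, 372827, 6657, 73, 0]"

text \<open>The bound 2/5 covers the arguments that occur, which are at most 1/4 + 37/400 in
  modulus, and keeps the squared angle below 2.\<close>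

lemma cos_lo_hi:
  assumes d: "d > 0" and x: "\<bar>real_of_int n / d\<bar> \<le> 2 / 5"
  shows "real_of_int (cos_lo (fixed_abs n d)) \<le> scale * cos (pi * (n / d))"
    and "scale * cos (pi * (n / d)) \<le> real_of_int (cos_hi (fixed_abs n d))"
proof -
  define x where "x = \<bar>real_of_int n / d\<bar>"
  define p where "p = fixed_abs n d"
  define y where "y = (pi * x)\<^sup>2"
  have x0: "0 \<le> x" "x \<le> 2 / 5" using assms by (auto simp: x_def)
  have "x * scale = real_of_int (\<bar>n\<bar> * scale) / d" using d by (simp add: x_def abs_divide)
  then have p: "real_of_int p \<le> x * scale" "x * scale < real_of_int p + 1"
    unfolding p_def fixed_abs_def using floor_div_le[of "\<bar>n\<bar> * scale" d] less_floor_div[of "\<bar>n\<bar> * scale" d] by simp_all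
  have p0: "0 \<le> p" using d by (simp add: p_def fixed_abs_def pos_imp_zdiv_nonneg_iff)
  have ylo: "real_of_int (sq_lo p) \<le> scale * y" "0 \<le> sq_lo p"
  proof -
    define z where "z = shift (843314856 * p)"
    have z0: "0 \<le> z" using p0 by (simp add: z_def shift_eq_div pos_imp_zdiv_nonneg_iff)
    have "real_of_int z \<le> real_of_int (843314856 * p) / scale" unfolding z_def by (rule shift_le)
    also have "\<dots> \<le> (843314856 / scale) * (x * scale)" using p(1) by simp
    also have "\<dots> \<le> pi * (x * scale)" using pi_approx x0 by (intro mult_right_mono) auto
    finally have z: "real_of_int z \<le> scale * (pi * x)" by (simp add: mult_ac)
    have "real_of_int z * z \<le> (scale * (pi * x)) * (scale * (pi * x))" using z z0 by (intro mult_mono) auto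
    then have "real_of_int (z * z) / scale \<le> scale * y" by (simp add: y_def power2_eq_square)
    then show "real_of_int (sq_lo p) \<le> scale * y"
      using shift_le[of "z * z"] by (simp add: sq_lo_def fixed_sq_def z_def[symmetric])
    show "0 \<le> sq_lo p" by (simp add: sq_lo_def fixed_sq_def shift_eq_div pos_imp_zdiv_nonneg_iff)
  qed
  have yhi: "scale * y \<le> real_of_int (sq_hi p)"
  proof -
    define z where "z = shift (843314857 * (p + 1)) + 1"
    have "scale * (pi * x) = pi * (x * scale)" by simp
    also have "\<dots> \<le> (843314857 / scale) * (p + 1)" using pi_approx x0 p by (intro mult_mono) auto
    also have "\<dots> = real_of_int (843314857 * (p + 1)) / scale" by simp
    also have "\<dots> \<le> z" unfolding z_def using less_shift[of "843314857 * (p + 1)"] by simp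
    finally have z: "scale * (pi * x) \<le> z" .
    have nn: "0 \<le> scale * (pi * x)" using x0 by simp
    have "0 \<le> real_of_int z" using nn z by linarith
    then have "(scale * (pi * x)) * (scale * (pi * x)) \<le> real_of_int z * z" using z nn by (intro mult_mono)
    then have "scale * y \<le> real_of_int (z * z) / scale" by (simp add: y_def power2_eq_square)
    moreover have "sq_hi p = shift (z * z) + 1" unfolding sq_hi_def fixed_sq_def z_def ..
    ultimately show ?thesis using less_shift[of "z * z"] by simp
  qed
  have "pi * x \<le> 3.2 * (2 / 5)" using pi_approx x0 by (intro mult_mono) auto
  then have "y \<le> (3.2 * (2 / 5))\<^sup>2" unfolding y_def using x0 by (intro power_mono) auto
  then have y2: "y \<le> 2" by (simp add: power2_eq_square)
  have cx: "cos (pi * (n / d)) = cos (pi * x)"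
    using cos_minus[of "pi * (n / d)"] by (simp add: x_def abs_if)
  have "real_of_int (cos_lo p) \<le> scale * taylor_sum y 0 (length [268435456, 134217728, 11184810, 372827, 6657, 73 :: int])"
    unfolding cos_lo_def
    by (rule taylor_bounds[OF ylo(1) yhi ylo(2) y2, THEN conjunct1]) (auto simp: less_Suc_eq fact_numeral)
  moreover have "taylor_sum y 0 (length [268435456, 134217728, 11184810, 372827, 6657, 73 :: int]) \<le> cos (pi * x)"
  proof -
    have len: "length [268435456, 134217728, 11184810, 372827, 6657, 73 :: int] = Suc 5" by simp
    show ?thesis unfolding y_def len by (rule cos_ge_taylor_sum) simp
  qed
  ultimately show "real_of_int (cos_lo (fixed_abs n d)) \<le> scale * cos (pi * (n / d))"
    unfolding cx p_def[symmetric] by linarith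
  have "cos (pi * x) \<le> taylor_sum y 0 (length [268435456, 134217728, 11184810, 372827, 6657, 73, 0 :: int])"
  proof -
    have len: "length [268435456, 134217728, 11184810, 372827, 6657, 73, 0 :: int] = Suc 6" by simp
    show ?thesis unfolding y_def len by (rule cos_le_taylor_sum) simp_all
  qed
  moreover have "scale * taylor_sum y 0 (length [268435456, 134217728, 11184810, 372827, 6657, 73, 0 :: int]) \<le> real_of_int (cos_hi p)"
    unfolding cos_hi_def
    by (rule taylor_bounds[OF ylo(1) yhi ylo(2) y2, THEN conjunct2]) (auto simp: less_Suc_eq fact_numeral)
  ultimately show "scale * cos (pi * (n / d)) \<le> real_of_int (cos_hi (fixed_abs n d))"
    unfolding cx p_def[symmetric] by linarith
qed

text \<open>A quotient of two cosines rounded down. Equal arguments, which arise when the cut point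
  returns to an end of arc 0, are treated exactly to avoid rounding loss.\<close>

definition cos_ratio :: "int \<Rightarrow> int \<Rightarrow> int \<Rightarrow> int" where
  "cos_ratio n n' d = (if n = n' then scale
     else max 0 (cos_lo (fixed_abs n d) * scale div cos_hi (fixed_abs n' d)))"

lemma cos_ratio_nonneg: "cos_ratio n n' d \<ge> 0"
  by (simp add: cos_ratio_def)

lemma cos_pos_two_fifths:
  assumes "\<bar>x\<bar> \<le> 2 / 5" shows "cos (pi * x) > 0"
proof (rule cos_gt_zero_pi)
  have "- (1 / 2) < x" "x < 1 / 2" using assms unfolding abs_le_iff by linarith+
  then have "pi * - (1 / 2) < pi * x" "pi * x < pi * (1 / 2)"
    using pi_gt_zero by (intro mult_strict_left_mono; simp)+
  then show "- (pi / 2) < pi * x" "pi * x < pi / 2" by simp_all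
qed

lemma cos_ratio_le:
  assumes d: "d > 0" and x: "\<bar>real_of_int n / d\<bar> \<le> 2 / 5" "\<bar>real_of_int n' / d\<bar> \<le> 2 / 5"
  shows "real_of_int (cos_ratio n n' d) \<le> scale * exp (logcos 0 (n / d) - logcos 0 (n' / d))"
proof -
  let ?c = "cos (pi * (n / d))" and ?c' = "cos (pi * (n' / d))"
  have c: "?c > 0" "?c' > 0" using cos_pos_two_fifths[OF x(1)] cos_pos_two_fifths[OF x(2)] by simp_all
  have e: "exp (logcos 0 (n / d) - logcos 0 (n' / d)) = ?c / ?c'"
    using c by (simp add: logcos_def exp_diff)
  have lo: "real_of_int (cos_lo (fixed_abs n d)) \<le> scale * ?c" and hi: "scale * ?c' \<le> real_of_int (cos_hi (fixed_abs n' d))"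
    using cos_lo_hi[OF d] x by auto
  have "0 < scale * ?c'" using c by simp
  with hi have h0: "0 < real_of_int (cos_hi (fixed_abs n' d))" by linarith
  then have "real_of_int (cos_lo (fixed_abs n d) * scale div cos_hi (fixed_abs n' d)) \<le> cos_lo (fixed_abs n d) * scale / cos_hi (fixed_abs n' d)"
    using floor_div_le[of "cos_lo (fixed_abs n d) * scale" "cos_hi (fixed_abs n' d)"] by simp
  also have "\<dots> \<le> scale * (?c / ?c')"
  proof -
    have "real_of_int (cos_lo (fixed_abs n d)) * ?c' \<le> (scale * ?c) * ?c'" using lo c by (intro mult_right_mono) auto
    also have "\<dots> \<le> ?c * cos_hi (fixed_abs n' d)" using mult_left_mono[OF hi, of ?c] c by (simp add: mult_ac)
    finally show ?thesis using h0 c by (simp add: divide_simps mult_ac)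
  qed
  finally have "real_of_int (cos_lo (fixed_abs n d) * scale div cos_hi (fixed_abs n' d)) \<le> scale * (?c / ?c')" .
  moreover have "0 \<le> scale * (?c / ?c')" using c by (intro mult_nonneg_nonneg divide_nonneg_nonneg) auto
  moreover have "n = n' \<Longrightarrow> ?c / ?c' = 1" using c by simp
  ultimately show ?thesis unfolding e cos_ratio_def max_def by (simp only: split: if_split) simp
qed

section \<open>Double sums in exponentiated form\<close>

definition nested_pair :: "nat \<Rightarrow> int \<Rightarrow> int \<Rightarrow> int \<times> int" where
  "nested_pair q t s = (s, if q > 0 then shift (t * s) else t)"

fun nested_step :: "nat \<Rightarrow> int \<Rightarrow> int \<times> int \<Rightarrow> int \<times> int" where
  "nested_step q x (s, t) = nested_pair q t (shift (x * s))"

text \<open>In one pass, up to rounding: the product of the list, and the product over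
  \<open>j < q\<close> of the list without its first \<open>j\<close> entries. The latter is the
  exponential of the double sum in \<open>integral_branch_sum_approx\<close>.\<close>

fun nested_prod :: "nat \<Rightarrow> int list \<Rightarrow> int \<times> int" where
  "nested_prod q [] = (scale, scale)"
| "nested_prod q (x # xs) = nested_step q x (nested_prod (q - 1) xs)"

lemma scaled_mult_le:
  fixes x y :: int and a b :: real
  assumes "0 \<le> x" "0 \<le> y" "real_of_int x \<le> scale * exp a" "real_of_int y \<le> scale * exp b"
  shows "0 \<le> shift (x * y)" "real_of_int (shift (x * y)) \<le> scale * exp (a + b)"
proof -
  show "0 \<le> shift (x * y)" using assms by (simp add: shift_eq_div pos_imp_zdiv_nonneg_iff)
  have "real_of_int x * y \<le> (scale * exp a) * (scale * exp b)"
    using assms by (intro mult_mono) auto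
  then show "real_of_int (shift (x * y)) \<le> scale * exp (a + b)"
    using shift_le[of "x * y"] by (simp add: exp_add)
qed

lemma nested_prod_le:
  assumes "\<And>i. i < length xs \<Longrightarrow> 0 \<le> xs ! i \<and> real_of_int (xs ! i) \<le> scale * exp (f i)"
  shows "0 \<le> fst (nested_prod q xs) \<and> real_of_int (fst (nested_prod q xs)) \<le> scale * exp (\<Sum>i<length xs. f i) \<and>
    0 \<le> snd (nested_prod q xs) \<and>
    real_of_int (snd (nested_prod q xs)) \<le> scale * exp (\<Sum>j<q. \<Sum>i\<in>{j..<length xs}. f i)"
  using assms
proof (induction xs arbitrary: q f)
  case Nil
  then show ?case by simp
next
  case (Cons x xs)
  obtain s t where st: "nested_prod (q - 1) xs = (s, t)" by (cases "nested_prod (q - 1) xs")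
  define s' where "s' = shift (x * s)"
  have IH: "0 \<le> s" "real_of_int s \<le> scale * exp (\<Sum>i<length xs. f (Suc i))" "0 \<le> t"
    "real_of_int t \<le> scale * exp (\<Sum>j<q - 1. \<Sum>i\<in>{j..<length xs}. f (Suc i))"
  proof -
    have "0 \<le> xs ! i \<and> real_of_int (xs ! i) \<le> scale * exp (f (Suc i))" if "i < length xs" for i
      using Cons.prems[of "Suc i"] that by simp
    from Cons.IH[of "\<lambda>i. f (Suc i)" "q - 1", OF this]
    show "0 \<le> s" "real_of_int s \<le> scale * exp (\<Sum>i<length xs. f (Suc i))" "0 \<le> t"
      "real_of_int t \<le> scale * exp (\<Sum>j<q - 1. \<Sum>i\<in>{j..<length xs}. f (Suc i))"
      unfolding st by simp_all
  qed
  have x: "0 \<le> x" "real_of_int x \<le> scale * exp (f 0)" using Cons.prems[of 0] by auto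
  have sum: "f 0 + (\<Sum>i<length xs. f (Suc i)) = (\<Sum>i<length (x # xs). f i)"
    by (simp only: sum.lessThan_Suc_shift length_Cons)  
  have s': "0 \<le> s'" "real_of_int s' \<le> scale * exp (\<Sum>i<length (x # xs). f i)"
    using scaled_mult_le[OF x(1) IH(1) x(2) IH(2)] unfolding s'_def sum by auto
  show ?case
  proof (cases q)
    case 0
    have "nested_prod 0 xs = (s, t)" using st 0 by simp
    then show ?thesis using s' IH 0 by (simp add: s'_def[symmetric] nested_pair_def)
  next
    case (Suc p)
    have "nested_prod p xs = (s, t)" using st Suc by simp
    then have np: "nested_prod (Suc p) (x # xs) = (s', shift (t * s'))" by (simp add: s'_def nested_pair_def)
    have eq: "(\<Sum>j<p. \<Sum>i\<in>{j..<length xs}. f (Suc i)) + (\<Sum>i<length (x # xs). f i) = (\<Sum>j<Suc p. \<Sum>i\<in>{j..<length (x # xs)}. f i)"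
      by (subst sum.lessThan_Suc_shift)
        (simp only: sum.shift_bounds_Suc_ivl length_Cons atLeast0LessThan add.commute)
    have "real_of_int t \<le> scale * exp (\<Sum>j<p. \<Sum>i\<in>{j..<length xs}. f (Suc i))"
      using IH(4) Suc by simp
    from scaled_mult_le[OF IH(3) s'(1) this s'(2)] show ?thesis
      using s' unfolding Suc np fst_conv snd_conv eq by blast
  qed
qed

text \<open>The inequality \<open>1 - x \<le> exp (- x)\<close> takes the place of a logarithm: it
  suffices that \<open>t / scale\<close> times \<open>1 - k / 2 ^ M\<close> exceeds 1.\<close>

lemma exp_bound_imp_less:
  assumes "real_of_int t \<le> scale * exp s" "t * (2 ^ M - k) > scale * 2 ^ M" "0 \<le> k" "k < 2 ^ M"
  shows "k / 2 ^ M < s"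
proof -
  let ?x = "real_of_int k / 2 ^ M"
  have k: "real_of_int k < 2 ^ M" using assms(4) by (metis of_int_less_iff of_int_numeral of_int_power)
  then have x: "?x < 1" by simp
  have "real_of_int (scale * 2 ^ M) < real_of_int (t * (2 ^ M - k))" using assms(2) by (simp only: of_int_less_iff)
  then have "scale < t * (1 - ?x)" by (simp add: field_simps)
  also have "\<dots> \<le> scale * exp s * (1 - ?x)" using assms(1) x by (intro mult_right_mono) auto
  finally have "1 < exp s * (1 - ?x)" by simp
  also have "1 - ?x \<le> exp (- ?x)" using exp_ge_add_one_self[of "- ?x"] by simp
  then have "exp s * (1 - ?x) \<le> exp s * exp (- ?x)" by (intro mult_left_mono) auto
  also have "\<dots> = exp (s - ?x)" by (simp add: exp_diff exp_minus divide_inverse)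
  finally have "0 < s - ?x" by simp
  then show ?thesis by simp
qed

subsection \<open>Checking one orbit on an interval of parameters\<close>

text \<open>The left end points of the arcs are \<open>la ! j / (2 ^ q - 1)\<close>; the parameters are \<open>c = i / 1024\<close>
  and \<open>u = a / (1024 * (2 ^ q - 1))\<close>. All points are evaluated over the common denominator
  \<open>1024 * (2 ^ q - 1) * 2 ^ m\<close>, and the sums are truncated after \<open>m = M\<close>.\<close>

definition denom :: "nat \<Rightarrow> int" where "denom q = 2 ^ q - 1"

text \<open>Arc \<open>j\<close> has length \<open>2 ^ (q - 1 - j)\<close> over
  \<open>denom q\<close>. At index 0 a full turn is subtracted to obtain the lift \<open>r q\<close>
  inside the half circle; \<open>right_pt\<close> restores the turn for \<open>r 0\<close>.\<close>

definition right_end :: "int list \<Rightarrow> nat \<Rightarrow> nat \<Rightarrow> int" where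
  "right_end la q j = la ! j + 2 ^ (q - 1 - j) - (if j = 0 then denom q else 0)"

definition left_pt :: "int list \<Rightarrow> nat \<Rightarrow> nat \<Rightarrow> real" where
  "left_pt la q m = real_of_int (la ! (m mod q)) / denom q"

definition right_pt :: "int list \<Rightarrow> nat \<Rightarrow> nat \<Rightarrow> real" where
  "right_pt la q m = real_of_int (right_end la q (m mod q)) / denom q + (if m = 0 then 1 else 0)"

definition step_check :: "nat \<Rightarrow> int list \<Rightarrow> nat \<Rightarrow> bool" where
  "step_check q la m \<longleftrightarrow> (2 * la ! (Suc m mod q) - la ! m) mod denom q = 0
    \<and> (2 * right_end la q (Suc m mod q) - right_end la q m) mod denom q = 0"

definition chain_check :: "nat \<Rightarrow> int list \<Rightarrow> nat list \<Rightarrow> nat \<Rightarrow> bool" where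
  "chain_check q la js i \<longleftrightarrow> (la ! (js ! Suc i) - right_end la q (js ! i)) mod denom q = 0"

definition orbit_check :: "nat \<Rightarrow> int list \<Rightarrow> nat list \<Rightarrow> bool" where
  "orbit_check q la js \<longleftrightarrow> 0 < q \<and> list_all (step_check q la) [0..<q]
    \<and> distinct js \<and> sort js = [0..<q] \<and> list_all (chain_check q la js) [0..<q - 1]"

definition start_num :: "nat \<Rightarrow> int list \<Rightarrow> int \<Rightarrow> int" where
  "start_num q la a = 2 ^ q * (1024 * la ! 0 - 512 * denom q) + a"

definition fits_ineqs :: "int \<Rightarrow> int \<Rightarrow> int \<Rightarrow> int \<Rightarrow> int \<Rightarrow> int \<Rightarrow> bool" where
  "fits_ineqs s x y h aw bw \<longleftrightarrow> s \<le> x \<and> x + aw \<le> s + h \<and> s \<le> y - bw \<and> y \<le> s + h"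

text \<open>Everything is multiplied by \<open>1024 * denom q * 2 ^ q\<close>. Index 0 stands for
  \<open>m = q\<close>, hence the exponent 0 there; \<open>512 * 2 ^ q\<close> is the numerator of
  \<open>L\<close> over \<open>1024 * denom q\<close>.\<close>

definition fits_at :: "nat \<Rightarrow> int list \<Rightarrow> int \<Rightarrow> nat \<Rightarrow> bool" where
  "fits_at q la a j = fits_ineqs (start_num q la a) (1024 * 2 ^ q * la ! j) (1024 * 2 ^ q * right_end la q j)
     (512 * 2 ^ q * denom q) (a * 2 ^ (if j = 0 then 0 else q - j)) ((512 * 2 ^ q - a) * 2 ^ (if j = 0 then 0 else q - j))"

definition fits_check :: "nat \<Rightarrow> int list \<Rightarrow> int \<Rightarrow> bool" where
  "fits_check q la a \<longleftrightarrow> 0 \<le> a \<and> a \<le> 512 * 2 ^ q \<and> list_all (fits_at q la a) [0..<q]"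

definition admissible_check :: "nat \<Rightarrow> int list \<Rightarrow> int \<Rightarrow> int \<Rightarrow> bool" where
  "admissible_check q la a i \<longleftrightarrow>
    \<bar>400 * (start_num q la a + (i + 256) * denom q * 2 ^ q)\<bar> \<le> 37 * 1024 * denom q * 2 ^ q"

definition arc_tuple :: "int \<Rightarrow> int \<Rightarrow> int \<Rightarrow> int \<Rightarrow> int \<Rightarrow> int \<times> int \<times> int \<times> int \<times> int" where
  "arc_tuple a b x y d = (x + a, x, y, y - (b - a), d)"

text \<open>Numerators of the four points in \<open>arc_diff\<close>, translated by
  \<open>c = i / 1024\<close>, followed by their common denominator.\<close>

definition arc_pts :: "nat \<Rightarrow> int list \<Rightarrow> int \<Rightarrow> int \<Rightarrow> nat \<Rightarrow> int \<times> int \<times> int \<times> int \<times> int" where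
  "arc_pts q la a i m = arc_tuple a (512 * 2 ^ q)
     ((1024 * la ! (m mod q) + i * denom q) * 2 ^ m)
     ((1024 * right_end la q (m mod q) + i * denom q) * 2 ^ m) (1024 * denom q * 2 ^ m)"

fun pos_of :: "int \<times> int \<times> int \<times> int \<times> int \<Rightarrow> int" where
  "pos_of (p, x, y, r, d) = shift (cos_ratio p x d * cos_ratio y r d)"

fun neg_of :: "int \<times> int \<times> int \<times> int \<times> int \<Rightarrow> int" where
  "neg_of (p, x, y, r, d) = shift (cos_ratio x p d * cos_ratio r y d)"

definition pos_factor :: "nat \<Rightarrow> int list \<Rightarrow> int \<Rightarrow> int \<Rightarrow> nat \<Rightarrow> int" where
  "pos_factor q la a i m = pos_of (arc_pts q la a i m)"

definition neg_factor :: "nat \<Rightarrow> int list \<Rightarrow> int \<Rightarrow> int \<Rightarrow> nat \<Rightarrow> int" where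
  "neg_factor q la a i m = neg_of (arc_pts q la a i m)"

text \<open>The threshold is the truncation error \<open>6 * q / 2 ^ M\<close> of
  \<open>integral_branch_sum_approx\<close>; passing it decides the sign of the mean.\<close>

definition exceeds :: "nat \<Rightarrow> nat \<Rightarrow> int list \<Rightarrow> bool" where
  "exceeds q M xs \<longleftrightarrow> snd (nested_prod q xs) * (2 ^ M - 6 * int q) > scale * 2 ^ M"

text \<open>As the mean decreases in \<open>c\<close>, its positivity for \<open>a1\<close> is
  tested at \<open>hi\<close> and its negativity for \<open>a2\<close> at \<open>lo\<close>.\<close>

definition interval_check :: "nat \<Rightarrow> int list \<Rightarrow> nat list \<Rightarrow> int \<Rightarrow> int \<Rightarrow> int \<Rightarrow> int \<Rightarrow> nat \<Rightarrow> bool" where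
  "interval_check q la js a1 a2 lo hi M \<longleftrightarrow>
    orbit_check q la js \<and> fits_check q la a1 \<and> fits_check q la a2 \<and> a1 < a2
    \<and> admissible_check q la a1 lo \<and> admissible_check q la a1 hi
    \<and> admissible_check q la a2 lo \<and> admissible_check q la a2 hi
    \<and> q \<le> M \<and> 6 * int q < 2 ^ M
    \<and> exceeds q M (map (pos_factor q la a1 hi) [1..<Suc M])
    \<and> exceeds q M (map (neg_factor q la a2 lo) [1..<Suc M])"

lemma denom_pos: "q > 0 \<Longrightarrow> denom q > 0"
  using one_less_power[of "2::int" q] by (simp add: denom_def)

lemma int_mod_denom:
  fixes z d :: int
  assumes "z mod d = 0" "d > 0"
  shows "real_of_int z / real_of_int d \<in> \<int>"
proof -
  obtain k where "z = d * k" using assms(1) unfolding mod_eq_0_iff_dvd by (rule dvdE)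
  then show ?thesis using assms(2) by simp
qed

lemma orbit_check_gap_system:
  assumes "orbit_check q la js"
  shows "gap_system q (left_pt la q) (right_pt la q) js"
proof -
  have q: "q > 0" using assms by (simp add: orbit_check_def)
  have d: "denom q > 0" using q by (rule denom_pos)
  have ld: "(2 * la ! (Suc m mod q) - la ! m) mod denom q = 0"
    and rd: "(2 * right_end la q (Suc m mod q) - right_end la q m) mod denom q = 0" if "m < q" for m
  proof -
    have "m \<in> set [0..<q]" using that by simp
    then show "(2 * la ! (Suc m mod q) - la ! m) mod denom q = 0"
      "(2 * right_end la q (Suc m mod q) - right_end la q m) mod denom q = 0"
      using assms unfolding orbit_check_def list_all_iff step_check_def by blast+
  qed
  have js: "distinct js" "sort js = [0..<q]" using assms unfolding orbit_check_def by blast+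
  have setjs: "set js = {..<q}" using arg_cong[OF js(2), of set] by (simp add: atLeast0LessThan)
  have len: "length js = q" using arg_cong[OF js(2), of length] by simp
  have Q: "real_of_int (denom q) = 2 ^ q - 1" by (simp add: denom_def)
  show ?thesis
  proof
    fix m
    have s: "Suc (m mod q) mod q = Suc m mod q" by (simp add: mod_Suc_eq)
    have "2 * left_pt la q (Suc m) - left_pt la q m = real_of_int (2 * la ! (Suc m mod q) - la ! (m mod q)) / denom q"
      by (simp add: left_pt_def diff_divide_distrib)
    then show "2 * left_pt la q (Suc m) - left_pt la q m \<in> \<int>"
      using int_mod_denom[OF ld[of "m mod q"] d] q unfolding s by simp
    have "2 * right_pt la q (Suc m) - right_pt la q m
        = real_of_int (2 * right_end la q (Suc m mod q) - right_end la q (m mod q)) / denom q - (if m = 0 then 1 else 0)"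
      by (simp add: right_pt_def diff_divide_distrib)
    moreover have "real_of_int (2 * right_end la q (Suc m mod q) - right_end la q (m mod q)) / denom q \<in> \<int>"
      using int_mod_denom[OF rd[of "m mod q"] d] q unfolding s by simp
    ultimately show "2 * right_pt la q (Suc m) - right_pt la q m \<in> \<int>" by simp
    show "left_pt la q (m + q) = left_pt la q m" by (simp add: left_pt_def)
    show "right_pt la q (m + q) = right_pt la q m" if "m > 0" using that by (simp add: right_pt_def)
  next
    fix j assume j: "j < q"
    have "right_pt la q j - left_pt la q j = 2 ^ (q - 1 - j) / denom q"
      using j d by (auto simp: right_pt_def left_pt_def right_end_def add_divide_distrib diff_divide_distrib)
    also have "(2::real) ^ (q - 1 - j) = 2 ^ (q - 1) / 2 ^ j" using j by (simp add: power_diff)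
    finally show "right_pt la q j - left_pt la q j = 2 ^ (q - 1) / (2 ^ q - 1) / 2 ^ j" by (simp add: Q)
  next
    fix i assume i: "Suc i < q"
    have mods: "js ! i mod q = js ! i" "js ! Suc i mod q = js ! Suc i"
      using setjs len i nth_mem[of i js] nth_mem[of "Suc i" js] by auto
    have "i \<in> set [0..<q - 1]" using i by simp
    then have "(la ! (js ! Suc i) - right_end la q (js ! i)) mod denom q = 0"
      using assms unfolding orbit_check_def list_all_iff chain_check_def by blast
    from int_mod_denom[OF this d]
    have "real_of_int (la ! (js ! Suc i) - right_end la q (js ! i)) / denom q - (if js ! i = 0 then 1 else 0) \<in> \<int>"
      by simp
    moreover have "left_pt la q (js ! Suc i) - right_pt la q (js ! i)
        = real_of_int (la ! (js ! Suc i) - right_end la q (js ! i)) / denom q - (if js ! i = 0 then 1 else 0)"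
      by (simp add: left_pt_def right_pt_def mods diff_divide_distrib)
    ultimately show "left_pt la q (js ! Suc i) - right_pt la q (js ! i) \<in> \<int>" by simp
  qed (use q js setjs in \<open>auto simp: right_pt_def\<close>)
qed

context
  fixes q :: nat and la :: "int list" and js :: "nat list"
  assumes oc: "orbit_check q la js"
begin

interpretation gap_system q "left_pt la q" "right_pt la q" js
  by (rule orbit_check_gap_system[OF oc])

definition param :: "int \<Rightarrow> real" where
  "param a = a / (1024 * denom q)"

lemma W_pos: "real_of_int (denom q) > 0" using denom_pos[OF q_pos] by simp

lemma L_num: "L = 512 * 2 ^ q / (1024 * denom q)"
proof -
  have "(2::real) ^ q = 2 * 2 ^ (q - 1)" using q_pos by (cases q) auto
  moreover have "L = 2 ^ (q - 1) / denom q" by (simp add: L_def denom_def)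
  ultimately show ?thesis by simp
qed

lemma start_param: "start (param a) = start_num q la a / (1024 * denom q * 2 ^ q)"
proof -
  let ?W = "1024 * real_of_int (denom q) * 2 ^ q"
  have "start_num q la a / ?W = (2 ^ q * 1024 * real_of_int (la ! 0)) / ?W - (2 ^ q * 512 * real_of_int (denom q)) / ?W + a / ?W"
    by (simp add: start_num_def add_divide_distrib diff_divide_distrib right_diff_distrib)
  also have "(2 ^ q * 1024 * real_of_int (la ! 0)) / ?W = left_pt la q q" by (simp add: left_pt_def)
  also have "(2 ^ q * 512 * real_of_int (denom q)) / ?W = 1 / 2" using W_pos by simp
  also have "a / ?W = param a / 2 ^ q" by (simp add: param_def)
  finally show ?thesis by (simp add: start_def)
qed

lemma fits_check_fits:
  assumes "fits_check q la a"
  shows "fits (param a)"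
  unfolding fits_def
proof (intro conjI ballI)
  let ?W = "1024 * real_of_int (denom q) * 2 ^ q"
  have W: "?W > 0" using W_pos by simp
  have a: "0 \<le> a" "a \<le> 512 * 2 ^ q" using assms unfolding fits_check_def by blast+
  then have "real_of_int a \<le> real_of_int (512 * 2 ^ q)" by (simp only: of_int_le_iff)
  then have ar: "real_of_int a \<le> 512 * 2 ^ q" by simp
  show "0 \<le> param a" using a W_pos by (simp add: param_def)
  show "param a \<le> L" unfolding param_def L_num using ar W_pos by (intro divide_right_mono) auto
  fix m assume m: "m \<in> {1..q}"
  define j where "j = m mod q"
  define w :: int where "w = 2 ^ (if j = 0 then 0 else q - j)"
  have j: "j < q" using q_pos by (simp add: j_def)
  have jm: "(if j = 0 then 0 else q - j) = q - m" using m by (cases "m = q") (auto simp: j_def)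
  have w: "real_of_int w / 2 ^ q = 1 / 2 ^ m"
  proof -
    have "real_of_int w = 2 ^ (q - m)" unfolding w_def jm by simp
    then have "real_of_int w / 2 ^ q = 2 ^ (q - m) / 2 ^ q" by (simp only:)
    also have "\<dots> = 1 / 2 ^ m" using m by (simp add: power_diff)
    finally show ?thesis .
  qed
  let ?s = "start_num q la a" and ?x = "1024 * 2 ^ q * la ! j" and ?y = "1024 * 2 ^ q * right_end la q j"
    and ?h = "512 * 2 ^ q * denom q"
  have c: "?s \<le> ?x" "?x + a * w \<le> ?s + ?h" "?s \<le> ?y - (512 * 2 ^ q - a) * w" "?y \<le> ?s + ?h"
  proof -
    have "j \<in> set [0..<q]" using j by simp
    then show "?s \<le> ?x" "?x + a * w \<le> ?s + ?h" "?s \<le> ?y - (512 * 2 ^ q - a) * w" "?y \<le> ?s + ?h"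
      using assms unfolding fits_check_def list_all_iff fits_at_def fits_ineqs_def w_def by blast+
  qed
  have D: "x \<le> y \<Longrightarrow> real_of_int x / ?W \<le> real_of_int y / ?W" for x y
    using W by (intro divide_right_mono) auto
  have ex: "real_of_int ?x / ?W = left_pt la q m" using W_pos by (simp add: left_pt_def j_def)
  have ey: "real_of_int ?y / ?W = right_pt la q m" using W_pos m by (simp add: right_pt_def j_def)
  have eh: "real_of_int ?h / ?W = 1 / 2" using W_pos by simp
  have ew: "real_of_int (b * w) / ?W = real_of_int b / (1024 * denom q) / 2 ^ m" for b
  proof -
    have "real_of_int (b * w) / ?W = real_of_int b / (1024 * denom q) * (w / 2 ^ q)" by simp
    then show ?thesis unfolding w by simp
  qed
  show "start (param a) \<le> left_pt la q m" using D[OF c(1)] unfolding ex by (simp add: start_param)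
  show "left_pt la q m + param a / 2 ^ m \<le> start (param a) + 1 / 2"
    using D[OF c(2)] unfolding of_int_add add_divide_distrib ex eh ew
    unfolding start_param by (simp add: param_def)
  have "L - param a = real_of_int (512 * 2 ^ q - a) / (1024 * denom q)"
    by (simp add: L_num param_def diff_divide_distrib)
  then show "start (param a) \<le> right_pt la q m - (L - param a) / 2 ^ m"
    using D[OF c(3)] unfolding of_int_diff[of ?y] diff_divide_distrib[of "real_of_int ?y"] ey ew by (simp add: start_param)
  show "right_pt la q m \<le> start (param a) + 1 / 2"
    using D[OF c(4)] unfolding of_int_add add_divide_distrib ey eh by (simp add: start_param)
qed

lemma admissible_check_admissible:
  assumes "admissible_check q la a lo" "admissible_check q la a hi" "real_of_int lo \<le> x" "x \<le> real_of_int hi"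
  shows "admissible (x / 1024) (start (param a))"
proof -
  let ?W = "1024 * real_of_int (denom q) * 2 ^ q"
  have W: "?W > 0" using W_pos by simp
  have one: "\<bar>start (param a) + i / 1024 + 1 / 4\<bar> \<le> 37 / 400" if "admissible_check q la a i" for i
  proof -
    let ?n = "start_num q la a + (i + 256) * denom q * 2 ^ q"
    have "start (param a) + i / 1024 + 1 / 4 = ?n / ?W"
      unfolding start_param using W_pos by (simp add: field_simps)
    moreover have "real_of_int \<bar>400 * ?n\<bar> \<le> real_of_int (37 * 1024 * denom q * 2 ^ q)"
      using that unfolding admissible_check_def by (simp only: of_int_le_iff)
    then have "\<bar>400 * real_of_int ?n\<bar> \<le> 37 * ?W" by (simp only: of_int_abs of_int_mult of_int_power of_int_numeral mult.assoc)
    then have "400 * \<bar>real_of_int ?n\<bar> \<le> 37 * ?W" by (simp only: abs_mult abs_numeral)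
    then have "\<bar>real_of_int ?n\<bar> / ?W \<le> 37 / 400" using W by (simp add: divide_le_eq)
    ultimately show ?thesis using W by (simp add: abs_divide)
  qed
  have "lo / 1024 \<le> x / 1024" "x / 1024 \<le> hi / 1024" using assms(3,4) by (simp_all add: divide_right_mono)
  then show ?thesis using one[OF assms(1)] one[OF assms(2)] unfolding admissible_def abs_le_iff by linarith
qed

lemma arc_pts_props:
  assumes f: "fits (param a)" and adm: "admissible (i / 1024) (start (param a))" and m: "m > 0"
    and p: "arc_pts q la a i m = (p, x, y, r, d)"
  shows "d > 0" "\<bar>real_of_int p / d\<bar> \<le> 2 / 5" "\<bar>real_of_int x / d\<bar> \<le> 2 / 5"
    "\<bar>real_of_int y / d\<bar> \<le> 2 / 5" "\<bar>real_of_int r / d\<bar> \<le> 2 / 5"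
    "arc_diff (i / 1024) (param a) m = (logcos 0 (p / d) - logcos 0 (x / d)) + (logcos 0 (y / d) - logcos 0 (r / d))"
proof -
  have e: "x = (1024 * la ! (m mod q) + i * denom q) * 2 ^ m"
    "y = (1024 * right_end la q (m mod q) + i * denom q) * 2 ^ m"
    "p = x + a" "r = y - (512 * 2 ^ q - a)" "d = 1024 * denom q * 2 ^ m"
    using p by (auto simp: arc_pts_def arc_tuple_def)
  show d: "d > 0" using denom_pos[OF q_pos] by (simp add: e)
  let ?c = "real_of_int i / 1024"
  have xd: "x / d = left_pt la q m + ?c"
    using W_pos by (simp add: e left_pt_def field_simps)
  have yd: "y / d = right_pt la q m + ?c"
    using W_pos m by (simp add: e right_pt_def field_simps)
  have pd: "p / d = left_pt la q m + param a / 2 ^ m + ?c"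
    unfolding e(3) of_int_add add_divide_distrib xd by (simp add: e(5) param_def)
  have rd: "r / d = right_pt la q m - (L - param a) / 2 ^ m + ?c"
    unfolding e(4) of_int_diff[of y] diff_divide_distrib[of "real_of_int y"] yd
    by (simp add: e(5) param_def L_num diff_divide_distrib)
  have u: "0 \<le> param a" "param a \<le> L" using f by (auto simp: fits_def)
  then have u2: "0 \<le> param a / 2 ^ m" "0 \<le> (L - param a) / 2 ^ m" by simp_all
  show "\<bar>real_of_int p / d\<bar> \<le> 2 / 5" "\<bar>real_of_int x / d\<bar> \<le> 2 / 5"
    "\<bar>real_of_int y / d\<bar> \<le> 2 / 5" "\<bar>real_of_int r / d\<bar> \<le> 2 / 5"
    unfolding xd yd pd rd using fitsD[OF f m] adm u2 unfolding admissible_def abs_le_iff by linarith+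
  have g: "logcos 0 (z + ?c) = logcos ?c z" for z by (simp add: logcos_def)
  show "arc_diff ?c (param a) m = (logcos 0 (p / d) - logcos 0 (x / d)) + (logcos 0 (y / d) - logcos 0 (r / d))"
    unfolding xd yd pd rd g arc_diff_def ..
qed

lemma factor_bounds:
  assumes "fits (param a)" "admissible (i / 1024) (start (param a))" "m > 0"
  shows "0 \<le> pos_factor q la a i m \<and> real_of_int (pos_factor q la a i m) \<le> scale * exp (arc_diff (i / 1024) (param a) m)"
    and "0 \<le> neg_factor q la a i m \<and> real_of_int (neg_factor q la a i m) \<le> scale * exp (- arc_diff (i / 1024) (param a) m)"
proof -
  obtain p x y r d where p: "arc_pts q la a i m = (p, x, y, r, d)" using prod_cases5 by blast
  note P = arc_pts_props[OF assms p]
  show "0 \<le> pos_factor q la a i m \<and> real_of_int (pos_factor q la a i m) \<le> scale * exp (arc_diff (i / 1024) (param a) m)"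
    unfolding P(6) pos_factor_def p pos_of.simps
    using scaled_mult_le[OF cos_ratio_nonneg cos_ratio_nonneg cos_ratio_le[OF P(1,2,3)] cos_ratio_le[OF P(1,4,5)]]
    by simp
  have "- arc_diff (i / 1024) (param a) m = (logcos 0 (x / d) - logcos 0 (p / d)) + (logcos 0 (r / d) - logcos 0 (y / d))"
    unfolding P(6) by simp
  then show "0 \<le> neg_factor q la a i m \<and> real_of_int (neg_factor q la a i m) \<le> scale * exp (- arc_diff (i / 1024) (param a) m)"
    unfolding neg_factor_def p neg_of.simps
    using scaled_mult_le[OF cos_ratio_nonneg cos_ratio_nonneg cos_ratio_le[OF P(1,3,2)] cos_ratio_le[OF P(1,5,4)]]
    by simp
qed

lemma exceeds_imp_sum:
  assumes ex: "exceeds q M (map F [1..<Suc M])" and k: "6 * int q < 2 ^ M"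
    and F: "\<And>m. m > 0 \<Longrightarrow> 0 \<le> F m \<and> real_of_int (F m) \<le> scale * exp (G m)"
  shows "6 * q / 2 ^ M < (\<Sum>j<q. \<Sum>m\<in>{j<..M}. G m)"
proof -
  let ?xs = "map F [1..<Suc M]"
  have len: "length ?xs = M" by simp
  have nth: "?xs ! i = F (Suc i)" if "i < M" for i using that by (simp del: upt_Suc)
  have "0 \<le> ?xs ! i \<and> real_of_int (?xs ! i) \<le> scale * exp (G (Suc i))" if "i < length ?xs" for i
    using F[of "Suc i"] nth[of i] that unfolding len by simp
  from nested_prod_le[of ?xs "\<lambda>i. G (Suc i)" q, OF this]
  have "real_of_int (snd (nested_prod q ?xs)) \<le> scale * exp (\<Sum>j<q. \<Sum>i\<in>{j..<M}. G (Suc i))"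
    unfolding len by blast
  then have "real_of_int (6 * int q) / 2 ^ M < (\<Sum>j<q. \<Sum>i\<in>{j..<M}. G (Suc i))"
    by (rule exp_bound_imp_less[OF _ ex[unfolded exceeds_def] _ k]) simp
  moreover have "(\<Sum>i\<in>{j..<M}. G (Suc i)) = (\<Sum>m\<in>{j<..M}. G m)" for j
    by (rule sum.reindex_bij_witness[of _ "\<lambda>m. m - 1" Suc]) auto
  ultimately show ?thesis by simp
qed

lemma ex_subaction_of_checks:
  assumes fc: "fits_check q la a1" "fits_check q la a2" and lt: "a1 < a2"
    and ac: "admissible_check q la a1 lo" "admissible_check q la a1 hi"
      "admissible_check q la a2 lo" "admissible_check q la a2 hi"
    and M: "q \<le> M" "6 * int q < 2 ^ M"
    and e1: "exceeds q M (map (pos_factor q la a1 hi) [1..<Suc M])"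
    and e2: "exceeds q M (map (neg_factor q la a2 lo) [1..<Suc M])"
    and x: "real_of_int lo \<le> x" "x \<le> real_of_int hi"
  shows "\<exists>\<psi> \<beta> x0. subaction (x / 1024) \<psi> \<beta> x0 q"
proof -
  note f = fc[THEN fits_check_fits]
  have lh: "real_of_int lo \<le> real_of_int hi" using x by linarith
  note A1 = admissible_check_admissible[OF ac(1,2)] and A2 = admissible_check_admissible[OF ac(3,4)]
  have h1: "admissible (hi / 1024) (start (param a1))" using A1[OF lh] by simp
  have h2: "admissible (lo / 1024) (start (param a2))" using A2[OF _ lh] by simp
  have "6 * q / 2 ^ M < (\<Sum>j<q. \<Sum>m\<in>{j<..M}. arc_diff (hi / 1024) (param a1) m)"
    using factor_bounds(1)[OF f(1) h1] by (intro exceeds_imp_sum[OF e1 M(2)]) blast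
  then have "0 < integral {0..1} (branch_sum (hi / 1024) (start (param a1)))"
    using integral_branch_sum_approx[OF f(1) h1 M(1)] unfolding abs_le_iff by linarith
  also have "\<dots> \<le> integral {0..1} (branch_sum (x / 1024) (start (param a1)))"
    using x by (intro integral_branch_sum_antimono A1 h1) (auto simp: divide_right_mono)
  finally have J1: "0 < integral {0..1} (branch_sum (x / 1024) (start (param a1)))" .
  have "6 * q / 2 ^ M < (\<Sum>j<q. \<Sum>m\<in>{j<..M}. - arc_diff (lo / 1024) (param a2) m)"
    using factor_bounds(2)[OF f(2) h2] by (intro exceeds_imp_sum[OF e2 M(2)]) blast
  then have "integral {0..1} (branch_sum (lo / 1024) (start (param a2))) < 0"
    using integral_branch_sum_approx[OF f(2) h2 M(1)] unfolding abs_le_iff sum_negf by linarith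
  moreover have "integral {0..1} (branch_sum (x / 1024) (start (param a2)))
      \<le> integral {0..1} (branch_sum (lo / 1024) (start (param a2)))"
    using x by (intro integral_branch_sum_antimono A2 h2) (auto simp: divide_right_mono)
  ultimately have J2: "integral {0..1} (branch_sum (x / 1024) (start (param a2))) < 0" by linarith
  have "param a1 < param a2" using lt W_pos by (simp add: param_def divide_strict_right_mono)
  from ex_subaction_orbit[OF f this A1[OF x] A2[OF x] J1 J2] show ?thesis by blast
qed

end

lemma interval_check_subaction:
  assumes "interval_check q la js a1 a2 lo hi M" "lo \<le> i" "i \<le> hi"
  shows "\<exists>\<psi> \<beta> x0. subaction (real_of_int i / 1024) \<psi> \<beta> x0 q"
proof -
  have "real_of_int lo \<le> real_of_int i" "real_of_int i \<le> real_of_int hi" using assms by simp_all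
  then show ?thesis
    using assms(1) unfolding interval_check_def by (elim conjE) (rule ex_subaction_of_checks)
qed

subsection \<open>The orbits for \<open>0 \<le> c \<le> 1/2\<close>\<close>

text \<open>The fixed point 0 serves this and the next four intervals. For \<open>q = 1\<close> the
  full range of \<open>u\<close> moves \<open>start\<close> by 1/2, more than the admissible window
  of width 37/200, so the parameters are split and \<open>a1\<close>, \<open>a2\<close> bracket the
  zero of the mean more closely.\<close>

lemma interval_check_0_60: "interval_check 1 [0]
    [0] 335 525 0 60 8"
  by code_simp

lemma interval_check_61_105: "interval_check 1 [0]
    [0] 212 345 61 105 11"
  by code_simp

lemma interval_check_106_135: "interval_check 1 [0]
    [0] 124 220 106 135 9"
  by code_simp

lemma interval_check_136_161: "interval_check 1 [0]
    [0] 51 130 136 161 9"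
  by code_simp

lemma interval_check_162_179: "interval_check 1 [0]
    [0] 0 60 162 179 10"
  by code_simp

text \<open>From here up to the parameter 437, \<open>a1\<close> and \<open>a2\<close> are the
  extreme values \<open>u = 0\<close> and \<open>u = L\<close>. The position of 1 in
  \<open>js\<close>, divided by \<open>q\<close>, is the rotation number counted backwards; it is
  1/13 here and increases with \<open>c\<close> up to 1/2.\<close>

lemma interval_check_180: "interval_check 13 [-1, -4096, -2048, -1024, -512, -256, -128, -64, -32, -16, -8, -4, -2]
    [0, 1, 2, 3, 4, 5, 6, 7, 8, 9, 10, 11, 12] 0 4194304 180 180 16"
  by code_simp

lemma interval_check_181: "interval_check 11 [-1, -1024, -512, -256, -128, -64, -32, -16, -8, -4, -2]
    [0, 1, 2, 3, 4, 5, 6, 7, 8, 9, 10] 0 1048576 181 181 15"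
  by code_simp

lemma interval_check_182_183: "interval_check 10 [-1, -512, -256, -128, -64, -32, -16, -8, -4, -2]
    [0, 1, 2, 3, 4, 5, 6, 7, 8, 9] 0 524288 182 183 14"
  by code_simp

lemma interval_check_184_186: "interval_check 9 [-1, -256, -128, -64, -32, -16, -8, -4, -2]
    [0, 1, 2, 3, 4, 5, 6, 7, 8] 0 262144 184 186 14"
  by code_simp

lemma interval_check_187_191: "interval_check 8 [-1, -128, -64, -32, -16, -8, -4, -2]
    [0, 1, 2, 3, 4, 5, 6, 7] 0 131072 187 191 13"
  by code_simp

lemma interval_check_193_201: "interval_check 7 [-1, -64, -32, -16, -8, -4, -2]
    [0, 1, 2, 3, 4, 5, 6] 0 65536 193 201 13"
  by code_simp

lemma interval_check_202_218: "interval_check 6 [-1, -32, -16, -8, -4, -2]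
    [0, 1, 2, 3, 4, 5] 0 32768 202 218 15"
  by code_simp

lemma interval_check_219: "interval_check 11 [-33, -1040, -520, -260, -130, -65, -1056, -528, -264, -132, -66]
    [0, 6, 1, 7, 2, 8, 3, 9, 4, 10, 5] 0 1048576 219 219 15"
  by code_simp

lemma interval_check_220_247: "interval_check 5 [-1, -16, -8, -4, -2]
    [0, 1, 2, 3, 4] 0 16384 220 247 15"
  by code_simp

lemma interval_check_248_250: "interval_check 9 [-17, -264, -132, -66, -33, -272, -136, -68, -34]
    [0, 5, 1, 6, 2, 7, 3, 8, 4] 0 262144 248 250 15"
  by code_simp

lemma interval_check_251_297: "interval_check 4 [-1, -8, -4, -2]
    [0, 1, 2, 3] 0 8192 251 297 13"
  by code_simp

lemma interval_check_298: "interval_check 11 [-137, -1092, -546, -273, -1160, -580, -290, -145, -1096, -548, -274]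
    [0, 4, 8, 1, 5, 9, 2, 6, 10, 3, 7] 0 1048576 298 298 15"
  by code_simp

lemma interval_check_299_307: "interval_check 7 [-9, -68, -34, -17, -72, -36, -18]
    [0, 4, 1, 5, 2, 6, 3] 0 65536 299 307 14"
  by code_simp

lemma interval_check_308: "interval_check 10 [-73, -548, -274, -137, -580, -290, -145, -584, -292, -146]
    [0, 7, 4, 1, 8, 5, 2, 9, 6, 3] 0 524288 308 308 13"
  by code_simp

lemma interval_check_310_389: "interval_check 3 [-1, -4, -2]
    [0, 1, 2] 0 4096 310 389 12"
  by code_simp

lemma interval_check_392_396: "interval_check 8 [-37, -146, -73, -164, -82, -41, -148, -74]
    [0, 3, 6, 1, 4, 7, 2, 5] 0 131072 392 396 15"
  by code_simp

lemma interval_check_397_423: "interval_check 5 [-5, -18, -9, -20, -10]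
    [0, 3, 1, 4, 2] 0 16384 397 423 12"
  by code_simp

lemma interval_check_424: "interval_check 12 [-661, -2378, -1189, -2642, -1321, -2708, -1354, -677, -2386, -1193, -2644, -1322]
    [0, 5, 10, 3, 8, 1, 6, 11, 4, 9, 2, 7] 0 2097152 424 424 16"
  by code_simp

lemma interval_check_425_433: "interval_check 7 [-21, -74, -37, -82, -41, -84, -42]
    [0, 5, 3, 1, 6, 4, 2] 0 65536 425 433 13"
  by code_simp

lemma interval_check_434_436: "interval_check 9 [-85, -298, -149, -330, -165, -338, -169, -340, -170]
    [0, 7, 5, 3, 1, 8, 6, 4, 2] 0 262144 434 436 14"
  by code_simp

lemma interval_check_437: "interval_check 11 [-341, -1194, -597, -1322, -661, -1354, -677, -1362, -681, -1364, -682]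
    [0, 9, 7, 5, 3, 1, 10, 8, 6, 4, 2] 0 1048576 437 437 14"
  by code_simp

text \<open>For \<open>q = 2\<close> the full range of \<open>u\<close> moves \<open>start\<close>
  by 1/6, which together with the spread of \<open>c\<close> exceeds the admissible window; hence
  \<open>a1 > 0\<close>.\<close>

lemma interval_check_438_512: "interval_check 2 [-1, -2]
    [0, 1] 921 2048 438 512 12"
  by code_simp

lemma interval_check_exhausted:
  assumes "interval_check q la js a1 a2 lo hi M"
    and "\<nexists>\<psi> \<beta> x0 q. subaction (real_of_int i / 1024) \<psi> \<beta> x0 q" and "lo \<le> i"
  shows "hi + 1 \<le> i"
  using interval_check_subaction[OF assms(1,3)] assms(2) by (cases "i \<le> hi") auto

text \<open>Arguing by contradiction, each certificate raises the lower bound for \<open>i\<close>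
  past its interval. The gaps between consecutive intervals consist exactly of 192, 309, 390 and
  391.\<close>

lemma ex_subaction_half:
  fixes i :: int
  assumes "0 \<le> i" "i \<le> 512" "i \<notin> {192, 309, 390, 391}"
  shows "\<exists>\<psi> \<beta> x0 q. subaction (real_of_int i / 1024) \<psi> \<beta> x0 q"
proof (rule ccontr)
  assume no: "\<nexists>\<psi> \<beta> x0 q. subaction (real_of_int i / 1024) \<psi> \<beta> x0 q"
  have "61 \<le> i" using interval_check_exhausted[OF interval_check_0_60 no] assms(1) by simp
  then have "106 \<le> i" using interval_check_exhausted[OF interval_check_61_105 no] by simp
  then have "136 \<le> i" using interval_check_exhausted[OF interval_check_106_135 no] by simp
  then have "162 \<le> i" using interval_check_exhausted[OF interval_check_136_161 no] by simp
  then have "180 \<le> i" using interval_check_exhausted[OF interval_check_162_179 no] by simp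
  then have "181 \<le> i" using interval_check_exhausted[OF interval_check_180 no] by simp
  then have "182 \<le> i" using interval_check_exhausted[OF interval_check_181 no] by simp
  then have "184 \<le> i" using interval_check_exhausted[OF interval_check_182_183 no] by simp
  then have "187 \<le> i" using interval_check_exhausted[OF interval_check_184_186 no] by simp
  then have "192 \<le> i" using interval_check_exhausted[OF interval_check_187_191 no] by simp
  then have "193 \<le> i" using assms(3) by auto
  then have "202 \<le> i" using interval_check_exhausted[OF interval_check_193_201 no] by simp
  then have "219 \<le> i" using interval_check_exhausted[OF interval_check_202_218 no] by simp
  then have "220 \<le> i" using interval_check_exhausted[OF interval_check_219 no] by simp
  then have "248 \<le> i" using interval_check_exhausted[OF interval_check_220_247 no] by simp
  then have "251 \<le> i" using interval_check_exhausted[OF interval_check_248_250 no] by simp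
  then have "298 \<le> i" using interval_check_exhausted[OF interval_check_251_297 no] by simp
  then have "299 \<le> i" using interval_check_exhausted[OF interval_check_298 no] by simp
  then have "308 \<le> i" using interval_check_exhausted[OF interval_check_299_307 no] by simp
  then have "309 \<le> i" using interval_check_exhausted[OF interval_check_308 no] by simp
  then have "310 \<le> i" using assms(3) by auto
  then have "390 \<le> i" using interval_check_exhausted[OF interval_check_310_389 no] by simp
  then have "392 \<le> i" using assms(3) by auto
  then have "397 \<le> i" using interval_check_exhausted[OF interval_check_392_396 no] by simp
  then have "424 \<le> i" using interval_check_exhausted[OF interval_check_397_423 no] by simp
  then have "425 \<le> i" using interval_check_exhausted[OF interval_check_424 no] by simp
  then have "434 \<le> i" using interval_check_exhausted[OF interval_check_425_433 no] by simp
  then have "437 \<le> i" using interval_check_exhausted[OF interval_check_434_436 no] by simp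
  then have "438 \<le> i" using interval_check_exhausted[OF interval_check_437 no] by simp
  then have "513 \<le> i" using interval_check_exhausted[OF interval_check_438_512 no] by simp
  then show False using assms(2) by simp
qed

text \<open>Reflection followed by a shift by one turn takes \<open>c\<close> to
  \<open>1 - c\<close>, and the excluded set is invariant under
  \<open>n \<mapsto> 1024 - n\<close>.\<close>

lemma ex_subaction_Lambda10:
  assumes "c \<in> Lambda10 - Lambda10U"
  shows "\<exists>\<psi> \<beta> x0 q. subaction c \<psi> \<beta> x0 q"
proof -
  obtain n where n: "c = real n / 1024" "n \<le> 1023" using assms by (auto simp: Lambda10_def)
  have U: "n \<notin> {192, 309, 390, 391, 832, 715, 634, 633}"
    using assms n(1) by (auto simp: Lambda10U_def)
  show ?thesis
  proof (cases "n \<le> 512")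
    case True
    then have "int n \<notin> {192, 309, 390, 391}" using U by auto
    then show ?thesis using ex_subaction_half[of "int n"] True unfolding n(1) by simp
  next
    case False
    define i where "i = 1024 - int n"
    have "0 \<le> i" "i \<le> 512" "i \<notin> {192, 309, 390, 391}" using False U n(2) by (auto simp: i_def)
    then obtain \<psi> \<beta> x0 q where "subaction (real_of_int i / 1024) \<psi> \<beta> x0 q" using ex_subaction_half by blast
    then have "subaction (- (real_of_int i / 1024) + 1) (\<lambda>x. \<psi> (- x)) \<beta> (- x0) q"
      by (intro subaction_shift subaction_mirror) auto
    moreover have "- (real_of_int i / 1024) + 1 = c" by (simp add: i_def n(1) field_simps)
    ultimately show ?thesis by auto
  qed
qed

theorem mainTheorem3:
  fixes c :: real
  assumes "c \<in> Lambda10 - Lambda10U"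
  shows "\<exists>\<mu>. maximizing doubling (potential c) \<mu>
    \<and> (\<forall>\<nu>. maximizing doubling (potential c) \<nu> \<longrightarrow> \<nu> = \<mu>)
    \<and> periodic_measure doubling \<mu>
    \<and> (\<exists>\<Delta>. is_gelfond_exponent c \<Delta>
          \<and> ereal \<Delta> = 1 + ext_integral \<mu> (potential c) / ereal (ln 2))"
proof -
  obtain \<psi> \<beta> x0 q where "subaction c \<psi> \<beta> x0 q" using ex_subaction_Lambda10[OF assms] by blast
  then show ?thesis by (rule subaction.maximizing_and_gelfond)
qed

end
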